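(* Let $d\ge 3$. There exists a constant $\alpha=\alpha(d)>0$ such that the following holds. Let $(d_i:1\le i\le n)$ be a sequence of integers with $\sum_i d_i$ even and $3\le d_i\le d$ for all $i\in[n]$, and let $G=([n],E)$ be a random graph chosen from the uniform distribution over all labeled (simple) graphs on $[n]$ in which the degree of vertex $i$ equals $d_i$ for every $i\in[n]$. Then $$\mathrm{P}[T_3(G)\text{ contains a connected component of size at least }\alpha n]=1-\exp(-\Omega(n)),$$ where the probability is taken jointly over the choice of $G$ and of the ages of the vertices.
   Context: $[n]:=\{1,\ldots,n\}$. Layers model: given a graph $G=(V,E)$, let $(X_v)_{v\in V}$ be i.i.d. Uniform$[0,1]$ random variables ("ages"), here independent of the choice of $G$. For an integer $k\ge1$, $T_k(G)$ is the (random) set of vertices $v$ having at most $k-1$ neighbors $u$ with $X_u<X_v$; $T_k(G)$ also denotes the subgraph of $G$ induced on this set. The statement is asymptotic as $n\to\infty$ with $d$ fixed: $1-\exp(-\Omega(n))$ means at least $1-e^{-cn}$ for all sufficiently large $n$, for some constant $c>0$ that does not depend on $n$ or on the degree sequence (it may depend on $d$). *)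

theory Defs
  imports "HOL-Probability.Probability" "Graph_Theory.Digraph_Component"
begin

text \<open>
  Finite simple graphs are represented by \<^locale>\<open>pair_graph\<close>: a finite vertex set with a
  symmetric irreflexive adjacency relation \<^const>\<open>parcs\<close>. The undirected edge \<open>{u, v}\<close> is the
  pair of arcs \<open>(u, v)\<close> and \<open>(v, u)\<close>, so the degree of a vertex is its out-degree.
\<close>

definition graphs_with_degrees :: "nat \<Rightarrow> (nat \<Rightarrow> nat) \<Rightarrow> nat pair_pre_digraph set" where
  "graphs_with_degrees n deg =
     {G. pair_graph G \<and> pverts G = {1..n} \<and> (\<forall>i\<in>{1..n}. out_degree (with_proj G) i = deg i)}"

text \<open>Only used for \<open>k \<ge> 1\<close>; the subtraction is on natural numbers.\<close>

definition layer :: "nat \<Rightarrow> 'a pair_pre_digraph \<Rightarrow> ('a \<Rightarrow> real) \<Rightarrow> 'a set" where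
  "layer k G X = {v \<in> pverts G. card {u \<in> pverts G. (u, v) \<in> parcs G \<and> X u < X v} \<le> k - 1}"

definition layer_graph ::
    "nat \<Rightarrow> 'a pair_pre_digraph \<Rightarrow> ('a \<Rightarrow> real) \<Rightarrow> ('a, 'a \<times> 'a) pre_digraph" where
  "layer_graph k G X = with_proj G \<restriction> layer k G X"

text \<open>
  A connected component is a maximal connected subgraph. The qualified name separates graph
  connectedness from topological connectedness.
\<close>

definition is_component :: "('a, 'b) pre_digraph \<Rightarrow> ('a, 'b) pre_digraph \<Rightarrow> bool" where
  "is_component H C \<longleftrightarrow> pre_digraph.max_subgraph H Digraph_Component.connected C"

definition age_measure :: "'a set \<Rightarrow> ('a \<Rightarrow> real) measure" where
  "age_measure V = (\<Pi>\<^sub>M v\<in>V. uniform_measure lborel {0..1})"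

text \<open>
  The product measure makes the ages independent of the graph. If no graph has the given degrees,
  the first factor is the null measure on the empty space, so every event has measure \<open>0\<close>.
\<close>

definition graph_age_measure ::
    "nat \<Rightarrow> (nat \<Rightarrow> nat) \<Rightarrow> (nat pair_pre_digraph \<times> (nat \<Rightarrow> real)) measure" where
  "graph_age_measure n deg =
     uniform_count_measure (graphs_with_degrees n deg) \<Otimes>\<^sub>M age_measure {1..n}"

end

theory Submission
  imports Defs
begin

text \<open>
  Along a non-backtracking path, a vertex of degree \<open>D\<close> certainly lies in \<open>T\<^sub>3\<close> if it is earlier than
  its \<open>D - 2\<close> neighbours off the path. This has probability \<open>1 / (D - 1)\<close>, independently for the
  vertices of a path in a tree, which is exactly critical; allowing one earlier neighbour off the
  path when the next vertex of the path is later makes it supercritical. A weighted second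
  moment argument, in which the weights are those of non-backtracking random walk, then bounds the
  probability that \<open>T\<^sub>3\<close> contains a path of length \<open>L\<close> along a given branch from below,
  uniformly in \<open>L\<close>. Hence linearly many vertices start three such paths.

  Keep the edges of \<open>T\<^sub>3\<close> that extend to paths of length \<open>L\<close> in both directions. For a suitable bounded
  \<open>L\<close> this subgraph has linearly more edges than vertices, so linearly many edges close cycles
  over a spanning forest. If all components had fewer than \<open>\<alpha> n\<close> vertices, each closing edge would
  join two vertices of a small tree. Switchings show that this has probability about
  \<open>\<alpha>\<close> per closing edge, which for small \<open>\<alpha>\<close> beats the exponential number of choices of the forest.
  The same bound shows that most vertices have tree-like neighbourhoods.
\<close>


section \<open>Switchings\<close>

text \<open>Survival must be bounded uniformly in \<open>L\<close> because passing from branches to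
  a dense subgraph with walks of length up to \<open>M\<close> loses up to n / M arcs. So a fixed
  fraction of the vertices has to start three walks whose length is of the order of the inverse of
  that fraction. A critical process would not do: writing the survival probability as 1 / Q, without
  gain the second moment recursion is Q \<mapsto> Q + d ^ 4, which grows linearly in the depth. A
  gain by a factor 1 + g per step turns it into Q \<mapsto> Q / (1 + g) + d ^ 4, which has a fixed
  point. Degrees vary along a branch, so plain path counts have no controlled mean; the weights of
  non-backtracking walk have total 1 at every step, whatever the degrees are. Hence the order of the
  constants: the fraction depends on \<open>d\<close> only, then come the length, the radius of the
  tree-like balls, and last \<alpha>. The two sources of randomness are kept apart: switchings
  discard a fraction of order exp (- n) of all graphs, and for every other graph only the ages are
  random.\<close>

definition deg_graphs :: "'a set \<Rightarrow> ('a \<Rightarrow> nat) \<Rightarrow> ('a \<times> 'a) set set" where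
  "deg_graphs V deg =
     {E. E \<subseteq> V \<times> V \<and> sym E \<and> irrefl E \<and> (\<forall>i\<in>V. card (E `` {i}) = deg i)}"

definition switch :: "'a \<Rightarrow> 'a \<Rightarrow> 'a \<Rightarrow> 'a \<Rightarrow> ('a \<times> 'a) set \<Rightarrow> ('a \<times> 'a) set" where
  "switch x y u v E = E - {(x, y), (y, x), (u, v), (v, u)} \<union> {(x, u), (u, x), (y, v), (v, y)}"

lemma finite_deg_graphs: "finite V \<Longrightarrow> finite (deg_graphs V deg)"
  by (rule finite_subset[of _ "Pow (V \<times> V)"]) (auto simp: deg_graphs_def)

lemma card_eq_sum_Image:
  assumes "finite V" "finite E" "E \<subseteq> V \<times> V"
  shows "card E = (\<Sum>v\<in>V. card (E `` {v}))"
proof -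
  have "E = (SIGMA v:V. E `` {v})" using assms by auto
  then have "card E = card (SIGMA v:V. E `` {v})" by simp
  also have "\<dots> = (\<Sum>v\<in>V. card (E `` {v}))"
    using assms by (intro card_SigmaI) (auto intro: finite_Image)
  finally show ?thesis .
qed

lemma card_swap_element:
  assumes "finite A" "a \<in> A" "b \<notin> A"
  shows "card (insert b (A - {a})) = card A"
  using assms by (metis Diff_iff card_Suc_Diff1 card_insert_disjoint finite_Diff)

lemma card_relation_left_le:
  assumes "finite E" "finite A" "\<And>u. u \<in> A \<Longrightarrow> card (E `` {u}) \<le> d"
  shows "card {(u, v) \<in> E. u \<in> A} \<le> card A * d"
proof -
  have "{(u, v) \<in> E. u \<in> A} = (SIGMA u:A. E `` {u})" by auto
  then have "card {(u, v) \<in> E. u \<in> A} = (\<Sum>u\<in>A. card (E `` {u}))"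
    using assms by (auto intro!: card_SigmaI simp: finite_Image)
  also have "\<dots> \<le> (\<Sum>u\<in>A. d)" by (intro sum_mono assms)
  finally show ?thesis by simp
qed

lemma card_relation_right_le:
  assumes "sym E" "finite E" "finite A" "\<And>u. u \<in> A \<Longrightarrow> card (E `` {u}) \<le> d"
  shows "card {(u, v) \<in> E. v \<in> A} \<le> card A * d"
proof -
  have "{(u, v) \<in> E. v \<in> A} = prod.swap ` {(u, v) \<in> E. u \<in> A}"
    using \<open>sym E\<close> by (force simp: sym_def image_iff)
  then have "card {(u, v) \<in> E. v \<in> A} = card {(u, v) \<in> E. u \<in> A}"
    by (simp add: card_image)
  also have "\<dots> \<le> card A * d" using assms(2-) by (rule card_relation_left_le)
  finally show ?thesis .
qed

lemma switch_deg_graphs: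
  assumes E: "E \<in> deg_graphs V deg" and "finite V"
    and xy: "(x, y) \<in> E" and uv: "(u, v) \<in> E"
    and ne: "u \<notin> {x, y}" "v \<notin> {x, y}" and nE: "(x, u) \<notin> E" "(y, v) \<notin> E"
  shows "switch x y u v E \<in> deg_graphs V deg"
proof -
  have sub: "E \<subseteq> V \<times> V" and symE: "\<And>a b. (a, b) \<in> E \<longleftrightarrow> (b, a) \<in> E" and ir: "\<And>a. (a, a) \<notin> E"
    and dg: "\<And>i. i \<in> V \<Longrightarrow> card (E `` {i}) = deg i"
    using E unfolding deg_graphs_def sym_def irrefl_def by blast+
  have finE: "finite E" using sub \<open>finite V\<close> finite_subset by blast
  have fin: "finite (E `` {i})" for i using finE by (rule finite_Image)
  have xy': "x \<noteq> y" "u \<noteq> v" using xy uv ir by auto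
  let ?E = "switch x y u v E"
  have "card (?E `` {i}) = card (E `` {i})" if "i \<in> V" for i
  proof -
    consider "i = x" | "i = y" | "i = u" | "i = v" | "i \<notin> {x, y, u, v}" by blast
    then show ?thesis
    proof cases
      case 1
      have "?E `` {i} = insert u (E `` {i} - {y})"
        unfolding 1 switch_def using xy' ne by auto
      moreover have "card \<dots> = card (E `` {i})"
        using fin xy nE 1 by (intro card_swap_element) auto
      ultimately show ?thesis by simp
    next
      case 2
      have "?E `` {i} = insert v (E `` {i} - {x})"
        unfolding 2 switch_def using xy' ne by auto
      moreover have "card \<dots> = card (E `` {i})"
        using fin xy nE 2 symE by (intro card_swap_element) auto
      ultimately show ?thesis by simp
    next
      case 3
      have "?E `` {i} = insert x (E `` {i} - {v})"
        unfolding 3 switch_def using xy' ne by auto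
      moreover have "card \<dots> = card (E `` {i})"
        using fin uv nE 3 symE by (intro card_swap_element) auto
      ultimately show ?thesis by simp
    next
      case 4
      have "?E `` {i} = insert y (E `` {i} - {u})"
        unfolding 4 switch_def using xy' ne by auto
      moreover have "card \<dots> = card (E `` {i})"
        using fin uv nE 4 symE by (intro card_swap_element) auto
      ultimately show ?thesis by simp
    next
      case 5
      have "?E `` {i} = E `` {i}" using 5 by (auto simp: switch_def)
      then show ?thesis by simp
    qed
  qed
  moreover have "?E \<subseteq> V \<times> V" using sub xy uv by (auto simp: switch_def)
  moreover have "sym ?E" using symE unfolding switch_def sym_def by blast
  moreover have "irrefl ?E" using ir ne unfolding switch_def irrefl_def by auto
  ultimately show ?thesis using dg unfolding deg_graphs_def by simp
qed

text \<open>Given \<open>x\<close>, \<open>y\<close>, \<open>u\<close>, \<open>v\<close>, a graph is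
  recovered from its switched version; this makes switching injective in the double count of
  \<open>switching_bound\<close>.\<close>

lemma switch_inverse:
  assumes "sym E" "(x, y) \<in> E" "(u, v) \<in> E" "(x, u) \<notin> E" "(y, v) \<notin> E"
  shows "E = switch x y u v E - {(x, u), (u, x), (y, v), (v, y)} \<union> {(x, y), (y, x), (u, v), (v, u)}"
proof -
  have "(y, x) \<in> E" "(v, u) \<in> E" "(u, x) \<notin> E" "(v, y) \<notin> E"
    using assms unfolding sym_def by blast+
  with assms show ?thesis unfolding switch_def by auto
qed

text \<open>Minimum degree 3 gives at least 3 n arcs, n = \<open>card V\<close>. Excluding
  \<open>F\<close> and its converse costs at most 5 n / 2, and the four conditions at
  \<open>x\<close> and \<open>y\<close> cost at most 4 d + 2 d^2, which \<open>large\<close> makes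
  at most n / 4. So n / 4 arcs remain.\<close>

lemma switch_arcs_many:
  assumes E: "E \<in> deg_graphs V deg" and "finite V"
    and deg: "\<And>i. i \<in> V \<Longrightarrow> 3 \<le> deg i \<and> deg i \<le> d"
    and F: "finite F" "card F \<le> 5 * card V / 4" and xy: "x \<in> V" "y \<in> V"
    and large: "card V \<ge> 16 * d + 8 * d\<^sup>2"
  shows "real (card {(u, v) \<in> E. (u, v) \<notin> F \<union> F\<inverse> \<and> u \<notin> {x, y} \<and> v \<notin> {x, y} \<and> (x, u) \<notin> E \<and> (y, v) \<notin> E})
     \<ge> card V / 4"
proof -
  let ?W = "{(u, v) \<in> E. (u, v) \<notin> F \<union> F\<inverse> \<and> u \<notin> {x, y} \<and> v \<notin> {x, y} \<and> (x, u) \<notin> E \<and> (y, v) \<notin> E}"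
  have sub: "E \<subseteq> V \<times> V" and symE: "sym E" 
    and dg: "\<And>i. i \<in> V \<Longrightarrow> card (E `` {i}) = deg i"
    using E unfolding deg_graphs_def by blast+
  have finE: "finite E" using sub \<open>finite V\<close> finite_subset by blast
  have fin: "finite (E `` {i})" for i using finE by (rule finite_Image)
  have EV: "E `` {i} \<subseteq> V" for i using sub by auto
  have le: "card (E `` {i}) \<le> d" if "i \<in> V" for i using deg dg that by simp
  have dd: "card {(u, v) \<in> E. u \<in> {x, y}} \<le> 2 * d" 
  proof -
    have "card {(u, v) \<in> E. u \<in> {x, y}} \<le> card {x, y} * d"
      using xy le by (intro card_relation_left_le finE) auto
    also have "\<dots> \<le> 2 * d" by (intro mult_right_mono) (auto simp: card_insert_if)
    finally show ?thesis .
  qed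
  have dd': "card {(u, v) \<in> E. v \<in> {x, y}} \<le> 2 * d" 
  proof -
    have "card {(u, v) \<in> E. v \<in> {x, y}} \<le> card {x, y} * d"
      using xy le by (intro card_relation_right_le finE symE) auto
    also have "\<dots> \<le> 2 * d" by (intro mult_right_mono) (auto simp: card_insert_if)
    finally show ?thesis .
  qed
  have d2: "card {(u, v) \<in> E. u \<in> E `` {x}} \<le> d\<^sup>2"
  proof -
    have "card {(u, v) \<in> E. u \<in> E `` {x}} \<le> card (E `` {x}) * d"
      using le EV by (intro card_relation_left_le finE fin) blast
    also have "\<dots> \<le> d * d" by (intro mult_right_mono le xy) auto
    finally show ?thesis by (simp add: power2_eq_square)
  qed
  have d2': "card {(u, v) \<in> E. v \<in> E `` {y}} \<le> d\<^sup>2"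
  proof -
    have "card {(u, v) \<in> E. v \<in> E `` {y}} \<le> card (E `` {y}) * d"
      using le EV by (intro card_relation_right_le finE fin symE) blast
    also have "\<dots> \<le> d * d" by (intro mult_right_mono le xy) auto
    finally show ?thesis by (simp add: power2_eq_square)
  qed
  have "card E = (\<Sum>i\<in>V. card (E `` {i}))" by (rule card_eq_sum_Image) fact+
  also have "\<dots> \<ge> (\<Sum>i\<in>V. 3)" using dg deg by (intro sum_mono) simp
  finally have E3: "card E \<ge> 3 * card V" by simp
  have "E \<subseteq> ?W \<union> (F \<union> F\<inverse> \<union> {(u, v) \<in> E. u \<in> {x, y}} \<union> {(u, v) \<in> E. v \<in> {x, y}} \<union>
      {(u, v) \<in> E. u \<in> E `` {x}} \<union> {(u, v) \<in> E. v \<in> E `` {y}})" by blast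
  then have "card E \<le> card (?W \<union> (F \<union> F\<inverse> \<union> {(u, v) \<in> E. u \<in> {x, y}} \<union> {(u, v) \<in> E. v \<in> {x, y}} \<union>
      {(u, v) \<in> E. u \<in> E `` {x}} \<union> {(u, v) \<in> E. v \<in> E `` {y}}))"
    using finE F by (intro card_mono finite_UnI) (auto intro: finite_subset[OF _ finE])
  also have "\<dots> \<le> card ?W + ((card F + card F + 2 * d + 2 * d + d\<^sup>2 + d\<^sup>2))"
    using dd dd' d2 d2' by (intro order_trans[OF card_Un_le] add_mono order_refl) simp_all
  finally have "real (3 * card V) \<le> real (card ?W + ((card F + card F + 2 * d + 2 * d + d\<^sup>2 + d\<^sup>2)))"
    using E3 by linarith
  moreover have "real (card V) \<ge> real (16 * d + 8 * d\<^sup>2)" using large by linarith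
  ultimately show ?thesis using F(2) by simp
qed

text \<open>Double counting. A graph containing the edge xy has at least n / 4 switchings that
  remove this edge and keep \<open>F\<close>. In the resulting graph \<open>u\<close> is a neighbour
  of \<open>x\<close> and \<open>v\<close> one of \<open>y\<close>, so at most d^2 switchings lead
  to the same graph. Given that \<open>F\<close> is present, a further edge is thus present with
  probability at most 4 d^2 / n.\<close>

lemma switching_bound:
  assumes "finite V" and deg: "\<And>i. i \<in> V \<Longrightarrow> 3 \<le> deg i \<and> deg i \<le> d"
    and F: "finite F" "card F \<le> 5 * card V / 4" and xy: "x \<in> V" "y \<in> V"
    and large: "card V \<ge> 16 * d + 8 * d\<^sup>2" and new: "(x, y) \<notin> F \<union> F\<inverse>"
  shows "card V * card {E \<in> deg_graphs V deg. insert (x, y) F \<subseteq> E}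
           \<le> 4 * d\<^sup>2 * card {E \<in> deg_graphs V deg. F \<subseteq> E}"
proof -
  let ?A = "{E \<in> deg_graphs V deg. insert (x, y) F \<subseteq> E}" and ?B = "{E \<in> deg_graphs V deg. F \<subseteq> E}"
  define W where "W E = {(u, v) \<in> E. (u, v) \<notin> F \<union> F\<inverse> \<and> u \<notin> {x, y} \<and> v \<notin> {x, y}
      \<and> (x, u) \<notin> E \<and> (y, v) \<notin> E}" for E
  let ?T = "SIGMA E:?B. E `` {x} \<times> E `` {y}"
  have finG: "finite (deg_graphs V deg)" using \<open>finite V\<close> by (rule finite_deg_graphs)
  have finE: "finite E" if "E \<in> deg_graphs V deg" for E
    using that \<open>finite V\<close> unfolding deg_graphs_def by (auto intro: finite_subset)
  have symE: "sym E" if "E \<in> deg_graphs V deg" for E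
    using that unfolding deg_graphs_def by auto
  let ?f = "\<lambda>(E, u, v). (switch x y u v E, u, v)"
  have "inj_on ?f (SIGMA E:?A. W E)"
  proof (rule inj_onI)
    fix q q' assume q: "q \<in> (SIGMA E:?A. W E)" "q' \<in> (SIGMA E:?A. W E)" "?f q = ?f q'"
    obtain E u v E' u' v' where qs: "q = (E, u, v)" "q' = (E', u', v')"
      by (metis prod_cases3)
    with q have *: "E \<in> deg_graphs V deg" "E' \<in> deg_graphs V deg" "insert (x, y) F \<subseteq> E" "insert (x, y) F \<subseteq> E'"
      "(u, v) \<in> W E" "(u', v') \<in> W E'"
      "?f (E, u, v) = ?f (E', u', v')"
      by auto
    then have uv: "u' = u" "v' = v" "switch x y u v E = switch x y u v E'" by auto
    have "E = switch x y u v E - {(x, u), (u, x), (y, v), (v, y)} \<union> {(x, y), (y, x), (u, v), (v, u)}"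
      using * symE by (intro switch_inverse) (auto simp: W_def)
    moreover have "E' = switch x y u v E' - {(x, u), (u, x), (y, v), (v, y)} \<union> {(x, y), (y, x), (u, v), (v, u)}"
      using * symE uv by (intro switch_inverse) (auto simp: W_def)
    ultimately show "q = q'" using uv qs by argo
  qed
  moreover have "?f ` (SIGMA E:?A. W E) \<subseteq> ?T"
  proof
    fix q assume "q \<in> ?f ` (SIGMA E:?A. W E)"
    then obtain E u v where E: "E \<in> deg_graphs V deg" and sub: "insert (x, y) F \<subseteq> E" and "(u, v) \<in> W E"
      and q: "q = (switch x y u v E, u, v)" by auto
    then have uv: "(u, v) \<in> E" "(u, v) \<notin> F \<union> F\<inverse>" "u \<notin> {x, y}" "v \<notin> {x, y}" "(x, u) \<notin> E" "(y, v) \<notin> E"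
      by (auto simp: W_def)
    have "switch x y u v E \<in> deg_graphs V deg"
      using E sub uv \<open>finite V\<close> by (intro switch_deg_graphs) auto
    moreover have "F \<subseteq> switch x y u v E" using sub uv new unfolding switch_def by auto
    moreover have "(x, u) \<in> switch x y u v E" "(y, v) \<in> switch x y u v E"
      by (auto simp: switch_def)
    ultimately show "q \<in> ?T" unfolding q by auto
  qed
  moreover have finT: "finite ?T" using finG finE by (auto intro!: finite_SigmaI finite_Image)
  ultimately have "card (SIGMA E:?A. W E) \<le> card ?T" by (rule card_inj_on_le)
  also have "card ?T = (\<Sum>E\<in>?B. card (E `` {x}) * card (E `` {y}))"
    using finG finE by (subst card_SigmaI) (auto intro!: finite_Image simp: card_cartesian_product)
  also have "\<dots> \<le> (\<Sum>E\<in>?B. d * d)"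
    using xy deg by (intro sum_mono mult_mono) (auto simp: deg_graphs_def)
  also have "\<dots> = d\<^sup>2 * card ?B" by (simp add: power2_eq_square)
  finally have "real (card (SIGMA E:?A. W E)) \<le> real (d\<^sup>2 * card ?B)" by linarith
  moreover have "real (card (SIGMA E:?A. W E)) = (\<Sum>E\<in>?A. real (card (W E)))"
    using finG finE by (subst card_SigmaI) (auto intro: finite_subset[of _ E for E] simp: W_def)
  moreover have "\<dots> \<ge> (\<Sum>E\<in>?A. card V / 4)"
    unfolding W_def using assms by (intro sum_mono switch_arcs_many) auto
  ultimately have "real (card ?A) * (card V / 4) \<le> real (d\<^sup>2 * card ?B)" by simp
  then have "real (card V * card ?A) \<le> real (4 * d\<^sup>2 * card ?B)" by (simp add: mult.commute)
  then show ?thesis by (simp only: of_nat_le_iff)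
qed

text \<open>The pairs of \<open>R\<close> are exposed one at a time, those already treated joining
  the forced set. The condition \<open>x < y\<close> keeps the reverse of a pair out of
  \<open>R\<close>, so that each pair is new when its turn comes.\<close>

lemma switching_bound_iterated:
  fixes R :: "('a :: linorder \<times> 'a) set"
  assumes "finite V" and deg: "\<And>i. i \<in> V \<Longrightarrow> 3 \<le> deg i \<and> deg i \<le> d"
    and "finite F" and "finite R" and "card F + card R \<le> 5 * card V / 4"
    and large: "card V \<ge> 16 * d + 8 * d\<^sup>2"
    and R: "\<And>x y. (x, y) \<in> R \<Longrightarrow> x \<in> V \<and> y \<in> V \<and> x < y \<and> (x, y) \<notin> F \<union> F\<inverse>"
  shows "card V ^ card R * card {E \<in> deg_graphs V deg. F \<union> R \<subseteq> E}
           \<le> (4 * d\<^sup>2) ^ card R * card {E \<in> deg_graphs V deg. F \<subseteq> E}"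
  using \<open>finite R\<close> assms(5) R
proof (induction R rule: finite_induct)
  case empty
  then show ?case by simp
next
  case (insert p R)
  obtain x y where p: "p = (x, y)" by (cases p)
  have cR: "card (insert p R) = Suc (card R)" using insert by simp
  have IH: "card V ^ card R * card {E \<in> deg_graphs V deg. F \<union> R \<subseteq> E}
           \<le> (4 * d\<^sup>2) ^ card R * card {E \<in> deg_graphs V deg. F \<subseteq> E}"
    using insert cR by (intro insert.IH) auto
  have "card (F \<union> R) \<le> card F + card R" by (rule card_Un_le)
  then have c: "card (F \<union> R) \<le> 5 * card V / 4" using insert.prems(1) cR by simp
  have new: "(x, y) \<notin> (F \<union> R) \<union> (F \<union> R)\<inverse>"
    using insert.prems(2)[of x y] insert.prems(2)[of y x] insert.hyps p by auto
  have xy: "x \<in> V" "y \<in> V" using insert.prems(2) p by auto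
  have "card V * card {E \<in> deg_graphs V deg. insert (x, y) (F \<union> R) \<subseteq> E}
           \<le> 4 * d\<^sup>2 * card {E \<in> deg_graphs V deg. F \<union> R \<subseteq> E}"
    using insert assms c new xy by (intro switching_bound) auto
  then have "card V ^ card R * (card V * card {E \<in> deg_graphs V deg. insert (x, y) (F \<union> R) \<subseteq> E})
     \<le> card V ^ card R * (4 * d\<^sup>2 * card {E \<in> deg_graphs V deg. F \<union> R \<subseteq> E})"
    by (rule mult_left_mono) simp
  also have "\<dots> \<le> 4 * d\<^sup>2 * ((4 * d\<^sup>2) ^ card R * card {E \<in> deg_graphs V deg. F \<subseteq> E})"
    using mult_left_mono[OF IH, of "4 * d\<^sup>2"] by (simp add: mult_ac)
  finally show ?case by (simp add: p cR[unfolded p] mult_ac)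
qed

section \<open>Edges that close cycles over a subgraph with small components\<close>

abbreviation connects :: "('a \<times> 'a) set \<Rightarrow> ('a \<times> 'a) set" where
  "connects F \<equiv> (F \<union> F\<inverse>)\<^sup>*"

text \<open>The order selects one orientation of each edge, the form in which
  \<open>switching_bound_iterated\<close> takes its pairs.\<close>

definition closing :: "('a :: linorder \<times> 'a) set \<Rightarrow> ('a \<times> 'a) set \<Rightarrow> ('a \<times> 'a) set" where
  "closing E F = {(x, y) \<in> E \<inter> connects F. x < y \<and> (x, y) \<notin> F \<union> F\<inverse>}"

text \<open>The exceptional event for the graph. Quantifying over all \<open>F\<close> makes it
  independent of the ages, although the spanning forest inside \<open>T\<^sub>3\<close> to which it
  is applied depends on them. Its second use is for the search forest around vertices without a
  tree-like neighbourhood.\<close>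

definition many_closing ::
    "('a :: linorder) set \<Rightarrow> real \<Rightarrow> real \<Rightarrow> ('a \<times> 'a) set \<Rightarrow> bool" where
  "many_closing V \<epsilon> \<alpha> E \<longleftrightarrow> (\<exists>F\<subseteq>E. card F \<le> card V \<and>
     (\<forall>x\<in>V. real (card (connects F `` {x})) \<le> \<alpha> * card V) \<and> \<epsilon> * card V \<le> card (closing E F))"

text \<open>The quotient of \<open>r ^ r\<close> by \<open>fact r\<close> is a single term of the
  exponential series at \<open>r\<close>.\<close>

lemma power_self_le_exp_fact: "real r ^ r \<le> exp (real r) * fact r"
proof -
  have "real r ^ r / fact r \<le> exp (real r)"
    using sum_le_suminf[OF summable_exp_generic[of "real r"], of "{r}"]
    by (simp add: exp_def scaleR_conv_of_real field_simps)
  then show ?thesis by (simp add: field_simps)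
qed

lemma choose_le_power:
  assumes "real P \<le> p" "r > 0" 
  shows "real (P choose r) \<le> (exp 1 * p / r) ^ r"
proof -
  have "real (P choose r) * fact r \<le> real P ^ r"
    using binomial_fact_pow[of P r] by (metis of_nat_fact of_nat_le_iff of_nat_mult of_nat_power)
  also have "\<dots> \<le> p ^ r" using assms by (intro power_mono) auto
  finally have "real (P choose r) * fact r * real r ^ r \<le> p ^ r * (exp (real r) * fact r)"
    using assms power_self_le_exp_fact[of r] by (intro mult_mono) auto
  then have "real (P choose r) * real r ^ r \<le> p ^ r * exp (real r)"
    by (simp add: mult.assoc mult.left_commute)
  also have "exp (real r) = exp 1 ^ r" by (simp add: exp_of_nat_mult[symmetric])
  finally show ?thesis using assms(2) by (simp add: power_mult_distrib power_divide field_simps)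
qed

lemma card_relation_le:
  assumes "finite V" "E \<subseteq> V \<times> V" "\<And>i. i \<in> V \<Longrightarrow> card (E `` {i}) \<le> d"
  shows "card E \<le> card V * d"
proof -
  have "finite E" using assms finite_subset by blast
  then have "card E = (\<Sum>v\<in>V. card (E `` {v}))" using assms by (intro card_eq_sum_Image)
  also have "\<dots> \<le> (\<Sum>v\<in>V. d)" by (intro sum_mono assms)
  finally show ?thesis by simp
qed

lemma connects_Image_subset: "F \<subseteq> V \<times> V \<Longrightarrow> connects F `` {v} \<subseteq> insert v V"
  by (auto elim: rtranclE)

lemma card_candidates_le:
  fixes V :: "'a :: linorder set" and c :: real
  assumes "finite V" "F \<subseteq> V \<times> V" "\<And>x. x \<in> V \<Longrightarrow> real (card (connects F `` {x})) \<le> c"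
  shows "real (card {(x, y) \<in> (V \<times> V) \<inter> connects F. x < y \<and> (x, y) \<notin> F \<union> F\<inverse>}) \<le> card V * c"
proof -
  let ?P = "{(x, y) \<in> (V \<times> V) \<inter> connects F. x < y \<and> (x, y) \<notin> F \<union> F\<inverse>}"
  let ?C = "(V \<times> V) \<inter> connects F"
  have finC: "finite ?C" using assms by auto
  have "card ?P \<le> card ?C" by (intro card_mono finC) auto
  also have "\<dots> = (\<Sum>v\<in>V. card (?C `` {v}))" using assms finC by (intro card_eq_sum_Image) auto
  finally have "real (card ?P) \<le> (\<Sum>v\<in>V. real (card (?C `` {v})))" by (simp flip: of_nat_sum)
  also have "\<dots> \<le> (\<Sum>v\<in>V. c)"
  proof (rule sum_mono)
    fix v assume v: "v \<in> V"
    have "finite (connects F `` {v})"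
      using connects_Image_subset[OF assms(2)] assms(1) finite_subset by blast
    then have "card (?C `` {v}) \<le> card (connects F `` {v})" by (intro card_mono) auto
    then show "real (card (?C `` {v})) \<le> c" using assms(3)[OF v] by linarith
  qed
  finally show ?thesis by simp
qed

text \<open>Exchange the sums: a graph with at most \<open>m\<close> arcs contains at most 2 ^ m
  members of \<open>\<F>\<close>, however large \<open>\<F>\<close> is.\<close>

lemma sum_card_supersets_le:
  assumes "finite \<G>" "finite \<F>" and c: "\<And>E. E \<in> \<G> \<Longrightarrow> finite E \<and> card E \<le> m"
  shows "(\<Sum>F\<in>\<F>. card {E \<in> \<G>. F \<subseteq> E}) \<le> 2 ^ m * card \<G>"
proof -
  have "(\<Sum>F\<in>\<F>. card {E \<in> \<G>. F \<subseteq> E}) = (\<Sum>F\<in>\<F>. \<Sum>E\<in>\<G>. of_bool (F \<subseteq> E))"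
    using assms by (simp add: of_bool_def sum.If_cases Int_def)
  also have "\<dots> = (\<Sum>E\<in>\<G>. \<Sum>F\<in>\<F>. of_bool (F \<subseteq> E))" by (rule sum.swap)
  also have "\<dots> \<le> (\<Sum>E\<in>\<G>. 2 ^ m)"
  proof (rule sum_mono)
    fix E assume E: "E \<in> \<G>"
    have "(\<Sum>F\<in>\<F>. of_bool (F \<subseteq> E)) = card {F \<in> \<F>. F \<subseteq> E}"
      using assms by (simp add: of_bool_def sum.If_cases Int_def)
    also have "\<dots> \<le> card (Pow E)" using c[OF E] by (intro card_mono) auto
    also have "\<dots> \<le> 2 ^ m" using c[OF E] by (simp add: card_Pow power_increasing)
    finally show "(\<Sum>F\<in>\<F>. of_bool (F \<subseteq> E)) \<le> (2 ^ m :: nat)" .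
  qed
  finally show ?thesis by (simp add: mult.commute)
qed

text \<open>\<alpha> is solved from e \<alpha> 4 d^2 / \<epsilon> = exp (- (1 + d) / \<epsilon>),
  which bounds each of the \<open>r\<close> factors after division by n. As r \<ge> \<epsilon> n,
  their product is at most exp (- (1 + d) n), and the part exp (- d n) absorbs 2 ^ (d n).\<close>

lemma closing_constant:
  fixes \<epsilon> :: real
  assumes "0 < \<epsilon>" "d > 0"
  defines "\<alpha> \<equiv> \<epsilon> / (4 * (real d)\<^sup>2 * exp 1) * exp (- (1 + real d) / \<epsilon>)"
  assumes "real r \<ge> \<epsilon> * real n" "r > 0"
  shows "2 ^ (d * n) * (exp 1 * (real n * (\<alpha> * n)) / r) ^ r * (4 * (real d)\<^sup>2) ^ r \<le> exp (- real n) * real n ^ r"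
proof -
  have \<alpha>: "\<alpha> > 0" using assms by (simp add: \<alpha>_def)
  have "(exp 1 * (real n * (\<alpha> * n)) / r) ^ r * (4 * (real d)\<^sup>2) ^ r
      = (real n / r * (exp 1 * \<alpha> * (4 * (real d)\<^sup>2))) ^ r * real n ^ r"
    by (simp add: power_mult_distrib[symmetric] mult_ac power2_eq_square)
  also have "(real n / r * (exp 1 * \<alpha> * (4 * (real d)\<^sup>2))) ^ r \<le> (1 / \<epsilon> * (exp 1 * \<alpha> * (4 * (real d)\<^sup>2))) ^ r"
    using assms \<alpha> by (intro power_mono mult_right_mono) (auto simp: field_simps)
  also have "1 / \<epsilon> * (exp 1 * \<alpha> * (4 * (real d)\<^sup>2)) = exp (- (1 + real d) / \<epsilon>)"
    using assms by (simp add: \<alpha>_def field_simps)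
  also have "exp (- (1 + real d) / \<epsilon>) ^ r = exp (- ((1 + real d) * (r / \<epsilon>)))"
  proof -
    have "real r * (- (1 + real d) / \<epsilon>) = - ((1 + real d) * (r / \<epsilon>))" using assms by (simp add: field_simps)
    then show ?thesis by (simp only: exp_of_nat_mult[symmetric])
  qed
  also have "\<dots> \<le> exp (- ((1 + real d) * n))"
  proof -
    have "real n \<le> r / \<epsilon>" using assms by (simp add: field_simps)
    then have "(1 + real d) * n \<le> (1 + real d) * (r / \<epsilon>)" by (intro mult_left_mono) auto
    then show ?thesis by simp
  qed
  finally have *: "(exp 1 * (real n * (\<alpha> * n)) / r) ^ r * (4 * (real d)\<^sup>2) ^ r \<le> exp (- ((1 + real d) * n)) * real n ^ r"
    by (simp add: mult_right_mono)
  have "(2::real) ^ (d * n) \<le> exp 1 ^ (d * n)"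
    using exp_ge_add_one_self[of 1] by (intro power_mono) auto
  also have "\<dots> = exp (real (d * n))" by (simp add: exp_of_nat_mult[symmetric])
  finally have "2 ^ (d * n) * ((exp 1 * (real n * (\<alpha> * n)) / r) ^ r * (4 * (real d)\<^sup>2) ^ r)
     \<le> exp (real (d * n)) * (exp (- ((1 + real d) * n)) * real n ^ r)"
    using * \<alpha> by (intro mult_mono[OF _ *]) auto
  also have "\<dots> = exp (- real n) * real n ^ r"
  proof -
    have "exp (real (d * n)) * exp (- ((1 + real d) * n)) = exp (- real n)"
      unfolding exp_add[symmetric] by (simp add: algebra_simps)
    then show ?thesis by (simp only: mult.assoc[symmetric])
  qed
  finally show ?thesis by (simp add: mult.assoc)
qed

text \<open>
  A union bound over a subgraph \<open>F\<close> together with a set \<open>R\<close> of closing edges. Summing over the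
  \<open>F\<close> contained in the random graph costs only \<open>2 ^ (d n)\<close>, which the factor \<open>\<alpha> ^ card R\<close>
  coming from the few possible positions of closing edges beats.
\<close>

lemma few_closing_edges:
  fixes \<epsilon> :: real
  assumes "\<epsilon> > 0" and "d > 0"
  shows "\<exists>\<alpha>>0. \<exists>N. \<forall>V :: 'a :: linorder set. \<forall>deg. finite V \<longrightarrow> card V \<ge> N \<longrightarrow>
    (\<forall>i\<in>V. 3 \<le> deg i \<and> deg i \<le> d) \<longrightarrow>
    real (card {E \<in> deg_graphs V deg. many_closing V \<epsilon> \<alpha> E})
      \<le> exp (- real (card V)) * real (card (deg_graphs V deg))"
proof -
  \<comment> \<open>Lowering \<epsilon> only enlarges the event. The cap 1 / 8 gives r < n / 8 + 1
    \<le> n / 4, so that \<open>F\<close> and \<open>R\<close> together respect the limit 5 n / 4 of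
    the iterated switching bound.\<close>
  define \<delta> where "\<delta> = min \<epsilon> (1 / 8)"
  have \<delta>: "\<delta> > 0" "\<delta> \<le> \<epsilon>" "\<delta> \<le> 1 / 8" using assms by (auto simp: \<delta>_def)
  define \<alpha> where "\<alpha> = \<delta> / (4 * (real d)\<^sup>2 * exp 1) * exp (- (1 + real d) / \<delta>)"
  have \<alpha>: "\<alpha> > 0" using \<delta> assms by (simp add: \<alpha>_def)
  have main: "real (card {E \<in> deg_graphs V deg. many_closing V \<epsilon> \<alpha> E})
      \<le> exp (- real (card V)) * real (card (deg_graphs V deg))"
    if V: "finite V" and large: "card V \<ge> max 8 (16 * d + 8 * d\<^sup>2)"
      and deg: "\<forall>i\<in>V. 3 \<le> deg i \<and> deg i \<le> d" for V :: "'a set" and deg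
  proof -
    define n where "n = card V"
    define r where "r = nat \<lceil>\<delta> * n\<rceil>"
    have n: "n \<ge> 8" using large by (simp add: n_def)
    have r: "real r \<ge> \<delta> * n" "real r < \<delta> * n + 1" unfolding r_def using \<delta> by (auto simp: ceiling_correct) linarith+
    have "\<delta> * n > 0" using \<delta> n by simp
    then have rpos: "r > 0" using r(1) by (metis less_le_trans of_nat_0_less_iff)
    have "\<delta> * n \<le> 1 / 8 * n" using \<delta> by (intro mult_right_mono) auto
    then have r4: "real r \<le> n / 4" using r n by linarith
    let ?G = "deg_graphs V deg"
    have finG: "finite ?G" using V by (rule finite_deg_graphs)
    define \<F> where "\<F> = {F. F \<subseteq> V \<times> V \<and> card F \<le> n \<and> (\<forall>x\<in>V. real (card (connects F `` {x})) \<le> \<alpha> * n)}"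
    define P where "P F = {(x, y) \<in> (V \<times> V) \<inter> connects F. x < y \<and> (x, y) \<notin> F \<union> F\<inverse>}" for F
    define \<R> where "\<R> F = {R. R \<subseteq> P F \<and> card R = r}" for F
    have fin\<F>: "finite \<F>" unfolding \<F>_def using V by (auto intro: finite_subset[of _ "Pow (V \<times> V)"])
    have finP: "finite (P F)" for F unfolding P_def using V by (auto intro: finite_subset[of _ "V \<times> V"])
    have fin\<R>: "finite (\<R> F)" for F unfolding \<R>_def using finP by auto
    have finF: "finite F" if "F \<in> \<F>" for F using that V finite_subset[of F "V \<times> V"] unfolding \<F>_def by blast
    have bnd: "n ^ r * card {E \<in> ?G. F \<union> R \<subseteq> E} \<le> (4 * d\<^sup>2) ^ r * card {E \<in> ?G. F \<subseteq> E}"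
      if "F \<in> \<F>" "R \<in> \<R> F" for F R
    proof -
      have R: "card R = r" "R \<subseteq> P F" using that by (auto simp: \<R>_def)
      have "card F \<le> n" using that by (auto simp: \<F>_def)
      then have "card F + card R \<le> 5 * card V / 4" using R r4 by (simp add: n_def)
      then show ?thesis
        using switching_bound_iterated[of V deg d F R] V deg large finF[OF that(1)] finite_subset[OF R(2) finP] R
        unfolding n_def P_def by fastforce
    qed
    have "{E \<in> ?G. many_closing V \<epsilon> \<alpha> E} \<subseteq> (\<Union>F\<in>\<F>. \<Union>R\<in>\<R> F. {E \<in> ?G. F \<union> R \<subseteq> E})"
    proof
      fix E assume "E \<in> {E \<in> ?G. many_closing V \<epsilon> \<alpha> E}"
      then obtain F where E: "E \<in> ?G" and F: "F \<subseteq> E" "card F \<le> n" 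
          "\<forall>x\<in>V. real (card (connects F `` {x})) \<le> \<alpha> * n" and cl: "\<epsilon> * n \<le> card (closing E F)"
        by (auto simp: many_closing_def n_def)
      have EV: "E \<subseteq> V \<times> V" using E by (simp add: deg_graphs_def)
      have "\<delta> * n \<le> \<epsilon> * n" using \<delta> by (intro mult_right_mono) auto
      then have "\<delta> * n \<le> of_int (int (card (closing E F)))" using cl by simp
      then have "r \<le> card (closing E F)" unfolding r_def by (simp add: ceiling_le_iff nat_le_iff)
      then obtain R where R: "R \<subseteq> closing E F" "card R = r"
        by (meson obtain_subset_with_card_n)
      then have "R \<subseteq> P F" "R \<subseteq> E" using EV by (auto simp: closing_def P_def)
      then have "R \<in> \<R> F" "F \<union> R \<subseteq> E" using R F by (simp_all add: \<R>_def)
      moreover have "F \<in> \<F>" using F EV by (simp add: \<F>_def)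
      ultimately show "E \<in> (\<Union>F\<in>\<F>. \<Union>R\<in>\<R> F. {E \<in> ?G. F \<union> R \<subseteq> E})"
        using E by blast
    qed
    then have "card {E \<in> ?G. many_closing V \<epsilon> \<alpha> E} \<le> card (\<Union>F\<in>\<F>. \<Union>R\<in>\<R> F. {E \<in> ?G. F \<union> R \<subseteq> E})"
      using finG by (intro card_mono finite_UN_I fin\<F> fin\<R>) auto
    also have "\<dots> \<le> (\<Sum>F\<in>\<F>. \<Sum>R\<in>\<R> F. card {E \<in> ?G. F \<union> R \<subseteq> E})"
      by (intro order_trans[OF card_UN_le] sum_mono card_UN_le fin\<F> fin\<R> order_refl)
    finally have "n ^ r * card {E \<in> ?G. many_closing V \<epsilon> \<alpha> E}
        \<le> n ^ r * (\<Sum>F\<in>\<F>. \<Sum>R\<in>\<R> F. card {E \<in> ?G. F \<union> R \<subseteq> E})" by simp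
    also have "\<dots> = (\<Sum>F\<in>\<F>. \<Sum>R\<in>\<R> F. n ^ r * card {E \<in> ?G. F \<union> R \<subseteq> E})"
      by (simp add: sum_distrib_left)
    also have "\<dots> \<le> (\<Sum>F\<in>\<F>. \<Sum>R\<in>\<R> F. (4 * d\<^sup>2) ^ r * card {E \<in> ?G. F \<subseteq> E})"
      by (intro sum_mono bnd)
    also have "\<dots> = (\<Sum>F\<in>\<F>. (card (P F) choose r) * ((4 * d\<^sup>2) ^ r * card {E \<in> ?G. F \<subseteq> E}))"
      unfolding \<R>_def using finP by (simp add: n_subsets)
    finally have "real (n ^ r * card {E \<in> ?G. many_closing V \<epsilon> \<alpha> E})
      \<le> real (\<Sum>F\<in>\<F>. (card (P F) choose r) * ((4 * d\<^sup>2) ^ r * card {E \<in> ?G. F \<subseteq> E}))"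
      by (simp only: of_nat_le_iff)
    also have "\<dots> = (\<Sum>F\<in>\<F>. real (card (P F) choose r) * ((4 * (real d)\<^sup>2) ^ r * card {E \<in> ?G. F \<subseteq> E}))"
      by simp
    also have "\<dots> \<le> (\<Sum>F\<in>\<F>. (exp 1 * (real n * (\<alpha> * n)) / r) ^ r * ((4 * (real d)\<^sup>2) ^ r * card {E \<in> ?G. F \<subseteq> E}))"
    proof (intro sum_mono mult_right_mono choose_le_power rpos)
      fix F assume "F \<in> \<F>"
      then show "real (card (P F)) \<le> real n * (\<alpha> * n)"
        unfolding P_def n_def by (intro card_candidates_le V) (auto simp: \<F>_def n_def)
    qed simp
    also have "\<dots> = (exp 1 * (real n * (\<alpha> * n)) / r) ^ r * (4 * (real d)\<^sup>2) ^ r * real (\<Sum>F\<in>\<F>. card {E \<in> ?G. F \<subseteq> E})"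
      by (simp add: sum_distrib_left mult.assoc)
    also have "\<dots> \<le> (exp 1 * (real n * (\<alpha> * n)) / r) ^ r * (4 * (real d)\<^sup>2) ^ r * real (2 ^ (d * n) * card ?G)"
    proof (intro mult_left_mono of_nat_mono sum_card_supersets_le finG fin\<F>)
      fix E assume "E \<in> ?G"
      then have "E \<subseteq> V \<times> V" "\<forall>i\<in>V. card (E `` {i}) \<le> d" using deg by (auto simp: deg_graphs_def)
      then show "finite E \<and> card E \<le> d * n"
        using V card_relation_le[of V E d] by (auto intro: finite_subset simp: n_def mult.commute)
    qed (use \<alpha> in auto)
    also have "\<dots> = 2 ^ (d * n) * (exp 1 * (real n * (\<alpha> * n)) / r) ^ r * (4 * (real d)\<^sup>2) ^ r * card ?G"
      by simp
    also have "\<dots> \<le> exp (- real n) * real n ^ r * card ?G"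
    proof (rule mult_right_mono)
      show "2 ^ (d * n) * (exp 1 * (real n * (\<alpha> * n)) / r) ^ r * (4 * (real d)\<^sup>2) ^ r \<le> exp (- real n) * real n ^ r"
        unfolding \<alpha>_def by (rule closing_constant) (fact \<delta> assms r rpos)+
    qed simp
    finally have "real n ^ r * real (card {E \<in> ?G. many_closing V \<epsilon> \<alpha> E}) \<le> real n ^ r * (exp (- real n) * card ?G)"
      by (simp only: of_nat_mult of_nat_power mult_ac)
    moreover have "real n ^ r > 0" using n by simp
    ultimately show ?thesis unfolding n_def by (rule mult_left_le_imp_le)
  qed
  show ?thesis
    by (rule exI[of _ \<alpha>], rule conjI[OF \<alpha>], rule exI[of _ "max 8 (16 * d + 8 * d\<^sup>2)"],
        intro allI impI, rule main; assumption)
qed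

section \<open>Existence of graphs with given degrees\<close>

lemma card_sym_irrefl:
  fixes E :: "('a :: linorder \<times> 'a) set"
  assumes "finite E" "sym E" "irrefl E"
  shows "card E = 2 * card {(x, y) \<in> E. x < y}"
proof -
  let ?L = "{(x, y) \<in> E. x < y}" and ?U = "{(x, y) \<in> E. y < x}"
  have fin: "finite ?L" "finite ?U" using assms by (auto intro: finite_subset[of _ E])
  have "E = ?L \<union> ?U" using assms by (auto simp: irrefl_def) (metis linorder_neqE)
  then have "card E = card ?L + card ?U" using card_Un_disjoint[OF fin] by fastforce
  also have "?U = prod.swap ` ?L" using assms by (force simp: sym_def image_iff)
  then have "card ?U = card ?L" by (simp add: card_image)
  finally show ?thesis by simp
qed

lemma ex_max_card:
  assumes "finite S" "S \<noteq> {}"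
  obtains E where "E \<in> S" "\<And>E'. E' \<in> S \<Longrightarrow> card E' \<le> card E"
proof -
  have "Max (card ` S) \<in> card ` S" using assms by (intro Max_in) auto
  then obtain E where "E \<in> S" "card E = Max (card ` S)" by auto
  then show ?thesis using that[of E] assms by simp
qed

text \<open>If no such graph existed, every event would have measure 0. Among the graphs with
  degrees at most \<open>deg\<close>, one with the most arcs attains all degrees: its deficient
  vertices are pairwise adjacent, hence confined to the closed neighbourhood of any one of them, and
  an edge elsewhere can be rerouted to raise the degrees of deficient vertices.\<close>

lemma deg_graphs_nonempty:
  fixes V :: "'a :: linorder set"
  assumes V: "finite V" and deg: "\<And>i. i \<in> V \<Longrightarrow> 3 \<le> deg i \<and> deg i \<le> d"
    and even: "even (\<Sum>i\<in>V. deg i)" and large: "card V > (d + 1) * (d + 1)"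
  shows "deg_graphs V deg \<noteq> {}"
proof
  assume empty: "deg_graphs V deg = {}"
  define S where "S = {E. E \<subseteq> V \<times> V \<and> sym E \<and> irrefl E \<and> (\<forall>i\<in>V. card (E `` {i}) \<le> deg i)}"
  have "finite S" unfolding S_def using V by (auto intro: finite_subset[of _ "Pow (V \<times> V)"])
  moreover have "{} \<in> S" by (auto simp: S_def sym_def irrefl_def)
  ultimately obtain E where ES: "E \<in> S" and max: "\<And>E'. E' \<in> S \<Longrightarrow> card E' \<le> card E"
    using ex_max_card[of S] by blast
  have sub: "E \<subseteq> V \<times> V" and symE': "sym E" and irrE: "irrefl E" and le: "\<And>i. i \<in> V \<Longrightarrow> card (E `` {i}) \<le> deg i"
    using ES unfolding S_def by auto
  have symE: "\<And>a b. (a, b) \<in> E \<longleftrightarrow> (b, a) \<in> E" and ir: "\<And>a. (a, a) \<notin> E"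
    using symE' irrE unfolding sym_def irrefl_def by blast+
  have finE: "finite E" using sub V finite_subset by blast
  have fin: "finite (E `` {i})" for i using finE by (rule finite_Image)
  define D where "D = {i \<in> V. card (E `` {i}) < deg i}"
  have finD: "finite D" using V by (simp add: D_def)
  have adj: "(x, y) \<in> E" if xy: "x \<in> D" "y \<in> D" "x \<noteq> y" for x y
  proof (rule ccontr)
    assume nE: "(x, y) \<notin> E"
    let ?E = "insert (x, y) (insert (y, x) E)"
    have "card (?E `` {i}) \<le> deg i" if "i \<in> V" for i
    proof -
      have "?E `` {i} = (if i = x then insert y (E `` {i}) else if i = y then insert x (E `` {i}) else E `` {i})"
        using xy by auto
      then show ?thesis using xy le that fin
        by (auto simp: D_def intro: order_trans[OF card_insert_le_m1] card_insert_le_m1)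
    qed
    moreover have "sym ?E" "irrefl ?E" using symE' irrE xy by (auto simp: sym_def irrefl_def)
    ultimately have "?E \<in> S" using sub xy by (auto simp: S_def D_def)
    moreover have "card ?E = card E + 2" using nE symE xy finE by auto
    ultimately show False using max[of ?E] by simp
  qed
  have "E \<notin> deg_graphs V deg" using empty by simp
  then obtain x where x: "x \<in> D"
    using ES le unfolding D_def deg_graphs_def S_def by force
  have xV: "x \<in> V" using x by (simp add: D_def)
  \<comment> \<open>Rerouting needs two missing half-edges, at two deficient vertices or both at
    \<open>x\<close>. If \<open>x\<close> is the only deficient vertex, its deficiency is even,
    since both the degree sum and the number of arcs are.\<close>
  have "\<exists>y\<in>D. y \<noteq> x \<or> card (E `` {x}) + 2 \<le> deg x"
  proof (cases "D = {x}")
    case True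
    have "(\<Sum>i\<in>V. deg i) = (\<Sum>i\<in>V - {x}. deg i) + deg x" using V xV by (simp add: sum.remove)
    also have "(\<Sum>i\<in>V - {x}. deg i) = (\<Sum>i\<in>V - {x}. card (E `` {i}))"
    proof (rule sum.cong)
      fix i assume "i \<in> V - {x}"
      then have "i \<in> V" "i \<notin> D" using True by auto
      then show "deg i = card (E `` {i})" using le[of i] by (simp add: D_def)
    qed simp
    also have "\<dots> + deg x = card E + (deg x - card (E `` {x}))"
      using V xV le[OF xV] by (simp add: card_eq_sum_Image[OF V finE sub] sum.remove[of V x])
    finally have "even (card E + (deg x - card (E `` {x})))" using even by simp
    then have "even (deg x - card (E `` {x}))" using card_sym_irrefl[OF finE symE' irrE] by simp
    moreover have "deg x - card (E `` {x}) > 0" using x by (simp add: D_def)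
    ultimately have "deg x - card (E `` {x}) \<ge> 2" by (cases "deg x - card (E `` {x})") (auto elim: oddE)
    then show ?thesis using x by (intro bexI[of _ x]) auto
  qed (use x in auto)
  then obtain y where y: "y \<in> D" and yx: "y \<noteq> x \<or> card (E `` {x}) + 2 \<le> deg x" by blast
  have yV: "y \<in> V" using y by (simp add: D_def)
  have led: "card (E `` {i}) \<le> d" if "i \<in> V" for i using le deg that by (meson le_trans)
  have nbV: "E `` {i} \<subseteq> V" for i using sub by auto
  let ?A = "insert x (E `` {x})" and ?B = "insert y (E `` {y})"
  have cA: "card ?A \<le> d + 1" using fin[of x] led[OF xV] by (simp add: card_insert_if)
  have cB: "card ?B \<le> d + 1" using fin[of y] led[OF yV] by (simp add: card_insert_if)
  have "D \<subseteq> ?A" using adj x by auto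
  have "card {(u, v) \<in> E. u \<in> ?A} \<le> card ?A * d"
    using led nbV[of x] xV by (intro card_relation_left_le finE) (auto intro: fin)
  also have "\<dots> \<le> (d + 1) * d" using cA by (rule mult_right_mono) simp
  finally have 1: "card {(u, v) \<in> E. u \<in> ?A} \<le> (d + 1) * d" .
  have "card {(u, v) \<in> E. v \<in> ?B} \<le> card ?B * d"
    using led nbV[of y] yV by (intro card_relation_right_le finE symE') (auto intro: fin)
  also have "\<dots> \<le> (d + 1) * d" using cB by (rule mult_right_mono) simp
  finally have 2: "card {(u, v) \<in> E. v \<in> ?B} \<le> (d + 1) * d" .
  \<comment> \<open>Vertices outside \<open>?A\<close> are not deficient and have degree at least 3,
    while few arcs start in \<open>?A\<close> or end in \<open>?B\<close>. So some arc uv avoids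
    both.\<close>
  have "3 * (card V - card ?A) \<le> 3 * card (V - ?A)"
    using diff_card_le_card_Diff[of ?A V] fin by auto
  also have "3 * card (V - ?A) = (\<Sum>i\<in>V - ?A. 3)" by simp
  also have "\<dots> \<le> (\<Sum>i\<in>V - ?A. card (E `` {i}))"
  proof (rule sum_mono)
    fix i assume "i \<in> V - ?A"
    then have "i \<in> V" "i \<notin> D" using \<open>D \<subseteq> ?A\<close> by auto
    then show "3 \<le> card (E `` {i})" using deg[of i] by (auto simp: D_def)
  qed
  also have "\<dots> \<le> (\<Sum>i\<in>V. card (E `` {i}))" using V by (intro sum_mono2) auto
  also have "\<dots> = card E" using card_eq_sum_Image[OF V finE sub] by simp
  finally have "3 * (card V - (d + 1)) \<le> card E" using cA by linarith
  moreover have "3 * (card V - (d + 1)) > (d + 1) * d + (d + 1) * d"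
    using large by (auto simp: algebra_simps)
  ultimately have "card E > card ({(u, v) \<in> E. u \<in> ?A} \<union> {(u, v) \<in> E. v \<in> ?B})"
    using 1 2 card_Un_le[of "{(u, v) \<in> E. u \<in> ?A}" "{(u, v) \<in> E. v \<in> ?B}"] by linarith
  moreover have "finite ({(u, v) \<in> E. u \<in> ?A} \<union> {(u, v) \<in> E. v \<in> ?B})"
    by (rule finite_subset[OF _ finE]) auto
  ultimately have "\<not> E \<subseteq> {(u, v) \<in> E. u \<in> ?A} \<union> {(u, v) \<in> E. v \<in> ?B}"
    using card_mono leD by blast
  then obtain u v where uv: "(u, v) \<in> E" "u \<notin> ?A" "v \<notin> ?B" by auto
  have new: "(x, u) \<notin> E" "(u, x) \<notin> E" "(y, v) \<notin> E" "(v, y) \<notin> E" "u \<noteq> x" "v \<noteq> y" "u \<noteq> v"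
    using uv symE ir by auto
  have new': "u \<noteq> y" "v \<noteq> x" using new adj[OF x y] adj[OF y x] uv by auto
  \<comment> \<open>One edge is removed and two are added, against the maximality of
    \<open>E\<close>. If x = y, the degree of \<open>x\<close> rises by 2, which the choice of
    \<open>y\<close> permits.\<close>
  let ?E = "E - {(u, v), (v, u)} \<union> {(x, u), (u, x), (y, v), (v, y)}"
  have "card (?E `` {i}) \<le> deg i" if "i \<in> V" for i
  proof -
    have ins: "card (insert a B) \<le> Suc (card B)" for a and B :: "'a set" by (rule card_insert_le_m1) auto
    consider "i = x" "x = y" | "i = x" "x \<noteq> y" | "i = y" "x \<noteq> y" | "i = u" | "i = v" | "i \<notin> {x, y, u, v}" by blast
    then show ?thesis
    proof cases
      case 1
      have "?E `` {i} = insert u (insert v (E `` {i}))" unfolding 1 using new new' 1 by auto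
      then have "card (?E `` {i}) \<le> Suc (Suc (card (E `` {i})))"
        using ins[of u "insert v (E `` {i})"] ins[of v "E `` {i}"] by simp
      then show ?thesis using yx 1 by simp
    next
      case 2
      have "?E `` {i} = insert u (E `` {i})" unfolding 2 using new new' 2 by auto
      then have "card (?E `` {i}) \<le> Suc (card (E `` {i}))" using ins by simp
      then show ?thesis using x 2 by (simp add: D_def)
    next
      case 3
      have "?E `` {i} = insert v (E `` {i})" unfolding 3 using new new' 3 by auto
      then have "card (?E `` {i}) \<le> Suc (card (E `` {i}))" using ins by simp
      then show ?thesis using y 3 by (simp add: D_def)
    next
      case 4
      have "?E `` {i} = insert x (E `` {i} - {v})" unfolding 4 using new new' by auto
      moreover have "card \<dots> = card (E `` {i})" using fin uv new 4 by (intro card_swap_element) auto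
      ultimately show ?thesis using le that by simp
    next
      case 5
      have "?E `` {i} = insert y (E `` {i} - {u})" unfolding 5 using new new' by auto
      moreover have "card \<dots> = card (E `` {i})" using fin uv new 5 symE by (intro card_swap_element) auto
      ultimately show ?thesis using le that by simp
    next
      case 6
      have "?E `` {i} = E `` {i}" using 6 by auto
      then show ?thesis using le that by simp
    qed
  qed
  moreover have "sym ?E" using symE unfolding sym_def by blast
  moreover have "irrefl ?E" using ir new unfolding irrefl_def by blast
  moreover have "?E \<subseteq> V \<times> V" using sub xV yV uv by auto
  ultimately have "?E \<in> S" by (simp add: S_def)
  then have "card ?E \<le> card E" by (rule max)
  moreover have "card ?E = card (E - {(u, v), (v, u)}) + card {(x, u), (u, x), (y, v), (v, y)}"
    using finE new by (intro card_Un_disjoint) auto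
  moreover have "card (E - {(u, v), (v, u)}) = card E - 2"
    using finE uv symE new by (subst card_Diff_subset) auto
  moreover have "card {(x, u), (u, x), (y, v), (v, y)} = 4" using new new' by auto
  moreover have "card E \<ge> card {(u, v), (v, u)}" using finE uv symE by (intro card_mono) auto
  ultimately show False using new by simp
qed

section \<open>Spanning forests and greedy colouring\<close>

lemma spanning_forest:
  assumes "sym H" "finite H"
  shows "\<exists>F\<subseteq>H. card F \<le> card (Field H) \<and> H \<subseteq> connects F"
proof -
  have symr: "sym (H\<^sup>*)" using \<open>sym H\<close> by (rule sym_rtrancl)
  \<comment> \<open>\<open>r\<close> picks one root per connected component (\<open>r_eq\<close>).
    Joining every other vertex to a neighbour nearer to its root uses at most one edge per
    vertex.\<close>
  define r where "r v = (SOME x. (v, x) \<in> H\<^sup>*)" for v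
  have rH: "(v, r v) \<in> H\<^sup>*" for v unfolding r_def by (rule someI[of _ v]) simp
  have r_eq: "r u = r v" if "(u, v) \<in> H\<^sup>*" for u v
  proof -
    have "(u, x) \<in> H\<^sup>* \<longleftrightarrow> (v, x) \<in> H\<^sup>*" for x
      using that symr by (meson rtrancl_trans symE)
    then show ?thesis by (simp add: r_def)
  qed
  define h where "h v = (LEAST k. (v, r v) \<in> H ^^ k)" for v
  have hH: "(v, r v) \<in> H ^^ h v" for v
    unfolding h_def using rH[of v] by (metis LeastI rtrancl_power)
  have step: "\<exists>u. (v, u) \<in> H \<and> h u < h v" if ne: "v \<noteq> r v" for v
  proof -
    obtain k where k: "h v = Suc k" using hH[of v] ne by (cases "h v") auto
    then obtain u where u: "(v, u) \<in> H" "(u, r v) \<in> H ^^ k"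
      using hH[of v] by (metis relpow_Suc_D2)
    have "r u = r v" using r_eq[OF r_into_rtrancl[OF u(1)]] by simp
    then have "h u \<le> k" unfolding h_def using u by (intro Least_le) simp
    then show ?thesis using u k by auto
  qed
  define p where "p v = (SOME u. (v, u) \<in> H \<and> h u < h v)" for v
  have p: "(v, p v) \<in> H" "h (p v) < h v" if "v \<noteq> r v" for v
    using someI_ex[OF step[OF that]] unfolding p_def by blast+
  define F where "F = (\<lambda>v. (v, p v)) ` {v \<in> Field H. v \<noteq> r v}"
  have F: "(v, p v) \<in> F" if "v \<noteq> r v" for v
    using p(1)[OF that] that by (auto simp: F_def Field_def)
  have finH: "finite (Field H)" using assms by (simp add: finite_Field)
  have conn: "(v, r v) \<in> connects F" for v
  proof (induction "h v" arbitrary: v rule: less_induct)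
    case less
    show ?case
    proof (cases "v = r v")
      case False
      then have "(p v, r (p v)) \<in> connects F" using less p by blast
      moreover have "r (p v) = r v" using r_eq p(1)[OF False] by (metis r_into_rtrancl)
      ultimately show ?thesis using F[OF False] by (auto intro: converse_rtrancl_into_rtrancl)
    qed auto
  qed
  have "sym (connects F)" by (intro sym_rtrancl sym_Un_converse)
  then have "H \<subseteq> connects F" using conn r_eq by (metis r_into_rtrancl rtrancl_trans subrelI symE)
  moreover have "F \<subseteq> H" using p by (auto simp: F_def)
  moreover have "card F \<le> card (Field H)" unfolding F_def
    by (rule order_trans[OF card_image_le card_mono]) (auto simp: finH)
  ultimately show ?thesis by blast
qed

text \<open>An undirected edge of \<open>H\<close> either lies in \<open>F\<close> in some
  direction, where \<open>?g\<close> orients it, or closes a cycle. The factor 2 passes from edges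
  to arcs.\<close>

lemma card_le_forest_closing:
  fixes H :: "('a :: linorder \<times> 'a) set"
  assumes "sym H" "irrefl H" "H \<subseteq> E" "finite E" "F \<subseteq> E" "H \<subseteq> connects F"
  shows "card H \<le> 2 * (card F + card (closing E F))"
proof -
  have finH: "finite H" and finF: "finite F" using assms finite_subset by blast+
  let ?g = "\<lambda>(a, b). (min a b, max a b)"
  have fc: "finite (closing E F)" using assms by (auto simp: closing_def intro: finite_subset[of _ E])
  have "{(x, y) \<in> H. x < y} \<subseteq> closing E F \<union> ?g ` F"
  proof clarsimp
    fix x y assume xy: "(x, y) \<in> H" "x < y" "(x, y) \<notin> ?g ` F"
    have "(x, y) \<notin> F \<union> F\<inverse>"
    proof
      assume "(x, y) \<in> F \<union> F\<inverse>"
      then consider "(x, y) \<in> F" | "(y, x) \<in> F" by auto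
      then show False
      proof cases
        case 1
        moreover have "?g (x, y) = (x, y)" using xy by simp
        ultimately show False using xy(3) by (metis (no_types, lifting) imageI)
      next
        case 2
        moreover have "?g (y, x) = (x, y)" using xy by simp
        ultimately show False using xy(3) by (metis (no_types, lifting) imageI)
      qed
    qed
    then show "(x, y) \<in> closing E F" using xy assms by (auto simp: closing_def)
  qed
  then have "card {(x, y) \<in> H. x < y} \<le> card (closing E F \<union> ?g ` F)"
    using fc finF by (intro card_mono) auto
  also have "\<dots> \<le> card (closing E F) + card F"
    using card_Un_le[of "closing E F" "?g ` F"] card_image_le[OF finF, of ?g] by linarith
  finally show ?thesis using card_sym_irrefl[OF finH] assms by simp
qed

text \<open>Applied with overlap of balls as \<open>R\<close>, to split vertices into boundedly many
  classes with disjoint balls: first to find separate cycles, later to obtain independence.\<close>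

lemma greedy_coloring:
  assumes "finite A" and sym: "\<And>x y. R x y \<Longrightarrow> R y x"
    and "\<And>x. x \<in> A \<Longrightarrow> card {y \<in> A. R x y \<and> y \<noteq> x} < K"
  shows "\<exists>c :: 'a \<Rightarrow> nat. (\<forall>x\<in>A. c x < K) \<and> (\<forall>x\<in>A. \<forall>y\<in>A. x \<noteq> y \<longrightarrow> R x y \<longrightarrow> c x \<noteq> c y)"
  using assms(1,3)
proof (induction A rule: finite_induct)
  case (insert a A)
  have "card {y \<in> A. R x y \<and> y \<noteq> x} < K" if "x \<in> A" for x
  proof -
    have "card {y \<in> A. R x y \<and> y \<noteq> x} \<le> card {y \<in> insert a A. R x y \<and> y \<noteq> x}"
      using insert.hyps by (intro card_mono) auto
    also have "\<dots> < K" using that by (intro insert.prems) auto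
    finally show ?thesis .
  qed
  then have "\<exists>c. (\<forall>x\<in>A. c x < K) \<and> (\<forall>x\<in>A. \<forall>y\<in>A. x \<noteq> y \<longrightarrow> R x y \<longrightarrow> c x \<noteq> c y)"
    by (rule insert.IH)
  then obtain c
    where c: "\<forall>x\<in>A. c x < K" "\<forall>x\<in>A. \<forall>y\<in>A. x \<noteq> y \<longrightarrow> R x y \<longrightarrow> c x \<noteq> c y"
    by (elim exE conjE)
  let ?B = "{y \<in> A. R a y}"
  have "?B = {y \<in> insert a A. R a y \<and> y \<noteq> a}" using insert.hyps by auto
  then have "card ?B < K" using insert.prems[of a] by simp
  moreover have "card (c ` ?B) \<le> card ?B" using insert.hyps by (intro card_image_le) auto
  ultimately have "card (c ` ?B) < card {..<K}" by simp
  then have "\<not> {..<K} \<subseteq> c ` ?B" using insert.hyps card_mono[of "c ` ?B" "{..<K}"] by (auto simp: not_le)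
  then obtain k where k: "k < K" "k \<notin> c ` ?B" by auto
  show ?case
    by (rule exI[of _ "c(a := k)"]) (use c k insert.hyps sym in \<open>auto\<close>)
qed auto

section \<open>Locally tree-like graphs\<close>

primrec branch_ball :: "('a \<times> 'a) set \<Rightarrow> nat \<Rightarrow> 'a \<Rightarrow> 'a \<Rightarrow> 'a set" where
  "branch_ball E 0 v a = {a}"
| "branch_ball E (Suc k) v a = insert a (\<Union>b\<in>E `` {a} - {v}. branch_ball E k a b)"

text \<open>
  Here \<open>v\<close> is the neighbour from which \<open>a\<close> was reached. A root is given as its own parent,
  \<open>v = a\<close>, which excludes no neighbour because \<open>E\<close> is irreflexive.
\<close>

primrec treelike :: "('a \<times> 'a) set \<Rightarrow> nat \<Rightarrow> 'a \<Rightarrow> 'a \<Rightarrow> bool" where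
  "treelike E 0 v a \<longleftrightarrow> True"
| "treelike E (Suc k) v a \<longleftrightarrow>
     (\<forall>b\<in>E `` {a} - {v}. treelike E k a b \<and> a \<notin> branch_ball E k a b) \<and>
     (\<forall>b\<in>E `` {a} - {v}. \<forall>b'\<in>E `` {a} - {v}. b \<noteq> b' \<longrightarrow> branch_ball E k a b \<inter> branch_ball E k a b' = {})"

definition nball :: "('a \<times> 'a) set \<Rightarrow> nat \<Rightarrow> 'a \<Rightarrow> 'a set" where
  "nball E R s = {x. \<exists>j\<le>R. (s, x) \<in> E ^^ j}"

lemma nball_0 [simp]: "nball E 0 s = {s}"
  by (auto simp: nball_def)

lemma nball_Suc: "nball E (Suc R) s = insert s (\<Union>b\<in>E `` {s}. nball E R b)"
proof (intro set_eqI iffI)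
  fix x assume "x \<in> nball E (Suc R) s"
  then obtain j where j: "j \<le> Suc R" "(s, x) \<in> E ^^ j" by (auto simp: nball_def)
  show "x \<in> insert s (\<Union>b\<in>E `` {s}. nball E R b)"
  proof (cases j)
    case (Suc i)
    then obtain b where "(s, b) \<in> E" "(b, x) \<in> E ^^ i" using j by (metis relpow_Suc_D2)
    then show ?thesis using j Suc by (auto simp: nball_def)
  qed (use j in auto)
next
  fix x assume "x \<in> insert s (\<Union>b\<in>E `` {s}. nball E R b)"
  then consider "x = s" | b where "(s, b) \<in> E" "x \<in> nball E R b" by auto
  then show "x \<in> nball E (Suc R) s"
  proof cases
    case 1
    then show ?thesis unfolding nball_def by (auto intro!: exI[of _ 0])
  next
    case (2 b)
    then obtain j where "j \<le> R" "(b, x) \<in> E ^^ j" by (auto simp: nball_def)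
    then show ?thesis using relpow_Suc_I2[OF 2(1), of x j] unfolding nball_def by (intro CollectI exI[of _ "Suc j"]) auto
  qed
qed

lemma branch_ball_subset_nball: "branch_ball E k v a \<subseteq> nball E k a"
  by (induction k arbitrary: v a) (auto simp: nball_Suc)

lemma nball_subset: "E \<subseteq> V \<times> V \<Longrightarrow> s \<in> V \<Longrightarrow> nball E R s \<subseteq> V"
  by (induction R arbitrary: s) (auto simp: nball_Suc)

lemma relpow_sym: "sym E \<Longrightarrow> (x, y) \<in> E ^^ j \<Longrightarrow> (y, x) \<in> E ^^ j"
  by (induction j arbitrary: y) (auto simp del: relpow.simps(2) elim!: relpow_Suc_E intro!: relpow_Suc_I2 dest: symD)

lemma nball_sym: "sym E \<Longrightarrow> x \<in> nball E R s \<longleftrightarrow> s \<in> nball E R x"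
  unfolding nball_def by (auto dest: relpow_sym)

lemma card_nball_le:
  assumes "finite V" "E \<subseteq> V \<times> V" "\<And>i. i \<in> V \<Longrightarrow> card (E `` {i}) \<le> d" "s \<in> V"
  shows "card (nball E R s) \<le> (d + 1) ^ R"
  using \<open>s \<in> V\<close>
proof (induction R arbitrary: s)
  case (Suc R)
  have finE: "finite (E `` {s})" using assms finite_subset[of E] by auto
  have "card (nball E (Suc R) s) \<le> Suc (card (\<Union>b\<in>E `` {s}. nball E R b))"
    unfolding nball_Suc by (rule card_insert_le_m1) auto
  also have "card (\<Union>b\<in>E `` {s}. nball E R b) \<le> (\<Sum>b\<in>E `` {s}. card (nball E R b))"
    by (rule card_UN_le[OF finE])
  also have "\<dots> \<le> (\<Sum>b\<in>E `` {s}. (d + 1) ^ R)" using assms(2) by (intro sum_mono Suc.IH) auto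
  also have "\<dots> \<le> d * (d + 1) ^ R" using assms(3) Suc.prems by simp
  finally have "card (nball E (Suc R) s) \<le> Suc (d * (d + 1) ^ R)" by simp
  moreover have "1 \<le> (d + 1) ^ R" by (rule one_le_power) simp
  ultimately show ?case by (simp only: power_Suc distrib_right mult_1)
qed simp

text \<open>If two balls meet, the centre \<open>w\<close> is within \<open>R\<close> of a point of
  the ball of \<open>s\<close>. The strict bound is the form asked for by
  \<open>greedy_coloring\<close>.\<close>

lemma nball_conflicts_le:
  assumes "finite V" "E \<subseteq> V \<times> V" "sym E" "\<And>i. i \<in> V \<Longrightarrow> card (E `` {i}) \<le> d" "s \<in> V" "A \<subseteq> V"
  shows "card {w \<in> A. nball E R s \<inter> nball E R w \<noteq> {} \<and> w \<noteq> s} < (d + 1) ^ (2 * R) + 1"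
proof -
  have sub: "nball E R x \<subseteq> V" if "x \<in> V" for x using nball_subset assms(2) that by metis
  have "{w \<in> A. nball E R s \<inter> nball E R w \<noteq> {} \<and> w \<noteq> s} \<subseteq> (\<Union>x\<in>nball E R s. nball E R x)"
    using nball_sym[OF \<open>sym E\<close>] by blast
  then have "card {w \<in> A. nball E R s \<inter> nball E R w \<noteq> {} \<and> w \<noteq> s} \<le> card (\<Union>x\<in>nball E R s. nball E R x)"
    using sub[OF \<open>s \<in> V\<close>] finite_subset[OF sub assms(1)] finite_subset[OF _ assms(1)]
    by (intro card_mono finite_UN_I) auto
  also have "\<dots> \<le> (\<Sum>x\<in>nball E R s. card (nball E R x))"
    using sub[OF \<open>s \<in> V\<close>] assms(1) by (intro card_UN_le) (auto intro: finite_subset)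
  also have "\<dots> \<le> (\<Sum>x\<in>nball E R s. (d + 1) ^ R)"
    using sub[OF \<open>s \<in> V\<close>] by (intro sum_mono card_nball_le[OF assms(1,2,4)]) auto
  also have "\<dots> \<le> (d + 1) ^ R * (d + 1) ^ R"
    using card_nball_le[OF assms(1,2,4,5)] by simp
  finally show ?thesis by (simp add: power_add[symmetric] mult_2)
qed

text \<open>The second conjunct strengthens the induction: from each vertex of a branch,
  \<open>p\<close> leads back to the top in as many steps as the heights differ. A vertex common to
  two sibling branches would reach both tops in the same number of steps, so the tops coincide; and
  heights below \<open>a\<close> exceed that of \<open>a\<close>, so \<open>a\<close> does not
  recur.\<close>

lemma treelike_if_no_closing:
  fixes E F p h
  assumes root: "h s = (0 :: nat)" "\<And>b. (s, b) \<notin> F"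
    and F: "\<And>x b. (x, b) \<in> F \<Longrightarrow> b = p x \<and> h x = Suc (h b)"
    and edge: "\<And>a b. (a, b) \<in> E \<Longrightarrow> (s, a) \<in> E ^^ h a \<Longrightarrow> h a < R \<Longrightarrow> (a, b) \<in> F \<union> F\<inverse>"
    and a: "(s, a) \<in> E ^^ h a" "h a + k \<le> R" "a = s \<and> v = s \<or> v = p a"
  shows "treelike E k v a \<and> (\<forall>x\<in>branch_ball E k v a. \<exists>j. (p ^^ j) x = a \<and> h x = h a + j)"
  using a
proof (induction k arbitrary: v a)
  case 0
  then show ?case by (auto intro: exI[of _ 0])
next
  case (Suc k)
  have IH: "treelike E k a b \<and> (\<forall>x\<in>branch_ball E k a b. \<exists>j. (p ^^ j) x = b \<and> h x = h b + j)"
    and pb: "p b = a" and hb: "h b = Suc (h a)" if b: "b \<in> E `` {a} - {v}" for b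
  proof -
    have "(a, b) \<in> F \<union> F\<inverse>" using b Suc.prems by (intro edge) auto
    \<comment> \<open>An arc of \<open>F\<close> leaving \<open>a\<close> would lead to its parent
      \<open>v\<close>, and the root has no such arc. So \<open>b\<close> is a child of
      \<open>a\<close>.\<close>
    moreover have "(a, b) \<notin> F" using b Suc.prems F root by blast
    ultimately have "(b, a) \<in> F" by auto
    then show pb: "p b = a" and hb: "h b = Suc (h a)" using F by auto
    have "(s, b) \<in> E ^^ h b" using Suc.prems b hb by auto
    then show "treelike E k a b \<and> (\<forall>x\<in>branch_ball E k a b. \<exists>j. (p ^^ j) x = b \<and> h x = h b + j)"
      using Suc.prems hb pb by (intro Suc.IH) auto
  qed
  have 1: "\<exists>j. (p ^^ j) x = a \<and> h x = h a + j" if b: "b \<in> E `` {a} - {v}" and x: "x \<in> branch_ball E k a b" for b x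
  proof -
    obtain j where "(p ^^ j) x = b" "h x = h b + j" using IH[OF b] x by blast
    then show ?thesis using pb[OF b] hb[OF b] by (intro exI[of _ "Suc j"]) auto
  qed
  have 2: "a \<notin> branch_ball E k a b" if "b \<in> E `` {a} - {v}" for b
    using IH[OF that] hb[OF that] by fastforce
  have 3: "b = b'" if b: "b \<in> E `` {a} - {v}" "b' \<in> E `` {a} - {v}" and x: "x \<in> branch_ball E k a b" "x \<in> branch_ball E k a b'" for b b' x
  proof -
    obtain j where j: "(p ^^ j) x = b" "h x = h b + j" using IH[OF b(1)] x by blast
    obtain j' where j': "(p ^^ j') x = b'" "h x = h b' + j'" using IH[OF b(2)] x by blast
    have "h b = h b'" using hb b by simp
    then show ?thesis using j j' by simp
  qed
  have "\<exists>j. (p ^^ j) x = a \<and> h x = h a + j" if "x \<in> branch_ball E (Suc k) v a" for x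
    using that 1 by (auto intro: exI[of _ 0])
  moreover have "treelike E (Suc k) v a" using IH 2 3 by (auto simp: disjoint_iff)
  ultimately show ?case by blast
qed


text \<open>
  For separated roots \<open>B\<close>, breadth-first search inside the balls produces a forest whose trees have
  bounded size, and each ball that is not a tree contains an edge closing a cycle.
\<close>

lemma card_separated_not_treelike:
  fixes E :: "('a :: linorder \<times> 'a) set"
  assumes V: "finite V" and E: "E \<subseteq> V \<times> V" "sym E" "irrefl E"
    and deg: "\<And>i. i \<in> V \<Longrightarrow> card (E `` {i}) \<le> d"
    and B: "B \<subseteq> V" "\<And>s. s \<in> B \<Longrightarrow> \<not> treelike E R s s"
    and sep: "\<And>s s'. s \<in> B \<Longrightarrow> s' \<in> B \<Longrightarrow> s \<noteq> s' \<Longrightarrow> nball E R s \<inter> nball E R s' = {}"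
  shows "\<exists>F\<subseteq>E. card F \<le> card V \<and> (\<forall>x\<in>V. card (connects F `` {x}) \<le> (d + 1) ^ R)
           \<and> card B \<le> card (closing E F)"
proof -
  have finE: "finite E" using E(1) V finite_subset by blast
  \<comment> \<open>Breadth-first search from all roots at once. Since the balls are disjoint, all
    walks of length at most \<open>R\<close> from \<open>B\<close> to a given vertex start at the
    same root (\<open>uniq\<close>).\<close>
  define h where "h x = (LEAST j. \<exists>s\<in>B. (s, x) \<in> E ^^ j)" for x
  define W where "W = (\<Union>s\<in>B. nball E R s)"
  have WV: "W \<subseteq> V" unfolding W_def using nball_subset[OF E(1)] B by blast
  have h_le: "h x \<le> j" if "s \<in> B" "(s, x) \<in> E ^^ j" for s x j
    unfolding h_def using that by (intro Least_le) auto
  have h_root: "\<exists>s\<in>B. (s, x) \<in> E ^^ h x" and hR: "h x \<le> R" if x: "x \<in> W" for x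
  proof -
    obtain s j where s: "s \<in> B" "j \<le> R" "(s, x) \<in> E ^^ j" using x by (auto simp: W_def nball_def)
    then have "\<exists>j. \<exists>s\<in>B. (s, x) \<in> E ^^ j" by blast
    then show "\<exists>s\<in>B. (s, x) \<in> E ^^ h x" unfolding h_def by (rule LeastI_ex)
    show "h x \<le> R" using h_le[OF s(1,3)] s by simp
  qed
  have uniq: "s = s'" if "s \<in> B" "s' \<in> B" "(s, x) \<in> E ^^ j" "(s', x) \<in> E ^^ j'" "j \<le> R" "j' \<le> R" for s s' x j j'
    using sep[of s s'] that unfolding nball_def by blast
  have in_W: "x \<in> W" if "s \<in> B" "(s, x) \<in> E ^^ j" "j \<le> R" for s x j
    using that by (auto simp: W_def nball_def)
  have h0: "h s = 0" if "s \<in> B" for s using h_le[of s s 0] that by simp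
  have step: "\<exists>u. (x, u) \<in> E \<and> h x = Suc (h u) \<and> u \<in> W" if x: "x \<in> W - B" for x
  proof -
    obtain s where s: "s \<in> B" "(s, x) \<in> E ^^ h x" using h_root x by blast
    have "h x \<noteq> 0" 
    proof
      assume "h x = 0"
      then have "s = x" using s by simp
      then show False using x s by simp
    qed
    then obtain j where j: "h x = Suc j" using not0_implies_Suc by blast
    then obtain u where u: "(s, u) \<in> E ^^ j" "(u, x) \<in> E" using s by auto
    have "h u \<le> j" using h_le s u by blast
    have uW: "u \<in> W" using in_W[OF s(1) u(1)] hR[of x] x j by simp
    obtain s' where s': "s' \<in> B" "(s', u) \<in> E ^^ h u" using h_root[OF uW] by blast
    have "(s', x) \<in> E ^^ Suc (h u)" using s' u by auto
    then have "h x \<le> Suc (h u)" by (rule h_le[OF s'(1)])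
    then show ?thesis using \<open>h u \<le> j\<close> j uW u(2) \<open>sym E\<close> by (auto dest: symD)
  qed
  define p where "p x = (SOME u. (x, u) \<in> E \<and> h x = Suc (h u) \<and> u \<in> W)" for x
  have p: "(x, p x) \<in> E" "h x = Suc (h (p x))" "p x \<in> W" if "x \<in> W - B" for x
    using someI_ex[OF step[OF that]] unfolding p_def by blast+
  define F where "F = (\<lambda>x. (x, p x)) ` (W - B)"
  have FE: "F \<subseteq> E" using p by (auto simp: F_def)
  have "card F \<le> card V" unfolding F_def using V WV
    by (intro order_trans[OF card_image_le card_mono]) (auto intro: finite_subset)
  have symF: "sym (connects F)" by (intro sym_rtrancl sym_Un_converse)
  have conn: "\<exists>s\<in>B. (x, s) \<in> connects F \<and> (s, x) \<in> E ^^ h x" if "x \<in> W" for x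
    using that
  proof (induction "h x" arbitrary: x rule: less_induct)
    case less
    show ?case
    proof (cases "x \<in> B")
      case True
      then show ?thesis using h0 by (intro bexI[of _ x]) auto
    next
      case False
      then have x: "x \<in> W - B" using less by simp
      then obtain s where s: "s \<in> B" "(p x, s) \<in> connects F" "(s, p x) \<in> E ^^ h (p x)"
        using less.hyps[of "p x"] p[OF x] by auto
      have "(x, p x) \<in> F" using x by (simp add: F_def)
      then have "(x, s) \<in> connects F" using s by (meson UnI1 converse_rtrancl_into_rtrancl)
      moreover have "(p x, x) \<in> E" using p(1)[OF x] \<open>sym E\<close> by (auto dest: symD)
      ultimately show ?thesis using s p(2)[OF x] by auto
    qed
  qed
  have root_of: "(s, x) \<in> E ^^ h x" if s: "s \<in> B" "x \<in> nball E R s" for s x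
  proof -
    have xW: "x \<in> W" using s by (auto simp: W_def)
    obtain s' where s': "s' \<in> B" "(s', x) \<in> E ^^ h x" using h_root[OF xW] by blast
    obtain j where "j \<le> R" "(s, x) \<in> E ^^ j" using s by (auto simp: nball_def)
    then have "s = s'" using uniq s s' hR[OF xW] by blast
    then show ?thesis using s' by simp
  qed
  \<comment> \<open>Forest arcs do not leave a ball, so a class inside \<open>W\<close> is no larger
    than a ball; outside \<open>W\<close> classes are singletons.\<close>
  have closed: "z \<in> nball E R s" if s: "s \<in> B" and y: "y \<in> nball E R s" and yz: "(y, z) \<in> F \<union> F\<inverse>" for s y z
  proof -
    have yW: "y \<in> W" using s y by (auto simp: W_def)
    consider "y \<in> W - B" "z = p y" | "z \<in> W - B" "y = p z" using yz by (auto simp: F_def)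
    then show ?thesis
    proof cases
      case 1
      obtain s' where s': "s' \<in> B" "(s', z) \<in> E ^^ h z" using h_root p(3) 1 by blast
      have "(z, y) \<in> E" using p(1) 1 \<open>sym E\<close> by (auto dest: symD)
      then have "(s', y) \<in> E ^^ h y" using s' p(2) 1 by auto
      then have "s' = s" using uniq root_of[OF s y] s s' hR[OF yW] by blast
      moreover have "h z \<le> R" using hR p(3) 1 by blast
      ultimately show ?thesis using s' by (auto simp: nball_def)
    next
      case 2
      have "(y, z) \<in> E" using p(1) 2 \<open>sym E\<close> by (auto dest: symD)
      then have "(s, z) \<in> E ^^ h z" using root_of[OF s y] p(2) 2 by auto
      moreover have "h z \<le> R" using hR 2 by blast
      ultimately show ?thesis by (auto simp: nball_def)
    qed
  qed
  have class_le: "card (connects F `` {x}) \<le> (d + 1) ^ R" if x: "x \<in> V" for x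
  proof (cases "x \<in> W")
    case True
    then obtain s where s: "s \<in> B" "x \<in> nball E R s" by (auto simp: W_def)
    have "(x, y) \<in> connects F \<Longrightarrow> y \<in> nball E R s" for y
      by (induction rule: rtrancl_induct) (use s closed in blast)+
    then have "connects F `` {x} \<subseteq> nball E R s" by auto
    moreover have sV: "s \<in> V" using s B by auto
    ultimately have "card (connects F `` {x}) \<le> card (nball E R s)"
      using nball_subset[OF E(1) sV] V by (intro card_mono) (auto intro: finite_subset)
    also have "\<dots> \<le> (d + 1) ^ R" using V E(1) deg sV by (rule card_nball_le)
    finally show ?thesis .
  next
    case False
    have "(x, y) \<in> connects F \<Longrightarrow> y = x" for y
      by (induction rule: rtrancl_induct) (use False p in \<open>auto simp: F_def\<close>)
    then have "connects F `` {x} \<subseteq> {x}" by auto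
    then have "card (connects F `` {x}) \<le> card {x}" by (intro card_mono) auto
    also have "card {x} \<le> (d + 1) ^ R" by simp
    finally show ?thesis .
  qed
  have "\<exists>e\<in>closing E F. fst e \<in> nball E R s" if s: "s \<in> B" for s
  proof -
    \<comment> \<open>If every edge at a level below \<open>R\<close> belonged to the forest,
      \<open>treelike_if_no_closing\<close> would make the ball a tree. Both ends of the exceptional
      edge are joined to \<open>s\<close> in the forest, so it closes a cycle.\<close>
    have "\<exists>a b. (a, b) \<in> E \<and> (s, a) \<in> E ^^ h a \<and> h a < R \<and> (a, b) \<notin> F \<union> F\<inverse>"
    proof (rule ccontr)
      assume "\<not> ?thesis"
      then have "treelike E R s s \<and> (\<forall>x\<in>branch_ball E R s s. \<exists>j. (p ^^ j) x = s \<and> h x = h s + j)"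
        using s h0 p by (intro treelike_if_no_closing[where F = F and s = s and R = R]) (auto simp: F_def)
      then show False using B s by blast
    qed
    then obtain a b where ab: "(a, b) \<in> E" "(s, a) \<in> E ^^ h a" "h a < R" "(a, b) \<notin> F \<union> F\<inverse>" by blast
    have a: "a \<in> nball E R s" using ab unfolding nball_def by (intro CollectI exI[of _ "h a"]) auto
    have "(s, b) \<in> E ^^ Suc (h a)" using ab by auto
    then have b: "b \<in> nball E R s" using ab unfolding nball_def by (intro CollectI exI[of _ "Suc (h a)"]) auto
    have to_s: "(x, s) \<in> connects F" if x: "x \<in> nball E R s" for x
    proof -
      have "x \<in> W" using s x by (auto simp: W_def)
      then obtain s' where s': "s' \<in> B" "(x, s') \<in> connects F" "(s', x) \<in> E ^^ h x" using conn by blast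
      then have "s' = s" using uniq root_of[OF s x] s hR[OF \<open>x \<in> W\<close>] by blast
      then show ?thesis using s' by simp
    qed
    have "(a, b) \<in> connects F" "(b, a) \<in> connects F"
      using to_s[OF a] to_s[OF b] symF by (meson rtrancl_trans symD)+
    moreover have "(b, a) \<in> E" using ab \<open>sym E\<close> by (auto dest: symD)
    moreover have "a \<noteq> b" using ab \<open>irrefl E\<close> by (auto simp: irrefl_def)
    ultimately have "(a, b) \<in> closing E F \<or> (b, a) \<in> closing E F"
      using ab by (auto simp: closing_def)
    then show ?thesis using a b by (metis fst_conv)
  qed
  then obtain f where f: "\<And>s. s \<in> B \<Longrightarrow> f s \<in> closing E F \<and> fst (f s) \<in> nball E R s" by metis
  have "inj_on f B"
  proof (rule inj_onI)
    fix s s' assume "s \<in> B" "s' \<in> B" "f s = f s'"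
    then have "fst (f s) \<in> nball E R s \<inter> nball E R s'" using f by force
    then show "s = s'" using sep \<open>s \<in> B\<close> \<open>s' \<in> B\<close> by blast
  qed
  moreover have "finite (closing E F)" using finE by (auto simp: closing_def intro: finite_subset[of _ E])
  ultimately have "card B \<le> card (closing E F)" using f by (intro card_inj_on_le[of f]) auto
  then show ?thesis using FE \<open>card F \<le> card V\<close> class_le by blast
qed

text \<open>Colour the bad vertices so that balls within a class are disjoint. A class of at least
  \<epsilon> n vertices would yield \<epsilon> n closing edges over a forest with trees of size at
  most (d + 1) ^ R \<le> \<alpha> n, which \<open>few\<close> excludes; the other factor is the
  number of colours.\<close>

lemma card_not_treelike_le:
  fixes E :: "('a :: linorder \<times> 'a) set" and \<epsilon> \<alpha> :: real
  assumes V: "finite V" and E: "E \<subseteq> V \<times> V" "sym E" "irrefl E"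
    and deg: "\<And>i. i \<in> V \<Longrightarrow> card (E `` {i}) \<le> d"
    and few: "\<not> many_closing V \<epsilon> \<alpha> E" and large: "real ((d + 1) ^ R) \<le> \<alpha> * card V"
  shows "real (card {s \<in> V. \<not> treelike E R s s}) \<le> real ((d + 1) ^ (2 * R) + 1) * (\<epsilon> * card V)"
proof -
  define A where "A = {s \<in> V. \<not> treelike E R s s}"
  let ?K = "(d + 1) ^ (2 * R) + 1" and ?R = "\<lambda>x y. nball E R x \<inter> nball E R y \<noteq> {}"
  have AV: "A \<subseteq> V" and finA: "finite A" using V by (auto simp: A_def)
  have "\<exists>c :: 'a \<Rightarrow> nat. (\<forall>x\<in>A. c x < ?K) \<and> (\<forall>x\<in>A. \<forall>y\<in>A. x \<noteq> y \<longrightarrow> ?R x y \<longrightarrow> c x \<noteq> c y)"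
  proof (rule greedy_coloring[OF finA])
    fix x assume "x \<in> A"
    then show "card {y \<in> A. ?R x y \<and> y \<noteq> x} < ?K"
      using AV by (intro nball_conflicts_le[OF V E(1,2) deg]) auto
  qed (simp add: Int_commute)
  then obtain c :: "'a \<Rightarrow> nat" where c: "\<forall>x\<in>A. c x < ?K"
     "\<forall>x\<in>A. \<forall>y\<in>A. x \<noteq> y \<longrightarrow> ?R x y \<longrightarrow> c x \<noteq> c y"
    by (elim exE conjE)
  have cls: "real (card {s \<in> A. c s = k}) \<le> \<epsilon> * card V" for k
  proof -
    have "\<exists>F\<subseteq>E. card F \<le> card V \<and> (\<forall>x\<in>V. card (connects F `` {x}) \<le> (d + 1) ^ R)
        \<and> card {s \<in> A. c s = k} \<le> card (closing E F)"
      by (rule card_separated_not_treelike[OF V E deg]) (use c(2) in \<open>auto simp: A_def\<close>)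
    then obtain F where F: "F \<subseteq> E" "card F \<le> card V" "\<forall>x\<in>V. card (connects F `` {x}) \<le> (d + 1) ^ R"
      "card {s \<in> A. c s = k} \<le> card (closing E F)"
      by blast
    have "\<forall>x\<in>V. real (card (connects F `` {x})) \<le> \<alpha> * card V"
      using F(3) large by (meson of_nat_le_iff order_trans)
    then have "\<not> \<epsilon> * card V \<le> card (closing E F)" using few F(1,2) unfolding many_closing_def by blast
    then show ?thesis using F(4) by linarith
  qed
  have "A = (\<Union>k<?K. {s \<in> A. c s = k})" using c(1) by auto
  then have "card A \<le> (\<Sum>k<?K. card {s \<in> A. c s = k})"
    using card_UN_le[of "{..<?K}" "\<lambda>k. {s \<in> A. c s = k}"] by simp
  then have "real (card A) \<le> (\<Sum>k<?K. real (card {s \<in> A. c s = k}))" by (simp flip: of_nat_sum)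
  also have "\<dots> \<le> (\<Sum>k<?K. \<epsilon> * card V)" by (intro sum_mono cls)
  finally show ?thesis by (simp only: A_def sum_constant card_lessThan)
qed

section \<open>Non-backtracking walks and dense subgraphs\<close>

text \<open>Only immediate reversal is forbidden, so extending a walk is a local condition on the
  last arc. Membership in \<open>T\<close> is asked of \<open>w\<close> and its successors.\<close>

primrec nb_walk :: "('a \<times> 'a) set \<Rightarrow> 'a set \<Rightarrow> nat \<Rightarrow> 'a \<Rightarrow> 'a \<Rightarrow> bool" where
  "nb_walk E T 0 v w \<longleftrightarrow> w \<in> T"
| "nb_walk E T (Suc L) v w \<longleftrightarrow> w \<in> T \<and> (\<exists>x\<in>E `` {w} - {v}. nb_walk E T L w x)"

definition branches :: "('a \<times> 'a) set \<Rightarrow> 'a set \<Rightarrow> nat \<Rightarrow> 'a \<Rightarrow> 'a set" where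
  "branches E T L v = {w \<in> E `` {v}. nb_walk E T L v w}"

lemma nb_walk_in: "nb_walk E T L v w \<Longrightarrow> w \<in> T"
  by (cases L) auto

lemma nb_walk_Suc: "nb_walk E T (Suc L) v w \<Longrightarrow> nb_walk E T L v w"
  by (induction L arbitrary: v w) auto

lemma nb_walk_mono: "L \<le> M \<Longrightarrow> nb_walk E T M v w \<Longrightarrow> nb_walk E T L v w"
proof (induction rule: dec_induct)
  case (step n)
  then show ?case using nb_walk_Suc[OF step.prems] by simp
qed

lemma branches_mono: "L \<le> M \<Longrightarrow> branches E T M v \<subseteq> branches E T L v"
  by (auto simp: branches_def dest: nb_walk_mono)

definition two_sided :: "('a \<times> 'a) set \<Rightarrow> 'a set \<Rightarrow> nat \<Rightarrow> ('a \<times> 'a) set" where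
  "two_sided E T L = {(v, w) \<in> E. nb_walk E T L v w \<and> nb_walk E T L w v}"

text \<open>Coming from \<open>w\<close>, the walk continues along a branch of \<open>v\<close>
  other than \<open>w\<close>. The step beyond \<open>v\<close> uses up one unit, so this branch has
  length \<open>L\<close>, not \<open>Suc L\<close>; the mismatch of levels is what
  \<open>ex_small_decrement\<close> repairs.\<close>

lemma two_sided_Suc_Image:
  "two_sided E T (Suc L) `` {v} =
     {w \<in> branches E T (Suc L) v. v \<in> T \<and> branches E T L v - {w} \<noteq> {}}"
  by (auto simp: two_sided_def branches_def)

text \<open>Degrees in the subgraph are at least 2, with a surplus where three long branches start,
  except for vertices of degree 1. Such a vertex has one branch of length \<open>Suc L\<close> but
  at least two of length \<open>L\<close>, and the bracketed difference pays for it.\<close>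

lemma degree_bound_two_sided:
  assumes "finite E"
  shows "int (card (two_sided E T (Suc L) `` {v})) - 2 * of_bool (two_sided E T (Suc L) `` {v} \<noteq> {})
    \<ge> of_bool (v \<in> T \<and> card (branches E T (Suc L) v) \<ge> 3)
      - (of_bool (v \<in> T \<and> card (branches E T L v) \<ge> 2)
         - of_bool (v \<in> T \<and> card (branches E T (Suc L) v) \<ge> 2))"
proof -
  let ?H = "two_sided E T (Suc L) `` {v}" and ?B = "branches E T (Suc L) v" and ?B' = "branches E T L v"
  have fin: "finite (E `` {v})"
    using assms by (rule finite_Image)
  have finB': "finite ?B'" and finB: "finite ?B" and finH: "finite ?H"
    using fin by (auto intro!: finite_subset[OF _ fin] simp: branches_def two_sided_Suc_Image)
  have sub: "?B \<subseteq> ?B'" by (rule branches_mono) simp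
  show ?thesis
  proof (cases "v \<in> T")
    case False
    then show ?thesis by (simp add: two_sided_Suc_Image)
  next
    case True
    show ?thesis
    proof (cases "card ?B \<ge> 2")
      case two: True
      have "?B' - {w} \<noteq> {}" for w
      proof
        assume "?B' - {w} = {}"
        then have "?B \<subseteq> {w}" using sub by auto
        then have "card ?B \<le> 1" using card_mono[of "{w}" ?B] by simp
        with two show False by simp
      qed
      then have H: "?H = ?B" using True by (auto simp: two_sided_Suc_Image)
      have "card ?B' \<ge> 2" using card_mono[OF finB' sub] two by simp
      moreover have "?B \<noteq> {}" using two by auto
      ultimately show ?thesis using two True unfolding H by auto
    next
      case small: False
      show ?thesis
      proof (cases "?H = {}")
        case True
        then show ?thesis using small by auto
      next
        case False
        then obtain w where w: "w \<in> ?B" "?B' - {w} \<noteq> {}" by (auto simp: two_sided_Suc_Image)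
        then obtain x where "x \<in> ?B'" "x \<noteq> w" by auto
        then have "card {w, x} \<le> card ?B'" using w sub by (intro card_mono finB') auto
        then have "card ?B' \<ge> 2" using \<open>x \<noteq> w\<close> by simp
        moreover have "card ?H \<ge> 1" using False finH by (simp add: Suc_le_eq card_gt_0_iff)
        ultimately show ?thesis using small False True by auto
      qed
    qed
  qed
qed

text \<open>Telescoping: \<open>M\<close> larger decrements would add up to more than
  \<open>a 0\<close>.\<close>

lemma ex_small_decrement:
  fixes a :: "nat \<Rightarrow> nat"
  assumes "M \<ge> 1" "a 0 \<le> n" 
  shows "\<exists>L<M. real (a L) - real (a (Suc L)) \<le> real n / real M"
proof (rule ccontr)
  assume "\<not> ?thesis"
  then have *: "L < M \<Longrightarrow> real (a L) - real (a (Suc L)) > real n / real M" for L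
    by (auto simp: not_le)
  have "real n = (\<Sum>L<M. real n / real M)" using assms by simp
  also have "\<dots> < (\<Sum>L<M. real (a L) - real (a (Suc L)))"
    using assms * by (intro sum_strict_mono) (auto simp: lessThan_empty_iff)
  also have "\<dots> = real (a 0) - real (a M)"
    by (rule sum_lessThan_telescope')
  finally show False using assms by simp
qed

text \<open>Sum the bound at each vertex, at a level below \<open>M\<close> where few vertices cease
  to have two branches. Arcs count each edge twice, so the difference is twice the excess of edges
  over vertices.\<close>

lemma ex_dense_subgraph:
  assumes fin: "finite V" and E: "E \<subseteq> V \<times> V" and "sym E" and "M \<ge> 1"
  shows "\<exists>H\<subseteq>E. sym H \<and> Field H \<subseteq> T \<and>
    real (card H) - 2 * real (card (Field H))
      \<ge> real (card {v \<in> V \<inter> T. card (branches E T M v) \<ge> 3}) - real (card V) / real M"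
proof -
  have finE: "finite E" using fin E finite_subset by blast
  define A where "A L = {v \<in> V \<inter> T. card (branches E T L v) \<ge> 2}" for L
  have "card (A 0) \<le> card V" unfolding A_def by (intro card_mono fin) auto
  then obtain L where L: "L < M" "real (card (A L)) - real (card (A (Suc L))) \<le> real (card V) / real M"
    using ex_small_decrement[of M "\<lambda>L. card (A L)" "card V"] \<open>M \<ge> 1\<close> by auto
  let ?H = "two_sided E T (Suc L)"
  have HE: "?H \<subseteq> E" by (auto simp: two_sided_def)
  have symH: "sym ?H" using \<open>sym E\<close> by (auto simp: two_sided_def sym_def)
  have HT: "Field ?H \<subseteq> T" by (auto simp: two_sided_def Field_def dest: nb_walk_in)
  have Fld: "Field ?H = {v \<in> V. ?H `` {v} \<noteq> {}}"
    using symH HE E unfolding Field_def sym_def by blast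
  have finH: "finite ?H" using HE finE finite_subset by blast
  let ?g = "\<lambda>v. (of_bool (v \<in> T \<and> card (branches E T (Suc L) v) \<ge> 3)
      - (of_bool (v \<in> T \<and> card (branches E T L v) \<ge> 2)
         - of_bool (v \<in> T \<and> card (branches E T (Suc L) v) \<ge> 2)) :: int)"
  have cnt: "(\<Sum>v\<in>V. of_bool (P v)) = int (card {v \<in> V. P v})" for P
    using fin by (simp add: of_bool_def sum.If_cases Int_def)
  have "int (card {v \<in> V \<inter> T. card (branches E T M v) \<ge> 3})
      \<le> int (card {v \<in> V \<inter> T. card (branches E T (Suc L) v) \<ge> 3})"
  proof -
    have "card (branches E T M v) \<le> card (branches E T (Suc L) v)" for v
      using L by (intro card_mono branches_mono)
        (auto intro: finite_subset[OF _ finite_Image[OF finE, of "{v}"]] simp: branches_def)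
    then show ?thesis using fin by (intro of_nat_mono card_mono) (auto intro: order_trans)
  qed
  also have "\<dots> - (int (card (A L)) - int (card (A (Suc L)))) = (\<Sum>v\<in>V. ?g v)"
    unfolding sum_subtractf cnt A_def by (simp add: conj_commute Int_def conj_left_commute)
  also have "\<dots> \<le> (\<Sum>v\<in>V. int (card (?H `` {v})) - 2 * of_bool (?H `` {v} \<noteq> {}))"
    by (intro sum_mono degree_bound_two_sided finE)
  also have "\<dots> = int (card ?H) - 2 * int (card (Field ?H))"
    using card_eq_sum_Image[OF fin finH] HE E unfolding sum_subtractf Fld sum_distrib_left[symmetric] cnt
    by (simp add: subset_trans)
  finally have "int (card {v \<in> V \<inter> T. card (branches E T M v) \<ge> 3}) - (int (card (A L)) - int (card (A (Suc L))))
     \<le> int (card ?H) - 2 * int (card (Field ?H))" by simp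
  then have "real_of_int (int (card {v \<in> V \<inter> T. card (branches E T M v) \<ge> 3}) - (int (card (A L)) - int (card (A (Suc L)))))
     \<le> real_of_int (int (card ?H) - 2 * int (card (Field ?H)))" by (simp only: of_int_le_iff)
  then have "real (card {v \<in> V \<inter> T. card (branches E T M v) \<ge> 3}) - real (card V) / real M \<le> real (card ?H) - 2 * real (card (Field ?H))"
    using L by simp
  then show ?thesis using HE symH HT by blast
qed

section \<open>Independent ages\<close>

text \<open>Free of measurability, so that it follows for recursive predicates by plain induction;
  \<open>indep_depends\<close> turns it into independence.\<close>

definition depends :: "'a set \<Rightarrow> (('a \<Rightarrow> real) \<Rightarrow> bool) \<Rightarrow> bool" where
  "depends J P \<longleftrightarrow> (\<forall>X Y. (\<forall>i\<in>J. X i = Y i) \<longrightarrow> P X = P Y)"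

lemma dependsD: "depends J P \<Longrightarrow> (\<And>i. i \<in> J \<Longrightarrow> X i = Y i) \<Longrightarrow> P X \<longleftrightarrow> P Y"
  by (auto simp: depends_def)

abbreviation unif :: "real measure" where
  "unif \<equiv> uniform_measure lborel {0..1}"

lemma prob_space_unif: "prob_space unif"
  by (rule prob_space_uniform_measure) auto

lemma measure_unif_Ico: "0 \<le> a \<Longrightarrow> a \<le> b \<Longrightarrow> b \<le> 1 \<Longrightarrow> measure unif {a..<b} = b - a"
proof -
  assume "0 \<le> a" "a \<le> b" "b \<le> 1"
  then have "{0..1} \<inter> {a..<b} = {a..<b}" by auto
  then show ?thesis using \<open>a \<le> b\<close> by (subst measure_uniform_measure) auto
qed

locale ages =
  fixes V :: "'a set"
  assumes finite_V: "finite V" and V_ne: "V \<noteq> {}"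
begin

abbreviation "M \<equiv> age_measure V"

sublocale prob_space M
  unfolding age_measure_def by (intro prob_space_PiM prob_space_unif)

lemma age_measurable [measurable]: "v \<in> V \<Longrightarrow> (\<lambda>X. X v) \<in> borel_measurable M"
  unfolding age_measure_def by measurable

lemma pred_less: "u \<in> V \<Longrightarrow> v \<in> V \<Longrightarrow> Measurable.pred M (\<lambda>X. X u < X v)"
  by measurable

lemma pred_min:
  assumes "v \<in> V" "S \<subseteq> V"
  shows "Measurable.pred M (\<lambda>X. \<forall>u\<in>S. X v < X u)"
  using assms finite_subset[OF assms(2) finite_V] by (intro pred_intros_finite pred_less) auto

lemma pred_box:
  assumes "S \<subseteq> V"
  shows "Measurable.pred M (\<lambda>X. \<forall>i\<in>S. a i \<le> X i \<and> X i < b i)"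
proof -
  have "Measurable.pred M (\<lambda>X. a i \<le> X i \<and> X i < b i)" if "i \<in> S" for i
  proof -
    have [measurable]: "i \<in> V" using that assms by auto
    show ?thesis by measurable
  qed
  then show ?thesis using finite_subset[OF assms finite_V] by (intro pred_intros_finite)
qed

lemma indep_ages: "indep_vars (\<lambda>_. unif) (\<lambda>i X. X i) V"
proof (subst indep_vars_iff_distr_eq_PiM'[OF V_ne])
  show "random_variable unif (\<lambda>X. X i)" if "i \<in> V" for i
    using that unfolding age_measure_def by measurable
  have "distr M (PiM V (\<lambda>_. unif)) (\<lambda>X. \<lambda>i\<in>V. X i) = distr M M (\<lambda>X. X)"
    by (rule distr_cong) (auto simp: age_measure_def space_PiM)
  also have "\<dots> = M" by (rule distr_id)
  also have "M = PiM V (\<lambda>i. distr M unif (\<lambda>X. X i))"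
    unfolding age_measure_def
    by (intro PiM_cong refl distr_PiM_component[symmetric] finite_V prob_space_unif)
  finally show "distr M (PiM V (\<lambda>_. unif)) (\<lambda>X. \<lambda>i\<in>V. X i) = PiM V (\<lambda>i. distr M unif (\<lambda>X. X i))" .
qed

lemma indep_depends:
  assumes "disjoint_family_on J A" "\<And>a. a \<in> A \<Longrightarrow> J a \<subseteq> V"
    and dep: "\<And>a. a \<in> A \<Longrightarrow> depends (J a) (P a)"
    and P: "\<And>a. a \<in> A \<Longrightarrow> Measurable.pred M (P a)"
  shows "indep_vars (\<lambda>_. count_space UNIV) P A"
proof -
  have ind: "indep_vars (\<lambda>a. PiM (J a) (\<lambda>_. unif)) (\<lambda>a X. restrict (\<lambda>i. X i) (J a)) A"
    by (rule indep_vars_restrict[OF indep_ages]) fact+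
  \<comment> \<open>Setting the other coordinates to 0 exhibits \<open>P a\<close> as a measurable
    function of the ages in \<open>J a\<close> alone.\<close>
  define ext where "ext a Y = (\<lambda>i\<in>V. if i \<in> J a then Y i else (0 :: real))" for a and Y :: "'a \<Rightarrow> real"
  have meas: "(\<lambda>Y. P a (ext a Y)) \<in> measurable (PiM (J a) (\<lambda>_. unif)) (count_space UNIV)" if "a \<in> A" for a
  proof (rule measurable_compose[OF _ P[OF that]])
    show "ext a \<in> measurable (PiM (J a) (\<lambda>_. unif)) M"
      unfolding ext_def age_measure_def
    proof (rule measurable_restrict)
      fix i assume "i \<in> V"
      show "(\<lambda>Y. if i \<in> J a then Y i else 0) \<in> measurable (PiM (J a) (\<lambda>_. unif)) unif"
        by (cases "i \<in> J a") (simp_all add: measurable_component_singleton)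
    qed
  qed
  have "indep_vars (\<lambda>_. count_space UNIV) (\<lambda>a X. P a (ext a (restrict (\<lambda>i. X i) (J a)))) A"
    by (rule indep_vars_compose2[OF ind meas])
  moreover have "P a (ext a (restrict (\<lambda>i. X i) (J a))) = P a X" if "a \<in> A" for a X
    using assms(2)[OF that] by (intro dependsD[OF dep[OF that]]) (auto simp: ext_def)
  ultimately show ?thesis by (simp cong: indep_vars_cong)
qed

lemma prob_all:
  assumes "finite A" "disjoint_family_on J A" "\<And>a. a \<in> A \<Longrightarrow> J a \<subseteq> V"
    and "\<And>a. a \<in> A \<Longrightarrow> depends (J a) (P a)"
    and "\<And>a. a \<in> A \<Longrightarrow> Measurable.pred M (P a)"
  shows "prob {X \<in> space M. \<forall>a\<in>A. P a X} = (\<Prod>a\<in>A. prob {X \<in> space M. P a X})"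
proof (cases "A = {}")
  case True
  then show ?thesis by (simp add: prob_space)
next
  case False
  have "indep_vars (\<lambda>_. count_space UNIV) P A" by (rule indep_depends) fact+
  then have "prob (\<Inter>a\<in>A. P a -` {True} \<inter> space M) = (\<Prod>a\<in>A. prob (P a -` {True} \<inter> space M))"
    using False assms(1) by (intro indep_varsD_finite) auto
  moreover have "(\<Inter>a\<in>A. P a -` {True} \<inter> space M) = {X \<in> space M. \<forall>a\<in>A. P a X}" using False by auto
  moreover have "P a -` {True} \<inter> space M = {X \<in> space M. P a X}" for a by auto
  ultimately show ?thesis by simp
qed

lemma prob_conj:
  assumes "J \<inter> K = {}" "J \<subseteq> V" "K \<subseteq> V" "depends J P" "depends K Q"
    and "Measurable.pred M P" "Measurable.pred M Q"
  shows "prob {X \<in> space M. P X \<and> Q X} = prob {X \<in> space M. P X} * prob {X \<in> space M. Q X}"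
proof -
  have "prob {X \<in> space M. \<forall>b\<in>UNIV. (if b then P else Q) X}
      = (\<Prod>b\<in>UNIV. prob {X \<in> space M. (if b then P else Q) X})"
    using assms by (intro prob_all[where J = "\<lambda>b. if b then J else K"]) (auto simp: disjoint_family_on_def)
  moreover have "{X \<in> space M. \<forall>b\<in>UNIV. (if b then P else Q) X} = {X \<in> space M. P X \<and> Q X}"
    by (auto split: if_splits)
  ultimately show ?thesis by (simp add: UNIV_bool mult.commute)
qed

lemma prob_Ico:
  assumes "v \<in> V" "0 \<le> a" "a \<le> b" "b \<le> 1"
  shows "prob {X \<in> space M. a \<le> X v \<and> X v < b} = b - a"
proof -
  have "distr M unif (\<lambda>X. X v) = unif"
    unfolding age_measure_def using assms by (intro distr_PiM_component finite_V prob_space_unif)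
  then have "measure unif {a..<b} = measure (distr M unif (\<lambda>X. X v)) {a..<b}" by simp
  also have "\<dots> = prob ((\<lambda>X. X v) -` {a..<b} \<inter> space M)"
    using assms by (intro measure_distr) (auto simp: age_measure_def)
  also have "(\<lambda>X. X v) -` {a..<b} \<inter> space M = {X \<in> space M. a \<le> X v \<and> X v < b}" by auto
  finally show ?thesis using measure_unif_Ico[OF assms(2-4)] by (simp only:)
qed

lemma prob_box:
  assumes "J \<subseteq> V" "\<And>i. i \<in> J \<Longrightarrow> 0 \<le> a i \<and> a i \<le> b i \<and> b i \<le> 1"
  shows "prob {X \<in> space M. \<forall>i\<in>J. a i \<le> X i \<and> X i < b i} = (\<Prod>i\<in>J. b i - a i)"
proof -
  have fJ: "finite J" using assms finite_V finite_subset by blast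
  have "prob {X \<in> space M. \<forall>i\<in>J. a i \<le> X i \<and> X i < b i}
      = (\<Prod>i\<in>J. prob {X \<in> space M. a i \<le> X i \<and> X i < b i})"
  proof (rule prob_all[where J = "\<lambda>i. {i}", OF fJ])
    fix i assume "i \<in> J"
    then have [measurable]: "i \<in> V" using assms by auto
    show "Measurable.pred M (\<lambda>X. a i \<le> X i \<and> X i < b i)" by measurable
  qed (use assms in \<open>auto simp: disjoint_family_on_def depends_def\<close>)
  also have "\<dots> = (\<Prod>i\<in>J. b i - a i)" using assms by (intro prod.cong prob_Ico) auto
  finally show ?thesis .
qed

end

text \<open>By Bernoulli's inequality (n + 1) ^ (k + 1) - n ^ (k + 1) \<le> (k + 1) (n + 1) ^
  k.\<close>

lemma sum_powers_ge: "real n ^ Suc k \<le> real (Suc k) * (\<Sum>i\<le>n. real i ^ k)"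
proof (induction n)
  case (Suc n)
  have "1 + real (Suc k) * (- 1 / real (Suc n)) \<le> (1 + (- 1 / real (Suc n))) ^ Suc k"
    by (rule Bernoulli_inequality) (simp add: field_simps)
  then have "(1 - real (Suc k) / real (Suc n)) * real (Suc n) ^ Suc k
      \<le> (1 - 1 / real (Suc n)) ^ Suc k * real (Suc n) ^ Suc k"
    by (intro mult_right_mono) auto
  also have "\<dots> = real n ^ Suc k"
    unfolding power_mult_distrib[symmetric] by (simp add: left_diff_distrib)
  also have "(1 - real (Suc k) / real (Suc n)) * real (Suc n) ^ Suc k
      = real (Suc n) ^ Suc k - real (Suc k) * real (Suc n) ^ k"
    by (simp add: left_diff_distrib)
  finally have "real (Suc n) ^ Suc k \<le> real n ^ Suc k + real (Suc k) * real (Suc n) ^ k" by simp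
  then show ?case using Suc.IH by (simp only: sum.atMost_Suc distrib_left)
qed simp

context ages
begin

text \<open>A Riemann sum for \<open>\<integral> (1 - x) ^ card S dx\<close>, which needs only probabilities of boxes.\<close>

lemma prob_min_ge_approx:
  assumes "v \<notin> S" "insert v S \<subseteq> V" "N > 0"
  shows "prob {X \<in> space M. \<forall>u\<in>S. X v < X u} \<ge> (1 - 1 / real N) ^ Suc (card S) / Suc (card S)"
proof -
  let ?k = "card S"
  have finS: "finite S" using assms(2) finite_subset[OF _ finite_V] by auto
  \<comment> \<open>In the box \<open>B j\<close> the age of \<open>v\<close> lies in the j-th
    interval of length 1 / N, counted from 0, and all ages in \<open>S\<close> lie beyond that
    interval.\<close>
  define lo hi where "lo j i = (if i = v then real j / N else real (Suc j) / N)"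
    and "hi j i = (if i = v then real (Suc j) / N else 1)" for j i
  define B where "B j = {X \<in> space M. \<forall>i\<in>insert v S. lo j i \<le> X i \<and> X i < hi j i}" for j
  have B: "prob (B j) = real (N - Suc j) ^ ?k / real N ^ Suc ?k" if "j < N" for j
  proof -
    have "0 \<le> real j / N" "real j / N \<le> real (Suc j) / N" "real (Suc j) / N \<le> 1"
      using that by (auto intro: divide_right_mono)
    then have "prob (B j) = (\<Prod>i\<in>insert v S. hi j i - lo j i)"
      unfolding B_def using assms by (intro prob_box) (auto simp: lo_def hi_def)
    also have "\<dots> = (hi j v - lo j v) * (\<Prod>i\<in>S. hi j i - lo j i)" using finS assms by simp
    also have "(\<Prod>i\<in>S. hi j i - lo j i) = (\<Prod>i\<in>S. 1 - real (Suc j) / N)"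
      using assms by (intro prod.cong) (auto simp: lo_def hi_def)
    also have "\<dots> = (real (N - Suc j) / N) ^ ?k" using that by (simp add: of_nat_diff diff_divide_distrib)
    also have "hi j v - lo j v = 1 / N" by (simp add: hi_def lo_def diff_divide_distrib[symmetric])
    finally show ?thesis by (simp add: power_divide)
  qed
  have meas: "B j \<in> events" for j
    using pred_box[OF assms(2)] unfolding B_def pred_def by simp
  have disj: "disjoint_family_on B {..<N}"
  proof -
    have False if "X \<in> B i" "X \<in> B j" "i < j" for X i j
    proof -
      have "X v < real (Suc i) / N" "real j / N \<le> X v" using that by (auto simp: B_def lo_def hi_def)
      then have "real j < real (Suc i)" using assms by (simp add: field_simps)
      then show False using that by simp
    qed
    then show ?thesis unfolding disjoint_family_on_def by (metis disjoint_iff nat_neq_iff)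
  qed
  have sub: "(\<Union>j<N. B j) \<subseteq> {X \<in> space M. \<forall>u\<in>S. X v < X u}"
  proof
    fix X assume "X \<in> (\<Union>j<N. B j)"
    then obtain j where X: "X \<in> B j" by auto
    have "X v < X u" if "u \<in> S" for u
    proof -
      have "X v < hi j v" "lo j u \<le> X u" "u \<noteq> v" using X that assms(1) by (auto simp: B_def)
      then show ?thesis by (simp add: lo_def hi_def)
    qed
    then show "X \<in> {X \<in> space M. \<forall>u\<in>S. X v < X u}" using X by (simp add: B_def)
  qed
  have "{X \<in> space M. \<forall>u\<in>S. X v < X u} \<in> events"
    using pred_min[of v S] assms unfolding pred_def by simp
  moreover have "(\<Sum>j<N. prob (B j)) = prob (\<Union>j<N. B j)"
    using meas disj by (intro finite_measure_finite_Union[symmetric]) auto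
  ultimately have "(\<Sum>j<N. prob (B j)) \<le> prob {X \<in> space M. \<forall>u\<in>S. X v < X u}"
    using finite_measure_mono[OF sub] by simp
  also have "(\<Sum>j<N. prob (B j)) = (\<Sum>j<N. real (N - Suc j) ^ ?k) / real N ^ Suc ?k"
    using B by (simp add: sum_divide_distrib)
  also have "(\<Sum>j<N. real (N - Suc j) ^ ?k) = (\<Sum>i<N. real i ^ ?k)"
    by (rule sum.nat_diff_reindex[of "\<lambda>i. real i ^ ?k"])
  also have "\<dots> = (\<Sum>i\<le>N - 1. real i ^ ?k)"
    using assms by (intro sum.cong) auto
  finally have 1: "(\<Sum>i\<le>N - 1. real i ^ ?k) / real N ^ Suc ?k \<le> prob {X \<in> space M. \<forall>u\<in>S. X v < X u}" .
  have "(1 - 1 / real N) ^ Suc ?k / Suc ?k = (real (N - 1) ^ Suc ?k / Suc ?k) / real N ^ Suc ?k"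
  proof -
    have "1 - 1 / real N = real (N - 1) / N" using assms by (simp add: field_simps of_nat_diff)
    then show ?thesis by (simp add: power_divide)
  qed
  also have "\<dots> \<le> (\<Sum>i\<le>N - 1. real i ^ ?k) / real N ^ Suc ?k"
    using sum_powers_ge[of "N - 1" ?k] by (intro divide_right_mono) (auto simp: field_simps)
  finally show ?thesis using 1 by simp
qed

lemma prob_min_ge:
  assumes "v \<notin> S" "insert v S \<subseteq> V"
  shows "prob {X \<in> space M. \<forall>u\<in>S. X v < X u} \<ge> 1 / (card S + 1)"
proof (rule tendsto_upperbound)
  have "(\<lambda>N. (1 - 1 / real N) ^ Suc (card S) / Suc (card S)) \<longlonglongrightarrow> (1 - 0) ^ Suc (card S) / Suc (card S)"
    by (intro tendsto_intros lim_1_over_n) auto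
  then show "(\<lambda>N. (1 - 1 / real N) ^ Suc (card S) / Suc (card S)) \<longlonglongrightarrow> 1 / (card S + 1)"
    by (simp add: add.commute)
  show "\<forall>\<^sub>F N in sequentially. (1 - 1 / real N) ^ Suc (card S) / Suc (card S)
      \<le> prob {X \<in> space M. \<forall>u\<in>S. X v < X u}"
    using eventually_gt_at_top[of "0::nat"] by eventually_elim (rule prob_min_ge_approx[OF assms])
qed simp

end

section \<open>Survival along tree-like branches\<close>

text \<open>The weighted sum \<open>S\<close> vanishes outside the union, and 2 t S - t^2 S^2 \<le>
  1 since (1 - t S)^2 \<ge> 0. Integrate and take t = 1 / Q, the maximiser of 2 t - t^2 Q.\<close>

lemma (in prob_space) weighted_second_moment:
  fixes w :: "'b \<Rightarrow> real"
  assumes I: "finite I" and A: "\<And>i. i \<in> I \<Longrightarrow> A i \<in> events"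
    and one: "(\<Sum>i\<in>I. w i * prob (A i)) = 1"
    and two: "(\<Sum>i\<in>I. \<Sum>j\<in>I. w i * w j * prob (A i \<inter> A j)) \<le> Q" and "Q > 0"
  shows "prob (\<Union>i\<in>I. A i) \<ge> 1 / Q"
proof -
  define S where "S x = (\<Sum>i\<in>I. w i * indicator (A i) x)" for x :: 'a
  have int: "integrable M (\<lambda>x. indicator B x :: real)" if "B \<in> events" for B
    using that by (simp add: integrable_real_indicator emeasure_eq_measure)
  have intS: "integrable M S" unfolding S_def using A by (auto intro!: Bochner_Integration.integrable_sum int)
  have ES: "expectation S = 1"
    unfolding S_def using A one by (subst Bochner_Integration.integral_sum) (auto intro!: int)
  have S2: "(\<lambda>x. (S x)\<^sup>2) = (\<lambda>x. \<Sum>i\<in>I. \<Sum>j\<in>I. w i * w j * indicator (A i \<inter> A j) x)"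
    unfolding S_def power2_eq_square sum_product by (simp add: indicator_inter_arith mult_ac)
  have intS2: "integrable M (\<lambda>x. (S x)\<^sup>2)"
    unfolding S2 using A by (auto intro!: Bochner_Integration.integrable_sum Bochner_Integration.integrable_mult_right int)
  have "expectation (\<lambda>x. (S x)\<^sup>2) = (\<Sum>i\<in>I. \<Sum>j\<in>I. expectation (\<lambda>x. w i * w j * indicator (A i \<inter> A j) x))"
    unfolding S2 using A
    by (subst Bochner_Integration.integral_sum; (intro sum.cong refl Bochner_Integration.integral_sum)?)
      (auto intro!: Bochner_Integration.integrable_sum Bochner_Integration.integrable_mult_right int)
  also have "\<dots> = (\<Sum>i\<in>I. \<Sum>j\<in>I. w i * w j * prob (A i \<inter> A j))"
    using A by (intro sum.cong refl) (simp add: sets.Int Int_absorb2 sets.sets_into_space)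
  finally have ES2: "expectation (\<lambda>x. (S x)\<^sup>2) \<le> Q" using two by simp
  define t where "t = 1 / Q"
  have U: "(\<Union>i\<in>I. A i) \<in> events" using I A by auto
  have "2 * t - t\<^sup>2 * Q \<le> 2 * t * expectation S - t\<^sup>2 * expectation (\<lambda>x. (S x)\<^sup>2)"
    using ES2 ES by (simp add: mult_left_mono)
  also have "\<dots> = expectation (\<lambda>x. 2 * t * S x - t\<^sup>2 * (S x)\<^sup>2)"
    using intS intS2 by simp
  also have "\<dots> \<le> expectation (indicator (\<Union>i\<in>I. A i))"
  proof (rule integral_mono)
    show "integrable M (\<lambda>x. 2 * t * S x - t\<^sup>2 * (S x)\<^sup>2)" using intS intS2 by auto
    show "integrable M (\<lambda>x. indicator (\<Union>i\<in>I. A i) x :: real)" using U by (rule int)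
    fix x
    show "2 * t * S x - t\<^sup>2 * (S x)\<^sup>2 \<le> indicator (\<Union>i\<in>I. A i) x"
    proof (cases "x \<in> (\<Union>i\<in>I. A i)")
      case True
      have "0 \<le> (1 - t * S x)\<^sup>2" by simp
      then show ?thesis using True by (simp add: power2_eq_square algebra_simps)
    next
      case False
      then have "S x = 0" by (auto simp: S_def indicator_def)
      then show ?thesis by simp
    qed
  qed
  also have "\<dots> = prob (\<Union>i\<in>I. A i)" using U by simp
  also have "2 * t - t\<^sup>2 * Q = 1 / Q" using \<open>Q > 0\<close> by (simp add: t_def power2_eq_square)
  finally show ?thesis .
qed

lemma (in prob_space) prob_ge_by_complement:
  assumes "A \<in> events" "B \<in> events"
  shows "prob (A \<inter> B) \<ge> prob A + prob B - 1"
proof -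
  have "prob (A \<union> B) = prob A + prob B - prob (A \<inter> B)" using assms by (simp add: measure_Un3 fmeasurable_eq_sets)
  then show ?thesis using prob_le_1[of "A \<union> B"] by simp
qed

context ages
begin

text \<open>Two disjoint events add up. In the first, \<open>a\<close> precedes all of
  \<open>S\<close> and \<open>b\<close> all of \<open>T\<close>, independently. In the second, one
  \<open>s\<close> in \<open>S\<close>, then \<open>a\<close>, then \<open>b\<close>, then all
  others have ages in successive quarters of the unit interval; there \<open>s\<close> precedes
  \<open>a\<close>, which the first event forbids. The existence of \<open>s\<close> is where degree
  at least 3 enters.\<close>

lemma prob_block_ge:
  fixes S T :: "'a set"
  assumes S: "S \<subseteq> V" "S \<noteq> {}" and T: "T \<subseteq> V" and ab: "a \<in> V" "b \<in> V" "a \<noteq> b"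
    and disj: "a \<notin> S" "a \<notin> T" "b \<notin> S" "b \<notin> T" "S \<inter> T = {}"
  shows "prob {X \<in> space M. (\<forall>u\<in>T. X b < X u) \<and>
      ((\<forall>u\<in>S. X a < X u) \<or> X a < X b \<and> (\<exists>w\<in>S. \<forall>u\<in>S - {w}. X a < X u))}
    \<ge> 1 / (real (card S + 1) * real (card T + 1)) + (1 / 4) ^ (card S + card T + 2)"
proof -
  have fin: "finite S" "finite T" using S T finite_subset[OF _ finite_V] by auto
  obtain s where s: "s \<in> S" using S by auto
  let ?E1 = "{X \<in> space M. (\<forall>u\<in>T. X b < X u) \<and> (\<forall>u\<in>S. X a < X u)}"
  define lo :: "'a \<Rightarrow> real" where "lo i = (if i = s then 0 else if i = a then 1/4 else if i = b then 1/2 else 3/4)" for i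
  let ?J = "insert a (insert b (S \<union> T))"
  let ?E2 = "{X \<in> space M. \<forall>i\<in>?J. lo i \<le> X i \<and> X i < lo i + 1/4}"
  let ?E = "{X \<in> space M. (\<forall>u\<in>T. X b < X u) \<and>
      ((\<forall>u\<in>S. X a < X u) \<or> X a < X b \<and> (\<exists>w\<in>S. \<forall>u\<in>S - {w}. X a < X u))}"
  have JV: "?J \<subseteq> V" using S T ab by auto
  have "prob ?E1 = prob {X \<in> space M. \<forall>u\<in>T. X b < X u} * prob {X \<in> space M. \<forall>u\<in>S. X a < X u}"
    using S T ab disj
    by (intro prob_conj[where J = "insert b T" and K = "insert a S"] pred_min) (auto simp: depends_def)
  also have "\<dots> \<ge> 1 / (card T + 1) * (1 / (card S + 1))"
    using S T ab disj by (intro mult_mono prob_min_ge) auto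
  finally have E1: "prob ?E1 \<ge> 1 / (real (card S + 1) * real (card T + 1))" by (simp add: mult.commute)
  have "prob ?E2 = (\<Prod>i\<in>?J. (lo i + 1/4) - lo i)"
    using JV by (intro prob_box) (auto simp: lo_def)
  also have "\<dots> = (1/4) ^ card ?J" by simp
  also have "card ?J = card S + card T + 2" using fin ab disj by (simp add: card_Un_disjoint)
  finally have E2: "prob ?E2 = (1/4) ^ (card S + card T + 2)" .
  have ne: "s \<noteq> a" "s \<noteq> b" "s \<notin> T" using s disj by auto
  have m1: "?E1 \<in> events"
    using pred_min[OF ab(2) T] pred_min[OF ab(1) S(1)] unfolding pred_def by (intro sets.sets_Collect) auto
  have m2: "?E2 \<in> events" using pred_box[OF JV] unfolding pred_def by simp
  have "Measurable.pred M (\<lambda>X. \<exists>w\<in>S. \<forall>u\<in>S - {w}. X a < X u)"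
    using S ab fin by (intro pred_intros_finite pred_min) auto
  then have m: "?E \<in> events"
    using pred_min[OF ab(2) T] pred_min[OF ab(1) S(1)] pred_less[OF ab(1,2)] unfolding pred_def
    by (intro sets.sets_Collect) auto
  have "X a < X b \<and> (\<forall>u\<in>T. X b < X u) \<and> X s < X a \<and> (\<forall>u\<in>S - {s}. X a < X u)" if "X \<in> ?E2" for X
  proof -
    have *: "lo i \<le> X i" "X i < lo i + 1/4" if "i \<in> ?J" for i using \<open>X \<in> ?E2\<close> that by auto
    have small: "X a < 1/2" "X a \<ge> 1/4" "X b < 3/4" "X b \<ge> 1/2" "X s < 1/4"
      using *[of a] *[of b] *[of s] ne ab s by (auto simp: lo_def)
    have big: "X u \<ge> 3/4" if "u \<in> S \<union> T" "u \<noteq> s" for u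
      using *[of u] that disj by (auto simp: lo_def split: if_splits)
    have "X a < X u" "X b < X u" if "u \<in> S \<union> T" "u \<noteq> s" for u
      using big[OF that] small by linarith+
    then show ?thesis using ne(3) small by auto
  qed
  note E2D = this
  have sub: "?E2 \<subseteq> ?E"
  proof
    fix X assume X: "X \<in> ?E2"
    have "\<exists>w\<in>S. \<forall>u\<in>S - {w}. X a < X u" using E2D[OF X] s by blast
    then show "X \<in> ?E" using E2D[OF X] X by simp
  qed
  have dis: "?E1 \<inter> ?E2 = {}"
  proof (rule equals0I)
    fix X assume X: "X \<in> ?E1 \<inter> ?E2"
    then have "X a < X s" using s by simp
    moreover have "X s < X a" using E2D[of X] X by blast
    ultimately show False by simp
  qed
  have "prob ?E1 + prob ?E2 = prob (?E1 \<union> ?E2)" using m1 m2 dis by (rule finite_measure_Union[symmetric])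
  also have "\<dots> \<le> prob ?E" using sub m by (intro finite_measure_mono) auto
  finally show ?thesis using E1 E2 by simp
qed

end

text \<open>Concerns the path v, a, b, c. The relaxed rule for \<open>a\<close> compares it with the
  next vertex \<open>b\<close>, hence two vertices at a time. The ages of \<open>v\<close> and
  \<open>c\<close> are not consulted, so in a tree a block is independent of survival from
  \<open>c\<close> on.\<close>

definition block :: "('a \<times> 'a) set \<Rightarrow> 'a \<Rightarrow> 'a \<Rightarrow> 'a \<Rightarrow> 'a \<Rightarrow> ('a \<Rightarrow> real) \<Rightarrow> bool" where
  "block E v a b c X \<longleftrightarrow> (\<forall>u\<in>E `` {b} - {a, c}. X b < X u) \<and>
     ((\<forall>u\<in>E `` {a} - {v, b}. X a < X u) \<or>
      X a < X b \<and> (\<exists>w\<in>E `` {a} - {v, b}. \<forall>u\<in>E `` {a} - {v, b} - {w}. X a < X u))"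

primrec surv :: "('a \<times> 'a) set \<Rightarrow> nat \<Rightarrow> 'a \<Rightarrow> 'a \<Rightarrow> ('a \<Rightarrow> real) \<Rightarrow> bool" where
  "surv E 0 v a X \<longleftrightarrow> True"
| "surv E (Suc m) v a X \<longleftrightarrow>
     (\<exists>b\<in>E `` {a} - {v}. \<exists>c\<in>E `` {b} - {a}. block E v a b c X \<and> surv E m b c X)"

text \<open>The threshold \<eta> puts \<open>v\<close> before all its neighbours without comparing
  two ages, which keeps the conditions on \<open>v\<close> and on the separate branches
  independent.\<close>

definition gain :: "('a \<times> 'a) set \<Rightarrow> nat \<Rightarrow> real \<Rightarrow> 'a \<Rightarrow> ('a \<Rightarrow> real) \<Rightarrow> bool" where
  "gain E m \<eta> v X \<longleftrightarrow> X v < \<eta> \<and> (\<forall>u\<in>E `` {v}. \<eta> \<le> X u \<and> surv E m v u X)"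

lemma branch_ball_self: "a \<in> branch_ball E k v a"
  by (cases k) auto

lemma depends_block: "depends (insert a (insert b (E `` {a} - {v, b} \<union> (E `` {b} - {a, c})))) (block E v a b c)"
  unfolding depends_def block_def
proof (intro allI impI)
  fix X Y :: "'a \<Rightarrow> real"
  assume *: "\<forall>i\<in>insert a (insert b (E `` {a} - {v, b} \<union> (E `` {b} - {a, c}))). X i = Y i"
  have "X a = Y a" "X b = Y b" "\<And>u. u \<in> E `` {a} - {v, b} \<Longrightarrow> X u = Y u" "\<And>u. u \<in> E `` {b} - {a, c} \<Longrightarrow> X u = Y u"
    using * by blast+
  moreover define S T where "S = E `` {a} - {v, b}" and "T = E `` {b} - {a, c}"
  ultimately have "X a = Y a" "X b = Y b" "\<And>u. u \<in> S \<Longrightarrow> X u = Y u" "\<And>u. u \<in> T \<Longrightarrow> X u = Y u"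
    by blast+
  moreover from this have "(\<forall>u\<in>S - {w}. Y a < X u) \<longleftrightarrow> (\<forall>u\<in>S - {w}. Y a < Y u)" for w
    by (intro ball_cong) auto
  ultimately show "((\<forall>u\<in>E `` {b} - {a, c}. X b < X u) \<and>
     ((\<forall>u\<in>E `` {a} - {v, b}. X a < X u) \<or>
      X a < X b \<and> (\<exists>w\<in>E `` {a} - {v, b}. \<forall>u\<in>E `` {a} - {v, b} - {w}. X a < X u))) =
    ((\<forall>u\<in>E `` {b} - {a, c}. Y b < Y u) \<and>
     ((\<forall>u\<in>E `` {a} - {v, b}. Y a < Y u) \<or>
      Y a < Y b \<and> (\<exists>w\<in>E `` {a} - {v, b}. \<forall>u\<in>E `` {a} - {v, b} - {w}. Y a < Y u)))"
    unfolding S_def[symmetric] T_def[symmetric] by (simp cong: ball_cong bex_cong)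
qed

lemma depends_surv: "depends (branch_ball E (2 * m) v a) (surv E m v a)"
proof (induction m arbitrary: v a)
  case 0
  then show ?case by (simp add: depends_def)
next
  case (Suc m)
  let ?J = "branch_ball E (2 * Suc m) v a"
  have Jeq: "?J = insert a (\<Union>b\<in>E `` {a} - {v}. insert b (\<Union>c\<in>E `` {b} - {a}. branch_ball E (2 * m) b c))"
    by simp
  show ?case
    unfolding depends_def
  proof (intro allI impI)
    fix X Y :: "'a \<Rightarrow> real" assume XY: "\<forall>i\<in>?J. X i = Y i"
    have "block E v a b c X = block E v a b c Y \<and> surv E m b c X = surv E m b c Y"
      if bc: "b \<in> E `` {a} - {v}" "c \<in> E `` {b} - {a}" for b c
    proof
      have "insert a (insert b (E `` {a} - {v, b} \<union> (E `` {b} - {a, c}))) \<subseteq> ?J"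
        unfolding Jeq using bc branch_ball_self[of _ E "2 * m"] by blast
      then show "block E v a b c X = block E v a b c Y"
        using XY by (intro dependsD[OF depends_block]) blast
      have "branch_ball E (2 * m) b c \<subseteq> ?J" unfolding Jeq using bc by blast
      then show "surv E m b c X = surv E m b c Y"
        using XY by (intro dependsD[OF Suc.IH]) blast
    qed
    then show "surv E (Suc m) v a X = surv E (Suc m) v a Y"
      unfolding surv.simps by blast
  qed
qed

lemma depends_gain: "irrefl E \<Longrightarrow> depends (branch_ball E (Suc (2 * m)) v v) (gain E m \<eta> v)"
  unfolding depends_def
proof (intro allI impI)
  fix X Y :: "'a \<Rightarrow> real" assume "irrefl E" and XY: "\<forall>i\<in>branch_ball E (Suc (2 * m)) v v. X i = Y i"
  then have N: "E `` {v} - {v} = E `` {v}" by (auto simp: irrefl_def)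
  have "X v = Y v" using XY by simp
  moreover have "X u = Y u \<and> surv E m v u X = surv E m v u Y" if u: "u \<in> E `` {v}" for u
  proof -
    have "branch_ball E (2 * m) v u \<subseteq> branch_ball E (Suc (2 * m)) v v" using u N by auto
    then have "\<forall>i\<in>branch_ball E (2 * m) v u. X i = Y i" using XY by blast
    then show ?thesis using branch_ball_self[of u E "2 * m" v] by (metis dependsD[OF depends_surv])
  qed
  ultimately show "gain E m \<eta> v X = gain E m \<eta> v Y" unfolding gain_def by (metis (no_types, lifting))
qed

text \<open>A lower bound for the second term in \<open>prob_block_ge\<close>, whose exponent is the
  sum of the degrees of \<open>a\<close> and \<open>b\<close> minus 2.\<close>

definition block_gain :: "nat \<Rightarrow> real" where
  "block_gain d = (1 / 4) ^ (2 * d)"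

text \<open>The fixed point of Q \<mapsto> Q / (1 + g) + d ^ 4 with g = \<open>block_gain d\<close>,
  the recursion of \<open>prob_surv_Suc\<close>.\<close>

definition surv_const :: "nat \<Rightarrow> real" where
  "surv_const d = real d ^ 4 * (1 + block_gain d) / block_gain d"

lemma block_gain_pos: "block_gain d > 0"
  by (simp add: block_gain_def)

lemma surv_const_ge_1:
  assumes "d \<ge> 3"
  shows "surv_const d \<ge> 1"
proof -
  have "1 \<le> real d ^ 4 * (1 + block_gain d)"
    using mult_mono[OF one_le_power[of "real d" 4], of 1 "1 + block_gain d"] assms block_gain_pos[of d] by simp
  moreover have "block_gain d \<le> 1" unfolding block_gain_def by (rule power_le_one) auto
  ultimately show ?thesis using block_gain_pos[of d] by (simp add: surv_const_def field_simps)
qed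

section \<open>Survival probabilities in a fixed graph with independent ages\<close>

locale aged_graph = ages V for V :: "'a set" +
  fixes E :: "('a \<times> 'a) set" and d :: nat
  assumes E_sub: "E \<subseteq> V \<times> V" and sym_E: "sym E" and irrefl_E: "irrefl E"
    and degree: "\<And>i. i \<in> V \<Longrightarrow> 3 \<le> card (E `` {i}) \<and> card (E `` {i}) \<le> d"
begin

lemma nbr_sub: "E `` {i} \<subseteq> V"
  using E_sub by auto

lemma nbr_fin: "finite (E `` {i})"
  using nbr_sub finite_V by (rule finite_subset)

lemma E_commute: "(x, y) \<in> E \<longleftrightarrow> (y, x) \<in> E"
  using sym_E by (auto dest: symD)

lemma E_irrefl: "(x, x) \<notin> E"
  using irrefl_E by (auto simp: irrefl_def)

lemma pred_block:
  assumes "(v, a) \<in> E" "b \<in> E `` {a}"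
  shows "Measurable.pred M (block E v a b c)"
proof -
  have V: "a \<in> V" "b \<in> V" using assms E_sub by auto
  have 1: "Measurable.pred M (\<lambda>X. \<forall>u\<in>E `` {b} - {a, c}. X b < X u)"
    using V nbr_sub by (intro pred_min) blast+
  have 2: "Measurable.pred M (\<lambda>X. \<forall>u\<in>E `` {a} - {v, b}. X a < X u)"
    using V nbr_sub by (intro pred_min) blast+
  have "Measurable.pred M (\<lambda>X. \<exists>w\<in>E `` {a} - {v, b}. \<forall>u\<in>E `` {a} - {v, b} - {w}. X a < X u)"
    using V nbr_sub nbr_fin[of a] by (intro pred_intros_finite pred_min) auto
  with 1 2 pred_less[OF V] show ?thesis unfolding block_def by (intro pred_intros_logic)
qed

lemma pred_surv: "(v, a) \<in> E \<Longrightarrow> Measurable.pred M (surv E m v a)"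
proof (induction m arbitrary: v a)
  case (Suc m)
  show ?case
    unfolding surv.simps
    using Suc.prems nbr_fin by (intro pred_intros_finite pred_intros_logic pred_block Suc.IH) auto
next
  case 0
  have "surv E 0 v a = (\<lambda>X. True)" by (rule ext) simp
  then show ?case by simp
qed

lemma branch_ball_V: "a \<in> V \<Longrightarrow> branch_ball E k v a \<subseteq> V"
  using branch_ball_subset_nball nball_subset[OF E_sub] by (metis subset_trans)

text \<open>The additive gain becomes a factor on the probability that non-backtracking walk, having
  reached \<open>a\<close>, continues to \<open>b\<close> and then to \<open>c\<close>; since that
  probability is at most 1, the additive gain covers the factor.\<close>

lemma prob_block_ge':
  assumes va: "(v, a) \<in> E" and tree: "treelike E (Suc (Suc k)) v a"
    and b: "b \<in> E `` {a} - {v}" and c: "c \<in> E `` {b} - {a}"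
  shows "prob {X \<in> space M. block E v a b c X}
    \<ge> 1 / ((real (card (E `` {a})) - 1) * (real (card (E `` {b})) - 1)) * (1 + block_gain d)"
proof -
  let ?S = "E `` {a} - {v, b}" and ?T = "E `` {b} - {a, c}"
  have V: "a \<in> V" "b \<in> V" using va b E_sub by auto
  have nb: "v \<in> E `` {a}" "b \<in> E `` {a}" "a \<in> E `` {b}" "c \<in> E `` {b}" "v \<noteq> b" "a \<noteq> c" "a \<noteq> b"
    using va b c E_commute E_irrefl by auto
  have "card ?S = card (E `` {a}) - 2" using nb nbr_fin by (subst card_Diff_subset) auto
  then have cS: "card ?S + 2 = card (E `` {a})" using degree[OF V(1)] by linarith
  have "card ?T = card (E `` {b}) - 2" using nb nbr_fin by (subst card_Diff_subset) auto
  then have cT: "card ?T + 2 = card (E `` {b})" using degree[OF V(2)] by linarith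
  have sib: "branch_ball E (Suc k) a b \<inter> branch_ball E (Suc k) a u = {}" if "u \<in> E `` {a} - {v}" "u \<noteq> b" for u
    using tree b that by (auto simp del: branch_ball.simps)
  have T: "?T \<subseteq> branch_ball E (Suc k) a b" using branch_ball_self by fastforce
  have "u \<notin> ?T" if "u \<in> ?S" for u
    using sib[of u] T branch_ball_self[of u E "Suc k" a] that by blast
  then have "?S \<inter> ?T = {}" by blast
  moreover have "?S \<noteq> {}" using cS degree[OF V(1)] by (metis add_0 card.empty Suc_le_lessD numeral_3_eq_3 numeral_2_eq_2 less_irrefl)
  ultimately have "1 / (real (card ?S + 1) * real (card ?T + 1)) + (1 / 4) ^ (card ?S + card ?T + 2)
     \<le> prob {X \<in> space M. (\<forall>u\<in>?T. X b < X u) \<and>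
      ((\<forall>u\<in>?S. X a < X u) \<or> X a < X b \<and> (\<exists>w\<in>?S. \<forall>u\<in>?S - {w}. X a < X u))}"
    using V nb nbr_sub[of a] nbr_sub[of b] E_irrefl by (intro prob_block_ge) auto
  then have *: "1 / (real (card ?S + 1) * real (card ?T + 1)) + (1 / 4) ^ (card ?S + card ?T + 2)
     \<le> prob {X \<in> space M. block E v a b c X}" by (simp add: block_def)
  have "card ?S + card ?T + 2 \<le> 2 * d" using cS cT degree[OF V(1)] degree[OF V(2)] by linarith
  then have "block_gain d \<le> (1 / 4) ^ (card ?S + card ?T + 2)"
    unfolding block_gain_def by (intro power_decreasing) auto
  moreover have "1 / (real (card ?S + 1) * real (card ?T + 1)) * block_gain d \<le> 1 * block_gain d"
  proof (rule mult_right_mono)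
    have "1 * 1 \<le> real (card ?S + 1) * real (card ?T + 1)" by (intro mult_mono) auto
    then show "1 / (real (card ?S + 1) * real (card ?T + 1)) \<le> 1"
      by (simp add: divide_le_eq_1 del: of_nat_add)
  qed (use block_gain_pos[of d] in simp)
  moreover have "real (card (E `` {a})) - 1 = real (card ?S + 1)" "real (card (E `` {b})) - 1 = real (card ?T + 1)"
    using cS cT by linarith+
  ultimately show ?thesis using * by (simp only: distrib_left mult_1_right mult_1_left)
qed

text \<open>Second moment over the pairs (b, c) with weights \<mu> / (p q), where \<mu> is the law
  of two steps of non-backtracking walk, so that the first moment is 1 for any degrees. A diagonal
  term is \<mu> (\<mu> / p) (1 / q) \<le> \<mu> Q / (1 + g), and these sum to at most Q / (1 + g).
  Off the diagonal each term is at most 1, and there are at most d ^ 4 of them.\<close>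

lemma prob_surv_Suc:
  assumes va: "(v, a) \<in> E" and tree: "treelike E (2 * Suc m) v a" and "Q > 0"
    and IH: "\<And>b c. b \<in> E `` {a} - {v} \<Longrightarrow> c \<in> E `` {b} - {a} \<Longrightarrow> 1 / Q \<le> prob {X \<in> space M. surv E m b c X}"
  shows "1 / (Q / (1 + block_gain d) + real d ^ 4) \<le> prob {X \<in> space M. surv E (Suc m) v a X}"
proof -
  let ?D = "\<lambda>i. real (card (E `` {i})) - 1"
  define I where "I = (SIGMA b:E `` {a} - {v}. E `` {b} - {a})"
  define \<mu> where "\<mu> = (\<lambda>(b, c :: 'a). 1 / (?D a * ?D b))"
  define p where "p = (\<lambda>(b, c). prob {X \<in> space M. block E v a b c X})"
  define q where "q = (\<lambda>(b, c). prob {X \<in> space M. surv E m b c X})"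
  define A where "A = (\<lambda>(b, c). {X \<in> space M. block E v a b c X \<and> surv E m b c X})"
  have tree2: "treelike E (Suc (Suc (2 * m))) v a" using tree by simp
  have aV: "a \<in> V" using va E_sub by auto
  have finI: "finite I" unfolding I_def using nbr_fin by auto
  have D2: "?D i \<ge> 2" "?D i \<le> d" if "i \<in> V" for i using degree[OF that] by linarith+
  have bc: "b \<in> E `` {a} - {v}" "c \<in> E `` {b} - {a}" "b \<in> V" "c \<in> V" "(b, c) \<in> E" if "(b, c) \<in> I" for b c
    using that E_sub by (auto simp: I_def)
  have cardD: "real (card (E `` {i} - {j})) = ?D i" if "j \<in> E `` {i}" for i j
  proof -
    have "card (E `` {i}) = Suc (card (E `` {i} - {j}))" by (rule card.remove[OF nbr_fin that])
    then show ?thesis by simp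
  qed
  have va': "v \<in> E `` {a}" using va E_commute by auto
  have sum\<mu>: "(\<Sum>i\<in>I. \<mu> i) = 1"
  proof -
    have "(\<Sum>i\<in>I. \<mu> i) = (\<Sum>b\<in>E `` {a} - {v}. \<Sum>c\<in>E `` {b} - {a}. 1 / (?D a * ?D b))"
      unfolding I_def \<mu>_def using nbr_fin by (subst sum.Sigma[symmetric]) auto
    also have "\<dots> = (\<Sum>b\<in>E `` {a} - {v}. 1 / ?D a)"
    proof (rule sum.cong)
      fix b assume b: "b \<in> E `` {a} - {v}"
      then have "a \<in> E `` {b}" "b \<in> V" using E_commute E_sub by auto
      then show "(\<Sum>c\<in>E `` {b} - {a}. 1 / (?D a * ?D b)) = 1 / ?D a"
        using cardD[of a b] D2[of b] by simp
    qed simp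
    also have "\<dots> = 1" using cardD[OF va'] D2[OF aV] by simp
    finally show ?thesis .
  qed
  have \<mu>pos: "\<mu> i > 0" if "i \<in> I" for i
    using that D2(1)[OF aV] D2(1)[OF bc(3)] by (cases i) (force simp: \<mu>_def)
  have p\<mu>: "p i \<ge> \<mu> i * (1 + block_gain d)" if "i \<in> I" for i
    using prob_block_ge'[OF va tree2] bc that by (cases i) (auto simp: p_def \<mu>_def)
  have ppos: "p i > 0" if "i \<in> I" for i
    using p\<mu>[OF that] \<mu>pos[OF that] block_gain_pos[of d] by (smt (verit) mult_pos_pos)
  have qQ: "q i \<ge> 1 / Q" if "i \<in> I" for i
    using IH bc that by (cases i) (auto simp: q_def)
  have qpos: "q i > 0" if "i \<in> I" for i
    using qQ[OF that] \<open>Q > 0\<close> by (smt (verit) divide_pos_pos)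
  have meas: "Measurable.pred M (block E v a b c)" "Measurable.pred M (surv E m b c)" if "(b, c) \<in> I" for b c
    using that va by (auto intro!: pred_block pred_surv simp: I_def)
  have ev: "A i \<in> events" if "i \<in> I" for i
    using meas that pred_intros_logic(3) unfolding A_def pred_def by (cases i) (auto intro!: sets.sets_Collect)
  have balls: "branch_ball E (2 * m) b c \<subseteq> branch_ball E (Suc (2 * m)) a b" if "(b, c) \<in> I" for b c
    using bc[OF that] by auto
  have tb: "treelike E (Suc (2 * m)) a b" "a \<notin> branch_ball E (Suc (2 * m)) a b" if "b \<in> E `` {a} - {v}" for b
    using tree2 that by (auto simp del: branch_ball.simps)
  have sib: "branch_ball E (Suc (2 * m)) a b \<inter> branch_ball E (Suc (2 * m)) a b' = {}"
    if "b \<in> E `` {a} - {v}" "b' \<in> E `` {a} - {v}" "b \<noteq> b'" for b b'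
    using tree2 that by (auto simp del: branch_ball.simps)
  have sib2: "branch_ball E (2 * m) b c \<inter> branch_ball E (2 * m) b c' = {}"
    if "b \<in> E `` {a} - {v}" "c \<in> E `` {b} - {a}" "c' \<in> E `` {b} - {a}" "c \<noteq> c'" for b c c'
    using tb(1)[OF that(1)] that by (auto simp del: branch_ball.simps)
  \<comment> \<open>The block reads no age in the branch of \<open>c\<close>, because the siblings
    of \<open>b\<close> and of \<open>c\<close> start branches disjoint from it.\<close>
  have PA: "prob (A i) = p i * q i" if i: "i \<in> I" for i
  proof -
    obtain b c where i': "i = (b, c)" by (cases i)
    let ?J = "insert a (insert b (E `` {a} - {v, b} \<union> (E `` {b} - {a, c})))"
    let ?K = "branch_ball E (2 * m) b c"
    note bc' = bc[OF i[unfolded i']]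
    have "a \<notin> ?K" using tb(2)[OF bc'(1)] balls[OF i[unfolded i']] by blast
    moreover have "b \<notin> ?K" using tb(1)[OF bc'(1)] bc' by auto
    moreover have "(E `` {a} - {v, b}) \<inter> ?K = {}"
    proof -
      have "u \<notin> branch_ball E (Suc (2 * m)) a b" if "u \<in> E `` {a} - {v, b}" for u
        using sib[OF bc'(1), of u] that branch_ball_self[of u E "Suc (2 * m)" a] by blast
      then show ?thesis using balls[OF i[unfolded i']] by blast
    qed
    moreover have "(E `` {b} - {a, c}) \<inter> ?K = {}"
    proof -
      have "u \<notin> ?K" if "u \<in> E `` {b} - {a, c}" for u
        using sib2[OF bc'(1,2), of u] that branch_ball_self[of u E "2 * m" b] by blast
      then show ?thesis by blast
    qed
    ultimately have "?J \<inter> ?K = {}" by blast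
    moreover have "?J \<subseteq> V" using aV bc'(3) nbr_sub by blast
    moreover have "?K \<subseteq> V" using branch_ball_V bc'(4) by blast
    ultimately show ?thesis
      unfolding i' A_def p_def q_def prod.case using meas[OF i[unfolded i']]
      by (intro prob_conj[OF _ _ _ depends_block depends_surv])
  qed
  \<comment> \<open>Different blocks share \<open>a\<close> and are dependent, so they are dropped;
    the survival events live in disjoint branches. The weights tolerate this because \<mu> \<le>
    p.\<close>
  have PAA: "prob (A i \<inter> A j) \<le> q i * q j" if ij: "i \<in> I" "j \<in> I" "i \<noteq> j" for i j
  proof -
    obtain b c where i': "i = (b, c)" by (cases i)
    obtain b' c' where j': "j = (b', c')" by (cases j)
    note i = ij(1)[unfolded i'] and j = ij(2)[unfolded j']
    have "prob (A i \<inter> A j) \<le> prob {X \<in> space M. surv E m b c X \<and> surv E m b' c' X}"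
    proof (rule finite_measure_mono)
      show "{X \<in> space M. surv E m b c X \<and> surv E m b' c' X} \<in> events"
        using meas(2)[OF i] meas(2)[OF j] unfolding pred_def by (intro sets.sets_Collect)
    qed (auto simp: A_def i' j')
    also have "\<dots> = q i * q j"
    proof -
      have "branch_ball E (2 * m) b c \<inter> branch_ball E (2 * m) b' c' = {}"
      proof (cases "b = b'")
        case True
        then have "c \<noteq> c'" using ij i' j' by simp
        then show ?thesis using sib2[OF bc(1,2)[OF i], of c'] bc(2)[OF j] True by simp
      next
        case False
        then show ?thesis using sib[OF bc(1)[OF i] bc(1)[OF j]] balls[OF i] balls[OF j] by blast
      qed
      then show ?thesis unfolding i' j' q_def prod.case
        using meas(2)[OF i] meas(2)[OF j] branch_ball_V bc(4)[OF i] bc(4)[OF j]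
        by (intro prob_conj[OF _ _ _ depends_surv depends_surv])
    qed
    finally show ?thesis .
  qed
  define w where "w i = \<mu> i / (p i * q i)" for i
  have wpos: "w i \<ge> 0" if "i \<in> I" for i
    using \<mu>pos[OF that] ppos[OF that] qpos[OF that] by (simp add: w_def)
  have wq: "w i * q i \<le> 1" if "i \<in> I" for i
  proof -
    have "\<mu> i \<le> \<mu> i * (1 + block_gain d)" using \<mu>pos[OF that] block_gain_pos[of d] by simp
    then have "\<mu> i \<le> p i" using p\<mu>[OF that] by linarith
    then show ?thesis using ppos[OF that] qpos[OF that] by (simp add: w_def)
  qed
  have diag: "w i * w i * prob (A i) \<le> \<mu> i * (Q / (1 + block_gain d))" if "i \<in> I" for i
  proof -
    have "w i * w i * prob (A i) = \<mu> i * (\<mu> i / p i) * (1 / q i)"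
      using ppos[OF that] qpos[OF that] by (simp add: w_def PA[OF that])
    also have "\<dots> \<le> \<mu> i * (1 / (1 + block_gain d)) * Q"
    proof (intro mult_mono mult_left_mono)
      show "\<mu> i / p i \<le> 1 / (1 + block_gain d)"
        using p\<mu>[OF that] ppos[OF that] block_gain_pos[of d] by (simp add: divide_simps)
      show "1 / q i \<le> Q" using qQ[OF that] qpos[OF that] \<open>Q > 0\<close> by (simp add: field_simps)
    qed (use \<mu>pos[OF that] ppos[OF that] qpos[OF that] block_gain_pos[of d] in auto)
    finally show ?thesis by simp
  qed
  have off: "w i * w j * prob (A i \<inter> A j) \<le> 1" if "i \<in> I" "j \<in> I" "i \<noteq> j" for i j
  proof -
    have "w i * w j * prob (A i \<inter> A j) \<le> w i * w j * (q i * q j)"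
      using PAA[OF that] wpos that by (intro mult_left_mono) auto
    also have "\<dots> = (w i * q i) * (w j * q j)" by simp
    also have "\<dots> \<le> 1 * 1" using wq wpos qpos that by (intro mult_mono) (auto simp: less_imp_le)
    finally show ?thesis by simp
  qed
  have cardI: "real (card I) \<le> d ^ 2"
  proof -
    have "card I = (\<Sum>b\<in>E `` {a} - {v}. card (E `` {b} - {a}))"
      unfolding I_def using nbr_fin by (intro card_SigmaI) auto
    also have "\<dots> \<le> (\<Sum>b\<in>E `` {a} - {v}. d)"
    proof (rule sum_mono)
      fix b assume "b \<in> E `` {a} - {v}"
      then have "b \<in> V" using nbr_sub by auto
      then show "card (E `` {b} - {a}) \<le> d" using degree card_Diff1_le[of "E `` {b}" a] by (meson le_trans)
    qed
    also have "\<dots> \<le> d * d" using degree[OF aV] card_Diff1_le[of "E `` {a}" v] by (simp add: le_trans)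
    finally show ?thesis by (simp add: power2_eq_square flip: of_nat_mult)
  qed
  have "(\<Sum>i\<in>I. w i * prob (A i)) = (\<Sum>i\<in>I. \<mu> i)"
  proof (rule sum.cong)
    fix i assume "i \<in> I"
    then show "w i * prob (A i) = \<mu> i" using ppos[of i] qpos[of i] by (simp add: w_def PA)
  qed simp
  then have one: "(\<Sum>i\<in>I. w i * prob (A i)) = 1" using sum\<mu> by simp
  have "(\<Sum>i\<in>I. \<Sum>j\<in>I. w i * w j * prob (A i \<inter> A j)) \<le> (\<Sum>i\<in>I. \<mu> i * (Q / (1 + block_gain d)) + card I)"
  proof (rule sum_mono)
    fix i assume i: "i \<in> I"
    have "(\<Sum>j\<in>I. w i * w j * prob (A i \<inter> A j))
        = w i * w i * prob (A i) + (\<Sum>j\<in>I - {i}. w i * w j * prob (A i \<inter> A j))"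
      using sum.remove[OF finI i, of "\<lambda>j. w i * w j * prob (A i \<inter> A j)"] by simp
    also have "\<dots> \<le> \<mu> i * (Q / (1 + block_gain d)) + (\<Sum>j\<in>I - {i}. 1)"
      using diag[OF i] off[OF i] by (intro add_mono sum_mono) auto
    also have "\<dots> \<le> \<mu> i * (Q / (1 + block_gain d)) + card I" using card_Diff1_le[of I i] by simp
    finally show "(\<Sum>j\<in>I. w i * w j * prob (A i \<inter> A j)) \<le> \<mu> i * (Q / (1 + block_gain d)) + card I" .
  qed
  also have "\<dots> = Q / (1 + block_gain d) + real (card I) * real (card I)"
    using sum\<mu> by (simp add: sum.distrib sum_distrib_right[symmetric] del: times_divide_eq_right)
  also have "\<dots> \<le> Q / (1 + block_gain d) + real d ^ 4"
    using mult_mono[OF cardI cardI] by (simp add: power_add[symmetric])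
  finally have two: "(\<Sum>i\<in>I. \<Sum>j\<in>I. w i * w j * prob (A i \<inter> A j)) \<le> Q / (1 + block_gain d) + real d ^ 4" .
  have "Q / (1 + block_gain d) + real d ^ 4 > 0" using \<open>Q > 0\<close> block_gain_pos[of d] by (intro add_pos_nonneg) auto
  then have "1 / (Q / (1 + block_gain d) + real d ^ 4) \<le> prob (\<Union>i\<in>I. A i)"
    using weighted_second_moment[OF finI ev one two] by simp
  also have "(\<Union>i\<in>I. A i) = {X \<in> space M. surv E (Suc m) v a X}"
    by (auto simp: A_def I_def)
  finally show ?thesis .
qed

lemma d_ge_3: "d \<ge> 3"
  using V_ne degree le_trans by blast

lemma prob_surv: "(v, a) \<in> E \<Longrightarrow> treelike E (2 * m) v a \<Longrightarrow> 1 / surv_const d \<le> prob {X \<in> space M. surv E m v a X}"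
proof (induction m arbitrary: v a)
  case 0
  then show ?case using surv_const_ge_1[OF d_ge_3] by (simp add: prob_space)
next
  case (Suc m)
  have "surv_const d / (1 + block_gain d) = real d ^ 4 / block_gain d" using block_gain_pos[of d] by (simp add: surv_const_def)
  moreover have "real d ^ 4 / block_gain d + real d ^ 4 = surv_const d" using block_gain_pos[of d] by (simp add: surv_const_def field_simps)
  ultimately have "surv_const d / (1 + block_gain d) + real d ^ 4 = surv_const d" by simp
  moreover have "1 / (surv_const d / (1 + block_gain d) + real d ^ 4) \<le> prob {X \<in> space M. surv E (Suc m) v a X}"
  proof (rule prob_surv_Suc[OF Suc.prems])
    show "surv_const d > 0" using surv_const_ge_1[OF d_ge_3] by simp
    fix b c assume bc: "b \<in> E `` {a} - {v}" "c \<in> E `` {b} - {a}"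
    have "treelike E (Suc (2 * m)) a b" using Suc.prems(2) bc(1) by simp
    then have "treelike E (2 * m) b c" using bc(2) by simp
    then show "1 / surv_const d \<le> prob {X \<in> space M. surv E m b c X}" using bc by (intro Suc.IH) auto
  qed
  ultimately show ?case by simp
qed

lemma pred_gain:
  assumes "v \<in> V"
  shows "Measurable.pred M (gain E m \<eta> v)"
proof -
  have [measurable]: "v \<in> V" by fact
  have 1: "Measurable.pred M (\<lambda>X. X v < \<eta>)" by measurable
  have 2: "Measurable.pred M (\<lambda>X. \<eta> \<le> X u)" if "u \<in> E `` {v}" for u
  proof -
    have [measurable]: "u \<in> V" using that nbr_sub by auto
    show ?thesis by measurable
  qed
  show ?thesis
    unfolding gain_def
    using 1 2 nbr_fin by (intro pred_intros_logic pred_intros_finite pred_surv) auto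
qed

text \<open>Write \<eta> = 1 / (2 C) with C = \<open>surv_const d\<close>. A neighbour survives with
  probability at least 2 \<eta> and has age below \<eta> with probability \<eta>, so both conditions
  on it hold with probability at least \<eta>. The at most \<open>d\<close> branches and the age of
  \<open>v\<close> then contribute \<eta> ^ d and \<eta>.\<close>

lemma prob_gain_ge:
  assumes v: "v \<in> V" and tree: "treelike E (Suc (2 * m)) v v"
  shows "prob {X \<in> space M. gain E m (1 / (2 * surv_const d)) v X} \<ge> (1 / (2 * surv_const d)) ^ Suc d"
proof -
  let ?\<eta> = "1 / (2 * surv_const d)" and ?N = "E `` {v}"
  have \<eta>: "0 < ?\<eta>" "?\<eta> \<le> 1" using surv_const_ge_1[OF d_ge_3] by auto
  have Nv: "?N - {v} = ?N" using E_irrefl by auto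
  define P where "P u X \<longleftrightarrow> ?\<eta> \<le> X u \<and> surv E m v u X" for u X
  have [measurable]: "v \<in> V" by fact
  have uV: "u \<in> V" if "u \<in> ?N" for u using that nbr_sub by auto
  have predP: "Measurable.pred M (P u)" if u: "u \<in> ?N" for u
  proof -
    have [measurable]: "u \<in> V" using u uV by auto
    have [measurable]: "Measurable.pred M (surv E m v u)" using u by (intro pred_surv) auto
    show ?thesis unfolding P_def by measurable
  qed
  have tb: "treelike E (2 * m) v u" "v \<notin> branch_ball E (2 * m) v u" if "u \<in> ?N" for u
    using tree that Nv by auto
  have sib: "branch_ball E (2 * m) v u \<inter> branch_ball E (2 * m) v u' = {}" if "u \<in> ?N" "u' \<in> ?N" "u \<noteq> u'" for u u'
    using tree that Nv by auto
  have P_ge: "prob {X \<in> space M. P u X} \<ge> ?\<eta>" if u: "u \<in> ?N" for u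
  proof -
    have [measurable]: "u \<in> V" using u uV by auto
    have s: "Measurable.pred M (surv E m v u)" using u by (intro pred_surv) auto
    let ?A = "{X \<in> space M. surv E m v u X}" and ?B = "{X \<in> space M. ?\<eta> \<le> X u \<and> X u < 1}"
    have ev: "?A \<in> events" "?B \<in> events" using s unfolding pred_def by (simp, measurable)
    have "1 / surv_const d \<le> prob ?A" using u tb by (intro prob_surv) auto
    moreover have "prob ?B = 1 - ?\<eta>" using \<eta> uV[OF u] by (intro prob_Ico) auto
    moreover have "1 / surv_const d = ?\<eta> + ?\<eta>" by (simp add: field_simps)
    ultimately have "?\<eta> \<le> prob ?A + prob ?B - 1" by linarith
    also have "\<dots> \<le> prob (?A \<inter> ?B)" by (rule prob_ge_by_complement[OF ev])
    also have "\<dots> \<le> prob {X \<in> space M. P u X}"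
      using predP[OF u] unfolding pred_def by (intro finite_measure_mono) (auto simp: P_def)
    finally show ?thesis .
  qed
  have depP: "depends (branch_ball E (2 * m) v u) (P u)" for u
    unfolding depends_def P_def
  proof (intro allI impI)
    fix X Y :: "'a \<Rightarrow> real" assume *: "\<forall>i\<in>branch_ball E (2 * m) v u. X i = Y i"
    then have "X u = Y u" using branch_ball_self[of u E "2 * m" v] by blast
    moreover have "surv E m v u X = surv E m v u Y" using * by (intro dependsD[OF depends_surv]) blast
    ultimately show "(?\<eta> \<le> X u \<and> surv E m v u X) = (?\<eta> \<le> Y u \<and> surv E m v u Y)" by simp
  qed
  have allP: "prob {X \<in> space M. \<forall>u\<in>?N. P u X} = (\<Prod>u\<in>?N. prob {X \<in> space M. P u X})"
  proof (rule prob_all[OF nbr_fin])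
    show "disjoint_family_on (branch_ball E (2 * m) v) ?N"
      unfolding disjoint_family_on_def using sib by blast
  qed (use depP predP uV branch_ball_V in auto)
  have "(\<Prod>u\<in>?N. ?\<eta>) \<le> (\<Prod>u\<in>?N. prob {X \<in> space M. P u X})"
    using P_ge \<eta> by (intro prod_mono) auto
  then have "?\<eta> ^ card ?N \<le> prob {X \<in> space M. \<forall>u\<in>?N. P u X}" using allP by simp
  moreover have "?\<eta> ^ d \<le> ?\<eta> ^ card ?N" using degree[OF v] \<eta> by (intro power_decreasing) auto
  ultimately have 1: "?\<eta> ^ d \<le> prob {X \<in> space M. \<forall>u\<in>?N. P u X}" by linarith
  have "?\<eta> = prob {X \<in> space M. 0 \<le> X v \<and> X v < ?\<eta>}" using \<eta> v by (subst prob_Ico) auto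
  also have "\<dots> \<le> prob {X \<in> space M. X v < ?\<eta>}" by (intro finite_measure_mono) (auto, measurable)
  finally have 2: "?\<eta> \<le> prob {X \<in> space M. X v < ?\<eta>}" .
  have 3: "Measurable.pred M (\<lambda>X. X v < ?\<eta>)" by measurable
  have 4: "Measurable.pred M (\<lambda>X. \<forall>u\<in>?N. P u X)" using predP nbr_fin by (intro pred_intros_finite)
  have "prob {X \<in> space M. X v < ?\<eta> \<and> (\<forall>u\<in>?N. P u X)}
      = prob {X \<in> space M. X v < ?\<eta>} * prob {X \<in> space M. \<forall>u\<in>?N. P u X}"
  proof (rule prob_conj[where J = "{v}" and K = "\<Union>u\<in>?N. branch_ball E (2 * m) v u"])
    show "depends (\<Union>u\<in>?N. branch_ball E (2 * m) v u) (\<lambda>X. \<forall>u\<in>?N. P u X)"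
      unfolding depends_def using dependsD[OF depP] by (metis UN_I)
    show "(\<Union>u\<in>?N. branch_ball E (2 * m) v u) \<subseteq> V" using uV branch_ball_V by blast
  qed (use tb v 3 4 in \<open>auto simp: depends_def\<close>)
  also have "\<dots> \<ge> ?\<eta> * ?\<eta> ^ d" using 1 2 \<eta> by (intro mult_mono) auto
  finally show ?thesis by (simp add: gain_def P_def)
qed

end

text \<open>
  Hoeffding's inequality is applied to each colour class, on which the events are independent;
  classes with less than half of the average size are given up.
\<close>

lemma (in ages) prob_many_events:
  fixes P :: "'b \<Rightarrow> ('a \<Rightarrow> real) \<Rightarrow> bool" and c :: "'b \<Rightarrow> nat" and \<epsilon> :: real
  assumes fin: "finite A" and "A \<noteq> {}"
    and D: "\<And>s. s \<in> A \<Longrightarrow> D s \<subseteq> V" and dep: "\<And>s. s \<in> A \<Longrightarrow> depends (D s) (P s)"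
    and P: "\<And>s. s \<in> A \<Longrightarrow> Measurable.pred M (P s)"
    and \<epsilon>: "0 < \<epsilon>" "\<And>s. s \<in> A \<Longrightarrow> \<epsilon> \<le> prob {X \<in> space M. P s X}"
    and c: "\<And>s. s \<in> A \<Longrightarrow> c s < K"
      "\<And>s s'. s \<in> A \<Longrightarrow> s' \<in> A \<Longrightarrow> s \<noteq> s' \<Longrightarrow> c s = c s' \<Longrightarrow> D s \<inter> D s' = {}"
  shows "prob {X \<in> space M. real (card {s \<in> A. P s X}) < \<epsilon> / 4 * card A}
     \<le> K * exp (- \<epsilon>\<^sup>2 * card A / (4 * K))"
proof -
  define C where "C k = {s \<in> A. c s = k}" for k
  define big where "big = {k \<in> {..<K}. real (card A) / (2 * K) \<le> card (C k)}"
  define bad where "bad k = {X \<in> space M. (\<Sum>s\<in>C k. of_bool (P s X)) \<le> \<epsilon> / 2 * real (card (C k))}" for k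
  have finC: "finite (C k)" for k using fin by (simp add: C_def)
  have K: "K > 0" using \<open>A \<noteq> {}\<close> c(1) by fastforce
  have Apos: "card A > 0" using assms by (simp add: card_gt_0_iff)
  have cnt: "(\<Sum>s\<in>B. of_bool (P s X)) = real (card {s \<in> B. P s X})" if "finite B" for B X
    using that by (simp add: of_bool_def sum.If_cases Int_def)
  have meas: "(\<lambda>X. of_bool (P s X) :: real) \<in> borel_measurable M" if "s \<in> A" for s
    using P[OF that] by (rule measurable_compose) auto
  have bad_ev: "bad k \<in> events" for k
  proof -
    have "(\<lambda>X. \<Sum>s\<in>C k. of_bool (P s X) :: real) \<in> borel_measurable M"
      using meas by (intro borel_measurable_sum) (auto simp: C_def)
    then show ?thesis unfolding bad_def by measurable
  qed
  have bad_le: "prob (bad k) \<le> exp (- \<epsilon>\<^sup>2 * card A / (4 * K))" if k: "k \<in> big" for k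
  proof -
    let ?m = "real (card (C k))"
    have mge: "?m \<ge> card A / (2 * K)" using k by (simp add: big_def)
    moreover have "real (card A) / (2 * K) > 0" using Apos K by simp
    ultimately have m: "?m > 0" by linarith
    have ind: "indep_vars (\<lambda>_. count_space UNIV) P (C k)"
    proof (rule indep_depends)
      show "disjoint_family_on D (C k)" using c(2) by (auto simp: disjoint_family_on_def C_def)
    qed (use D dep P in \<open>auto simp: C_def\<close>)
    have ind': "indep_vars (\<lambda>_. borel) (\<lambda>s X. of_bool (P s X) :: real) (C k)"
      by (rule indep_vars_compose2[OF ind]) auto
    interpret H: Hoeffding_ineq M "C k" "\<lambda>s X. of_bool (P s X) :: real" "\<lambda>_. 0" "\<lambda>_. 1"
      "\<Sum>s\<in>C k. expectation (\<lambda>X. of_bool (P s X) :: real)"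
      using finC ind' by unfold_locales auto
    have E: "expectation (\<lambda>X. of_bool (P s X) :: real) = prob {X \<in> space M. P s X}" if "s \<in> A" for s
    proof -
      have "expectation (\<lambda>X. of_bool (P s X) :: real) = expectation (indicator {X \<in> space M. P s X})"
        by (intro Bochner_Integration.integral_cong) (auto simp: indicator_def)
      then show ?thesis by (simp add: Int_absorb2)
    qed
    define \<mu> where "\<mu> = (\<Sum>s\<in>C k. expectation (\<lambda>X. of_bool (P s X) :: real))"
    have \<mu>: "\<mu> \<ge> \<epsilon> * ?m"
    proof -
      have "(\<Sum>s\<in>C k. \<epsilon>) \<le> \<mu>" unfolding \<mu>_def using E \<epsilon> by (intro sum_mono) (auto simp: C_def)
      then show ?thesis by (simp add: mult.commute)
    qed
    define t where "t = \<mu> - \<epsilon> / 2 * ?m"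
    have t: "t \<ge> \<epsilon> / 2 * ?m" using \<mu> by (simp add: t_def)
    have t0: "t \<ge> 0" using t \<epsilon>(1) by (smt (verit) divide_nonneg_nonneg mult_nonneg_nonneg of_nat_0_le_iff)
    have "prob (bad k) = prob {X \<in> space M. (\<Sum>s\<in>C k. of_bool (P s X)) \<le> \<mu> - t}"
      by (simp add: bad_def t_def)
    also have "\<dots> \<le> exp (- 2 * t\<^sup>2 / (\<Sum>s\<in>C k. (1 - 0)\<^sup>2))"
      unfolding \<mu>_def using t0 m by (intro H.Hoeffding_ineq_le) auto
    also have "\<dots> \<le> exp (- \<epsilon>\<^sup>2 * card A / (4 * K))"
    proof -
      have "\<epsilon>\<^sup>2 * (card A / (4 * K)) \<le> \<epsilon>\<^sup>2 * (?m / 2)" using mge K by (intro mult_left_mono) (auto simp: field_simps)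
      also have "\<dots> = 2 * (\<epsilon> / 2 * ?m)\<^sup>2 / ?m" using m by (simp add: power2_eq_square)
      also have "\<dots> \<le> 2 * t\<^sup>2 / ?m"
        using t m \<epsilon>(1) by (intro divide_right_mono mult_left_mono power_mono) auto
      finally show ?thesis by simp
    qed
    finally show ?thesis .
  qed
  have sub: "{X \<in> space M. real (card {s \<in> A. P s X}) < \<epsilon> / 4 * card A} \<subseteq> (\<Union>k\<in>big. bad k)"
  proof (rule ccontr)
    assume "\<not> ?thesis"
    then obtain X where X: "X \<in> space M" "real (card {s \<in> A. P s X}) < \<epsilon> / 4 * card A" "X \<notin> (\<Union>k\<in>big. bad k)"
      by auto
    have dec: "(\<Sum>s\<in>A. f s) = (\<Sum>k<K. \<Sum>s\<in>C k. f s)" for f :: "'b \<Rightarrow> real"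
      unfolding C_def using fin c(1) by (intro sum.group[symmetric]) auto
    \<comment> \<open>Large classes satisfy this by avoiding \<open>bad k\<close>, small ones
      because the left side is not positive. Summed over the \<open>K\<close> classes, it leaves
      \<epsilon> / 2 times half of \<open>card A\<close>.\<close>
    have "\<epsilon> / 2 * card (C k) - \<epsilon> / 2 * (card A / (2 * K)) \<le> (\<Sum>s\<in>C k. of_bool (P s X))" if "k < K" for k
    proof (cases "k \<in> big")
      case True
      then have "\<epsilon> / 2 * card (C k) \<le> (\<Sum>s\<in>C k. of_bool (P s X))" using X by (force simp: bad_def)
      moreover have "\<epsilon> / 2 * (card A / (2 * K)) \<ge> 0" using \<epsilon>(1) by simp
      ultimately show ?thesis by linarith
    next
      case False
      then have "real (card (C k)) \<le> card A / (2 * K)" using that by (simp add: big_def)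
      then have "\<epsilon> / 2 * card (C k) \<le> \<epsilon> / 2 * (card A / (2 * K))" using \<epsilon>(1) by (intro mult_left_mono) auto
      moreover have "(\<Sum>s\<in>C k. of_bool (P s X)) \<ge> (0::real)" by (intro sum_nonneg) auto
      ultimately show ?thesis by linarith
    qed
    then have "(\<Sum>k<K. \<epsilon> / 2 * card (C k) - \<epsilon> / 2 * (card A / (2 * K))) \<le> (\<Sum>k<K. \<Sum>s\<in>C k. of_bool (P s X))"
      by (intro sum_mono) auto
    also have "\<dots> = real (card {s \<in> A. P s X})" using dec cnt[OF fin] by metis
    also have "(\<Sum>k<K. \<epsilon> / 2 * card (C k) - \<epsilon> / 2 * (card A / (2 * K)))
        = \<epsilon> / 2 * (\<Sum>k<K. real (card (C k))) - K * (\<epsilon> / 2 * (card A / (2 * K)))"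
      by (simp add: sum_subtractf sum_distrib_left)
    also have "(\<Sum>k<K. real (card (C k))) = card A" using dec[of "\<lambda>_. 1"] by simp
    also have "\<epsilon> / 2 * card A - K * (\<epsilon> / 2 * (card A / (2 * K))) = \<epsilon> / 4 * card A"
      using K by (simp add: field_simps)
    finally show False using X by simp
  qed
  have "prob {X \<in> space M. real (card {s \<in> A. P s X}) < \<epsilon> / 4 * card A} \<le> prob (\<Union>k\<in>big. bad k)"
    using sub bad_ev by (intro finite_measure_mono) (auto simp: big_def)
  also have "\<dots> \<le> (\<Sum>k\<in>big. prob (bad k))"
    using bad_ev by (intro finite_measure_subadditive_finite) (auto simp: big_def)
  also have "\<dots> \<le> (\<Sum>k\<in>big. exp (- \<epsilon>\<^sup>2 * card A / (4 * K)))" by (intro sum_mono bad_le)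
  also have "\<dots> \<le> K * exp (- \<epsilon>\<^sup>2 * card A / (4 * K))"
  proof -
    have "card big \<le> card {..<K}" unfolding big_def by (intro card_mono) auto
    then show ?thesis by (simp add: mult_right_mono)
  qed
  finally show ?thesis by simp
qed

section \<open>The third layer\<close>

definition low_rank :: "'a set \<Rightarrow> ('a \<times> 'a) set \<Rightarrow> ('a \<Rightarrow> real) \<Rightarrow> 'a set" where
  "low_rank V E X = {v \<in> V. card {u \<in> E `` {v}. X u < X v} \<le> 2}"

lemma low_rankI:
  assumes "v \<in> V" "{u \<in> E `` {v}. X u < X v} \<subseteq> {x, y}"
  shows "v \<in> low_rank V E X"
proof -
  have "card {u \<in> E `` {v}. X u < X v} \<le> card {x, y}" using assms by (intro card_mono) auto
  also have "\<dots> \<le> 2" by (simp add: card_insert_if)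
  finally show ?thesis using assms by (simp add: low_rank_def)
qed

text \<open>At most two neighbours can be earlier: \<open>a\<close> and \<open>c\<close> for
  \<open>b\<close>; for \<open>a\<close> either \<open>v\<close> and \<open>b\<close> or, when
  \<open>b\<close> is later, \<open>v\<close> and the exempted \<open>w\<close>.\<close>

lemma block_low_rank:
  assumes "block E v a b c X" "a \<in> V" "b \<in> V"
  shows "a \<in> low_rank V E X" "b \<in> low_rank V E X"
proof -
  have b: "\<And>u. u \<in> E `` {b} - {a, c} \<Longrightarrow> X b < X u"
    and a: "(\<forall>u\<in>E `` {a} - {v, b}. X a < X u) \<or>
      X a < X b \<and> (\<exists>w\<in>E `` {a} - {v, b}. \<forall>u\<in>E `` {a} - {v, b} - {w}. X a < X u)"
    using assms(1) unfolding block_def by blast+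
  show "b \<in> low_rank V E X"
    using b assms(3) by (intro low_rankI[of _ _ _ _ a c]) (auto dest: order.asym)
  from a show "a \<in> low_rank V E X"
  proof
    assume "\<forall>u\<in>E `` {a} - {v, b}. X a < X u"
    then show ?thesis using assms(2) by (intro low_rankI[of _ _ _ _ v b]) (auto dest: order.asym)
  next
    assume "X a < X b \<and> (\<exists>w\<in>E `` {a} - {v, b}. \<forall>u\<in>E `` {a} - {v, b} - {w}. X a < X u)"
    then obtain w where w: "X a < X b" "\<And>u. u \<in> E `` {a} - {v, b} - {w} \<Longrightarrow> X a < X u" by blast
    have "u \<in> {v, w}" if "u \<in> E `` {a}" "X u < X a" for u
      using w(1) w(2)[of u] that by (cases "u = b") auto
    then show ?thesis using assms(2) by (intro low_rankI[of _ _ _ _ v w]) auto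
  qed
qed

text \<open>\<open>Suc m\<close> blocks carry 2 m + 2 vertices, as many as a walk of length 2 m + 1
  has from \<open>a\<close> on.\<close>

lemma surv_nb_walk:
  assumes "E \<subseteq> V \<times> V" "a \<in> V" "surv E (Suc m) v a X"
  shows "nb_walk E (low_rank V E X) (2 * m + 1) v a"
  using assms(2,3)
proof (induction m arbitrary: v a)
  case 0
  then obtain b c where bc: "b \<in> E `` {a} - {v}" "block E v a b c X" by auto
  moreover have "b \<in> V" using bc assms(1) by auto
  ultimately show ?case using block_low_rank[OF bc(2) 0(1)] by auto
next
  case (Suc m)
  from Suc.prems(2) obtain b c where bc: "b \<in> E `` {a} - {v}" "c \<in> E `` {b} - {a}" "block E v a b c X"
    "surv E (Suc m) b c X" unfolding surv.simps(2)[of E "Suc m"] by blast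
  have "b \<in> V" "c \<in> V" using bc assms(1) by auto
  then have "nb_walk E (low_rank V E X) (2 * m + 1) b c" using Suc.IH bc(4) by blast
  then have "nb_walk E (low_rank V E X) (Suc (Suc (2 * m + 1))) v a"
    using bc block_low_rank[OF bc(3) Suc.prems(1) \<open>b \<in> V\<close>] by auto
  then show ?case by simp
qed

lemma gain_branches:
  assumes "E \<subseteq> V \<times> V" "v \<in> V" "gain E (Suc m) \<eta> v X"
  shows "v \<in> low_rank V E X" "branches E (low_rank V E X) (2 * m + 1) v = E `` {v}"
proof -
  have v: "X v < \<eta>" and u: "\<And>u. u \<in> E `` {v} \<Longrightarrow> \<eta> \<le> X u \<and> surv E (Suc m) v u X"
    using assms(3) unfolding gain_def by blast+
  have "\<not> X u < X v" if "u \<in> E `` {v}" for u using u[OF that] v by linarith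
  then show "v \<in> low_rank V E X" using assms(2) by (intro low_rankI[of _ _ _ _ v v]) blast+
  have "nb_walk E (low_rank V E X) (2 * m + 1) v u" if "u \<in> E `` {v}" for u
    using u[OF that] that assms(1) by (intro surv_nb_walk[OF assms(1)]) auto
  then show "branches E (low_rank V E X) (2 * m + 1) v = E `` {v}"
    unfolding branches_def by blast
qed

text \<open>The dense subgraph has at least g n / 2 more arcs than twice its vertices, hence g n / 4
  edges closing cycles over a spanning forest. Since \<open>few\<close> rules this out when all
  classes are small, some class of the forest exceeds \<alpha> n, and the forest lies in
  \<open>T\<close>.\<close>

lemma ex_large_class:
  fixes E :: "('a :: linorder \<times> 'a) set" and g \<alpha> :: real
  assumes V: "finite V" and E: "E \<subseteq> V \<times> V" "sym E" "irrefl E" and "M \<ge> 1" "1 / M \<le> g / 2"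
    and many: "g * card V \<le> card {v \<in> V \<inter> T. card (branches E T M v) \<ge> 3}"
    and few: "\<not> many_closing V (g / 4) \<alpha> E" and "\<alpha> * card V \<ge> 1"
  shows "\<exists>x\<in>T. \<alpha> * card V \<le> card ((E \<inter> T \<times> T)\<^sup>* `` {x})"
proof -
  have finE: "finite E" using V E(1) finite_subset by blast
  obtain H where H: "H \<subseteq> E" "sym H" "Field H \<subseteq> T"
    and dense: "real (card H) - 2 * real (card (Field H))
      \<ge> real (card {v \<in> V \<inter> T. card (branches E T M v) \<ge> 3}) - real (card V) / real M"
    using ex_dense_subgraph[OF V E(1,2) \<open>M \<ge> 1\<close>] by blast
  have finH: "finite H" using H finE finite_subset by blast
  have irrH: "irrefl H" using H(1) E(3) by (auto simp: irrefl_def)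
  obtain F where F: "F \<subseteq> H" "card F \<le> card (Field H)" "H \<subseteq> connects F"
    using spanning_forest[OF H(2) finH] by blast
  have FE: "F \<subseteq> E" using F H by blast
  have "Field H \<subseteq> V" using H(1) E(1) by (auto simp: Field_def)
  then have "card (Field H) \<le> card V" using V by (intro card_mono)
  then have cF: "card F \<le> card V" using F by simp
  have "card H \<le> 2 * (card F + card (closing E F))"
    by (rule card_le_forest_closing[OF H(2) irrH H(1) finE FE F(3)])
  also have "\<dots> \<le> 2 * (card (Field H) + card (closing E F))" using F(2) by simp
  finally have "real (card H) \<le> real (2 * (card (Field H) + card (closing E F)))" by (rule of_nat_mono)
  then have "real (card H) \<le> 2 * real (card (Field H)) + 2 * real (card (closing E F))" by simp
  moreover have "real (card V) / real M \<le> g / 2 * card V"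
    using mult_right_mono[OF \<open>1 / M \<le> g / 2\<close>, of "real (card V)"] by simp
  ultimately have "g / 4 * card V \<le> card (closing E F)" using dense many by linarith
  then obtain x where x: "x \<in> V" "real (card (connects F `` {x})) > \<alpha> * card V"
    using few FE cF unfolding many_closing_def by (meson not_le)
  let ?A = "E \<inter> T \<times> T"
  have "sym ?A" using E(2) by (auto simp: sym_def)
  moreover have "H \<subseteq> T \<times> T" using H(3) by (meson FieldI1 FieldI2 SigmaI subrelI subsetD)
  then have "F \<subseteq> ?A" using F(1) H(1) by blast
  ultimately have "F \<union> F\<inverse> \<subseteq> ?A" by (auto simp: sym_def)
  then have "connects F \<subseteq> ?A\<^sup>*" by (rule rtrancl_mono)
  then have sub: "connects F `` {x} \<subseteq> ?A\<^sup>* `` {x}" by blast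
  have "?A\<^sup>* `` {x} \<subseteq> insert x V" using E(1) by (auto elim: rtranclE)
  then have fin: "finite (?A\<^sup>* `` {x})" using V finite_subset by blast
  have c: "card (connects F `` {x}) \<le> card (?A\<^sup>* `` {x})" using sub fin by (rule card_mono[rotated])
  \<comment> \<open>Outside \<open>T\<close> the class would be a singleton, but it has more than
    \<alpha> n \<ge> 1 elements.\<close>
  have "x \<in> T"
  proof (rule ccontr)
    assume "x \<notin> T"
    then have "?A\<^sup>* `` {x} \<subseteq> {x}" by (auto elim: converse_rtranclE)
    then have "card (?A\<^sup>* `` {x}) \<le> card {x}" by (intro card_mono) auto
    then show False using c x assms(9) by simp
  qed
  then show ?thesis using c x by (intro bexI[of _ x]) auto
qed

text \<open>The class of \<open>x\<close> induces a connected subgraph. It is maximal because a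
  connected subgraph containing it only has vertices reachable from \<open>x\<close>.\<close>

lemma ex_component:
  assumes A: "A \<subseteq> T \<times> T" "sym A" and x: "x \<in> T"
  shows "\<exists>C. is_component (with_proj \<lparr>pverts = T, parcs = A\<rparr>) C \<and> verts C = A\<^sup>* `` {x}"
proof -
  let ?H = "with_proj \<lparr>pverts = T, parcs = A\<rparr>"
  define S where "S = A\<^sup>* `` {x}"
  let ?C = "with_proj \<lparr>pverts = S, parcs = A \<inter> S \<times> S\<rparr>"
  have ST: "S \<subseteq> T" using A(1) x by (auto simp: S_def elim: rtranclE)
  have wf: "wf_digraph ?H" "wf_digraph ?C" using A(1) by (auto simp: wf_digraph_def)
  have "subgraph ?C ?H" using wf ST by (auto simp: subgraph_def compatible_def)
  moreover have "Digraph_Component.connected ?C"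
  proof -
    let ?B = "(A \<inter> S \<times> S)\<^sup>s"
    have xu: "(x, u) \<in> rtrancl_on S ?B" if "u \<in> S" for u
    proof -
      have "(x, u) \<in> A\<^sup>*" using that by (simp add: S_def)
      then show ?thesis
      proof (induction rule: rtrancl_induct)
        case base
        then show ?case by (auto simp: S_def)
      next
        case (step y z)
        have "y \<in> S" "z \<in> S" using step by (auto simp: S_def)
        then show ?case using step by (intro rtrancl_on_into_rtrancl_on[OF step.IH]) (auto simp: symcl_def)
      qed
    qed
    have "sym (rtrancl_on S ?B)" by (intro rtrancl_on_sym) (auto simp: symcl_def sym_def)
    then have "(u, v) \<in> rtrancl_on S ?B" if "u \<in> S" "v \<in> S" for u v
      using xu[OF that(1)] xu[OF that(2)] by (meson rtrancl_on_trans symD)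
    moreover have "S \<noteq> {}" by (auto simp: S_def)
    ultimately show ?thesis unfolding connected_conv by auto
  qed
  moreover have "H' = ?C"
    if H': "subgraph ?C H'" "subgraph H' ?H" "Digraph_Component.connected H'" for H'
  proof -
    have th: "tail H' = fst" "head H' = snd" and arcs: "A \<inter> S \<times> S \<subseteq> arcs H'" "arcs H' \<subseteq> A"
      and verts: "S \<subseteq> verts H'" and wfH': "wf_digraph H'"
      using H' by (auto simp: subgraph_def compatible_def)
    have "v \<in> S" if "v \<in> verts H'" for v
    proof -
      have "x \<in> verts H'" using verts by (auto simp: S_def)
      then have "(x, v) \<in> rtrancl_on (verts H') ((arcs_ends H')\<^sup>s)"
        using H'(3) that unfolding connected_conv by blast
      then have "(x, v) \<in> ((arcs_ends H')\<^sup>s)\<^sup>*" by (rule rtrancl_on_rtranclI)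
      moreover have "(arcs_ends H')\<^sup>s \<subseteq> A"
        using arcs(2) A(2) by (auto simp: symcl_def arcs_ends_conv th sym_def)
      ultimately have "(x, v) \<in> A\<^sup>*" by (meson rtrancl_mono subsetD)
      then show ?thesis by (simp add: S_def)
    qed
    then have v: "verts H' = S" using verts by auto
    have "arcs H' \<subseteq> A \<inter> S \<times> S"
    proof
      fix e assume e: "e \<in> arcs H'"
      then have "fst e \<in> S" "snd e \<in> S"
        using wf_digraph.tail_in_verts[OF wfH' e] wf_digraph.head_in_verts[OF wfH' e] v th by auto
      then show "e \<in> A \<inter> S \<times> S" using arcs e by (auto simp: mem_Times_iff)
    qed
    then show ?thesis using v th arcs by (intro pre_digraph.equality) auto
  qed
  ultimately have "is_component ?H ?C"
    unfolding is_component_def pre_digraph.max_subgraph_def by blast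
  then show ?thesis by (intro exI[of _ ?C]) (simp add: S_def)
qed

section \<open>From graph records to edge relations, and the final estimates\<close>

lemma layer_graph_eq:
  "layer_graph k G X = with_proj \<lparr>pverts = layer k G X, parcs = parcs G \<inter> layer k G X \<times> layer k G X\<rparr>"
  unfolding layer_graph_def by (intro pre_digraph.equality) auto

lemma pair_graph_iff:
  assumes "finite V"
  shows "pair_graph \<lparr>pverts = V, parcs = E\<rparr> \<longleftrightarrow> E \<subseteq> V \<times> V \<and> sym E \<and> irrefl E"
proof
  assume "pair_graph \<lparr>pverts = V, parcs = E\<rparr>"
  then interpret pair_graph "\<lparr>pverts = V, parcs = E\<rparr>" .
  have "(a, a) \<notin> E" for a using pair_no_loops[of "(a, a)"] by auto
  then show "E \<subseteq> V \<times> V \<and> sym E \<and> irrefl E"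
    using in_arcsD1 in_arcsD2 pair_sym_arcs by (auto simp: symmetric_def irrefl_def)
next
  assume E: "E \<subseteq> V \<times> V \<and> sym E \<and> irrefl E"
  then have "finite E" using assms finite_subset by blast
  with E assms show "pair_graph \<lparr>pverts = V, parcs = E\<rparr>"
    by unfold_locales (auto simp: symmetric_def irrefl_def)
qed

lemma graphs_with_degrees_eq:
  "graphs_with_degrees n deg = (\<lambda>E. \<lparr>pverts = {1..n}, parcs = E\<rparr>) ` deg_graphs {1..n} deg"
proof -
  have od: "out_degree (with_proj \<lparr>pverts = {1..n}, parcs = E\<rparr>) i = card (E `` {i})" for E and i :: nat
  proof -
    have "out_arcs (with_proj \<lparr>pverts = {1..n}, parcs = E\<rparr>) i = Pair i ` (E `` {i})"
      by (auto simp: out_arcs_def)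
    then show ?thesis by (simp add: out_degree_def card_image inj_on_def)
  qed
  have "G \<in> graphs_with_degrees n deg \<longleftrightarrow> (\<exists>E\<in>deg_graphs {1..n} deg. G = \<lparr>pverts = {1..n}, parcs = E\<rparr>)" for G
  proof (cases G)
    case (fields V E)
    then show ?thesis
      using pair_graph_iff[of "{1..n}" E] od[of E]
      by (auto simp: graphs_with_degrees_def deg_graphs_def)
  qed
  then show ?thesis by auto
qed

lemma layer_eq_low_rank:
  assumes "E \<subseteq> V \<times> V" "sym E"
  shows "layer 3 \<lparr>pverts = V, parcs = E\<rparr> X = low_rank V E X"
proof -
  have "{u \<in> V. (u, v) \<in> E \<and> X u < X v} = {u \<in> E `` {v}. X u < X v}" for v
    using assms by (auto dest: symD)
  then show ?thesis by (simp add: layer_def low_rank_def)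
qed

text \<open>Gains at vertices with disjoint balls are independent, so
  \<open>prob_many_events\<close> applies to the tree-like vertices coloured by overlap of balls.
  They number at least n / 2, which turns \<epsilon> / 4 into \<epsilon> / 8 and halves the
  exponent.\<close>

lemma (in aged_graph) prob_few_gains:
  assumes half: "real (card {v \<in> V. treelike E (Suc (2 * m)) v v}) \<ge> card V / 2"
  defines "\<epsilon> \<equiv> (1 / (2 * surv_const d)) ^ Suc d" and "K \<equiv> (d + 1) ^ (2 * Suc (2 * m)) + 1"
  shows "prob {X \<in> space M. real (card {v \<in> V. gain E m (1 / (2 * surv_const d)) v X}) < \<epsilon> / 8 * card V}
    \<le> K * exp (- (\<epsilon>\<^sup>2 / (8 * real K)) * card V)"
proof -
  let ?R = "Suc (2 * m)" and ?P = "gain E m (1 / (2 * surv_const d))"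
  define A where "A = {v \<in> V. treelike E ?R v v}"
  have AV: "A \<subseteq> V" and finA: "finite A" using finite_V by (auto simp: A_def)
  have \<epsilon>: "\<epsilon> > 0" unfolding \<epsilon>_def using surv_const_ge_1[OF d_ge_3] by (intro zero_less_power) simp
  have "card V > 0" using finite_V V_ne by (simp add: card_gt_0_iff)
  then have Ane: "A \<noteq> {}" using half unfolding A_def[symmetric] by auto
  have "\<exists>c :: 'a \<Rightarrow> nat. (\<forall>x\<in>A. c x < K) \<and>
     (\<forall>x\<in>A. \<forall>y\<in>A. x \<noteq> y \<longrightarrow> nball E ?R x \<inter> nball E ?R y \<noteq> {} \<longrightarrow> c x \<noteq> c y)"
  proof (rule greedy_coloring[OF finA])
    fix x assume "x \<in> A"
    then show "card {y \<in> A. nball E ?R x \<inter> nball E ?R y \<noteq> {} \<and> y \<noteq> x} < K"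
      unfolding K_def using AV degree by (intro nball_conflicts_le[OF finite_V E_sub sym_E]) auto
  qed (simp add: Int_commute)
  then obtain c :: "'a \<Rightarrow> nat" where c: "\<forall>x\<in>A. c x < K"
     "\<forall>x\<in>A. \<forall>y\<in>A. x \<noteq> y \<longrightarrow> nball E ?R x \<inter> nball E ?R y \<noteq> {} \<longrightarrow> c x \<noteq> c y"
    by (elim exE conjE)
  have "prob {X \<in> space M. real (card {s \<in> A. ?P s X}) < \<epsilon> / 4 * card A}
     \<le> K * exp (- \<epsilon>\<^sup>2 * card A / (4 * real K))"
  proof (rule prob_many_events[where D = "\<lambda>s. branch_ball E ?R s s" and c = c, OF finA Ane])
    fix s assume s: "s \<in> A"
    then have sV: "s \<in> V" using AV by auto
    show "branch_ball E ?R s s \<subseteq> V" by (rule branch_ball_V[OF sV])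
    show "depends (branch_ball E ?R s s) (?P s)" by (rule depends_gain[OF irrefl_E])
    show "Measurable.pred M (?P s)" by (rule pred_gain[OF sV])
    show "\<epsilon> \<le> prob {X \<in> space M. ?P s X}"
      unfolding \<epsilon>_def using s by (intro prob_gain_ge sV) (simp add: A_def)
    show "c s < K" using c(1) s by blast
    fix s' assume "s' \<in> A" "s \<noteq> s'" "c s = c s'"
    then have "nball E ?R s \<inter> nball E ?R s' = {}" using c(2) s by blast
    moreover have "branch_ball E ?R s s \<subseteq> nball E ?R s" "branch_ball E ?R s' s' \<subseteq> nball E ?R s'"
      by (rule branch_ball_subset_nball)+
    ultimately show "branch_ball E ?R s s \<inter> branch_ball E ?R s' s' = {}" by blast
  qed (rule \<epsilon>)
  also have "\<dots> \<le> K * exp (- (\<epsilon>\<^sup>2 / (8 * real K)) * card V)"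
  proof -
    have "\<epsilon>\<^sup>2 / (4 * real K) * (card V / 2) \<le> \<epsilon>\<^sup>2 / (4 * real K) * card A"
      using half by (intro mult_left_mono) (auto simp: A_def)
    then show ?thesis by (intro mult_left_mono) auto
  qed
  finally have *: "prob {X \<in> space M. real (card {s \<in> A. ?P s X}) < \<epsilon> / 4 * card A}
     \<le> K * exp (- (\<epsilon>\<^sup>2 / (8 * real K)) * card V)" .
  have "prob {X \<in> space M. real (card {v \<in> V. ?P v X}) < \<epsilon> / 8 * card V}
     \<le> prob {X \<in> space M. real (card {s \<in> A. ?P s X}) < \<epsilon> / 4 * card A}"
  proof (rule finite_measure_mono)
    show "{X \<in> space M. real (card {v \<in> V. ?P v X}) < \<epsilon> / 8 * card V}
       \<subseteq> {X \<in> space M. real (card {s \<in> A. ?P s X}) < \<epsilon> / 4 * card A}"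
    proof clarify
      fix X assume "real (card {v \<in> V. ?P v X}) < \<epsilon> / 8 * card V"
      moreover have "card {s \<in> A. ?P s X} \<le> card {v \<in> V. ?P v X}"
        using AV finite_V by (intro card_mono) auto
      moreover have "\<epsilon> / 4 * (card V / 2) \<le> \<epsilon> / 4 * card A"
        using half \<epsilon> by (intro mult_left_mono) (auto simp: A_def)
      ultimately show "real (card {s \<in> A. ?P s X}) < \<epsilon> / 4 * card A" by simp
    qed
    have "(\<lambda>X. \<Sum>s\<in>A. of_bool (?P s X) :: real) \<in> borel_measurable M"
      using AV by (intro borel_measurable_sum measurable_compose[OF pred_gain]) auto
    moreover have "(\<Sum>s\<in>A. of_bool (?P s X)) = real (card {s \<in> A. ?P s X})" for X
      using finA by (simp add: of_bool_def sum.If_cases Int_def)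
    ultimately have "(\<lambda>X. real (card {s \<in> A. ?P s X})) \<in> borel_measurable M" by simp
    then show "{X \<in> space M. real (card {s \<in> A. ?P s X}) < \<epsilon> / 4 * card A} \<in> events" by measurable
  qed
  then show ?thesis using * by linarith
qed

lemma measure_slices:
  assumes "finite \<G>" "\<G> \<noteq> {}" "prob_space M" and A: "\<And>G. G \<in> \<G> \<Longrightarrow> {X \<in> space M. P G X} \<in> sets M"
  shows "measure (uniform_count_measure \<G> \<Otimes>\<^sub>M M) {z \<in> space (uniform_count_measure \<G> \<Otimes>\<^sub>M M). P (fst z) (snd z)}
     = (\<Sum>G\<in>\<G>. measure M {X \<in> space M. P G X}) / card \<G>"
proof -
  let ?U = "uniform_count_measure \<G>"
  interpret M: prob_space M by fact
  interpret U: prob_space ?U using assms by (intro prob_space_uniform_count_measure)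
  interpret UM: pair_prob_space ?U M ..
  let ?S = "\<lambda>G. {G} \<times> {X \<in> space M. P G X}"
  have "{z \<in> space (?U \<Otimes>\<^sub>M M). P (fst z) (snd z)} = (\<Union>G\<in>\<G>. ?S G)"
    by (auto simp: space_pair_measure space_uniform_count_measure)
  moreover have ev: "?S G \<in> sets (?U \<Otimes>\<^sub>M M)" if "G \<in> \<G>" for G
    using that A by (intro pair_measureI) (auto simp: sets_uniform_count_measure)
  moreover have "measure (?U \<Otimes>\<^sub>M M) (\<Union>G\<in>\<G>. ?S G) = (\<Sum>G\<in>\<G>. measure (?U \<Otimes>\<^sub>M M) (?S G))"
    using ev assms(1) by (intro UM.P.finite_measure_finite_Union) (auto simp: disjoint_family_on_def)
  moreover have "measure (?U \<Otimes>\<^sub>M M) (?S G) = measure M {X \<in> space M. P G X} / card \<G>" if "G \<in> \<G>" for G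
  proof -
    have "emeasure (?U \<Otimes>\<^sub>M M) (?S G) = emeasure ?U {G} * emeasure M {X \<in> space M. P G X}"
      using that A by (intro M.emeasure_pair_measure_Times) (auto simp: sets_uniform_count_measure)
    then have "measure (?U \<Otimes>\<^sub>M M) (?S G) = measure ?U {G} * measure M {X \<in> space M. P G X}"
      by (simp add: measure_def enn2real_mult)
    then show ?thesis using that assms by (simp add: measure_uniform_count_measure)
  qed
  ultimately show ?thesis by (simp add: sum_divide_distrib)
qed

text \<open>\<open>low_rank\<close> takes only finitely many values, so any property of it is an
  event, even one that quantifies over components.\<close>

lemma (in ages) low_rank_measurable:
  assumes "E \<subseteq> V \<times> V"
  shows "{X \<in> space M. \<Phi> (low_rank V E X)} \<in> events"
proof -
  have card_pred: "Measurable.pred M (\<lambda>X. card {u \<in> E `` {v}. X u < X v} \<le> 2)" if v: "v \<in> V" for v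
  proof -
    have sub: "E `` {v} \<subseteq> V" using assms by auto
    then have fin: "finite (E `` {v})" using finite_V by (rule finite_subset)
    have "(\<lambda>X. \<Sum>u\<in>E `` {v}. of_bool (X u < X v) :: real) \<in> borel_measurable M"
      using v sub by (intro borel_measurable_sum measurable_compose[OF pred_less]) auto
    moreover have "(\<Sum>u\<in>E `` {v}. of_bool (X u < X v)) = real (card {u \<in> E `` {v}. X u < X v})" for X :: "'a \<Rightarrow> real"
      using fin by (simp add: of_bool_def sum.If_cases Int_def)
    ultimately have "(\<lambda>X. real (card {u \<in> E `` {v}. X u < X v})) \<in> borel_measurable M" by simp
    then have "Measurable.pred M (\<lambda>X. real (card {u \<in> E `` {v}. X u < X v}) \<le> 2)" by measurable
    then show ?thesis by simp
  qed
  have eq: "{X \<in> space M. low_rank V E X = S} \<in> events" if "S \<subseteq> V" for S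
  proof -
    have "Measurable.pred M (\<lambda>X. \<forall>v\<in>V. v \<in> S \<longleftrightarrow> card {u \<in> E `` {v}. X u < X v} \<le> 2)"
      using card_pred by (intro pred_intros_finite[OF finite_V] pred_intros_logic) auto
    moreover have "low_rank V E X = S \<longleftrightarrow> (\<forall>v\<in>V. v \<in> S \<longleftrightarrow> card {u \<in> E `` {v}. X u < X v} \<le> 2)" for X
      using that by (auto simp: low_rank_def)
    ultimately show ?thesis by (simp add: pred_def)
  qed
  have "{X \<in> space M. \<Phi> (low_rank V E X)} = (\<Union>S\<in>{S \<in> Pow V. \<Phi> S}. {X \<in> space M. low_rank V E X = S})"
    by (auto simp: low_rank_def)
  also have "\<dots> \<in> events" using finite_V eq by (intro sets.finite_UN) auto
  finally show ?thesis .
qed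

definition large_component ::
    "nat \<Rightarrow> real \<Rightarrow> nat pair_pre_digraph \<Rightarrow> (nat \<Rightarrow> real) \<Rightarrow> bool" where
  "large_component n \<alpha> G X \<longleftrightarrow>
     (\<exists>C. is_component (layer_graph 3 G X) C \<and> real (card (verts C)) \<ge> \<alpha> * real n)"

lemma layer_graph_low_rank:
  assumes "E \<in> deg_graphs V deg"
  shows "layer_graph 3 \<lparr>pverts = V, parcs = E\<rparr> X
    = with_proj \<lparr>pverts = low_rank V E X, parcs = E \<inter> low_rank V E X \<times> low_rank V E X\<rparr>"
proof -
  have "E \<subseteq> V \<times> V" "sym E" using assms by (auto simp: deg_graphs_def)
  then show ?thesis
    by (simp only: layer_graph_eq layer_eq_low_rank pair_pre_digraph.select_convs)
qed

lemma large_component_measurable: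
  assumes "n > 0" and E: "E \<in> deg_graphs {1..n} deg"
  shows "{X \<in> space (age_measure {1..n}). large_component n \<alpha> \<lparr>pverts = {1..n}, parcs = E\<rparr> X}
    \<in> sets (age_measure {1..n})"
proof -
  interpret ages "{1..n}" using assms(1) by unfold_locales auto
  have EV: "E \<subseteq> {1..n} \<times> {1..n}" using E by (auto simp: deg_graphs_def)
  show ?thesis
    unfolding large_component_def layer_graph_low_rank[OF E]
    by (rule low_rank_measurable[OF EV, of "\<lambda>T. \<exists>C. is_component (with_proj \<lparr>pverts = T, parcs = E \<inter> T \<times> T\<rparr>) C
      \<and> real (card (verts C)) \<ge> \<alpha> * real n"])
qed

text \<open>For a graph that is not exceptional, many gains force a large component; only the number
  of gains is random. The constants come from \<open>ex_large_class\<close> with g = \<epsilon> / 8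
  and walk length 2 m + 1: g / 2 = \<epsilon> / 16 and g / 4 = \<epsilon> / 32.\<close>

lemma prob_large_component:
  fixes deg :: "nat \<Rightarrow> nat" and \<alpha> \<epsilon> :: real and d m n K :: nat
  assumes n: "n > 0" and deg: "\<And>i. i \<in> {1..n} \<Longrightarrow> 3 \<le> deg i \<and> deg i \<le> d"
    and E: "E \<in> deg_graphs {1..n} deg"
  defines "\<epsilon> \<equiv> (1 / (2 * surv_const d)) ^ Suc d"
    and "K \<equiv> (d + 1) ^ (2 * Suc (2 * Suc m)) + 1"
  assumes half: "real (card {v \<in> {1..n}. treelike E (Suc (2 * Suc m)) v v}) \<ge> n / 2"
    and m: "1 / real (2 * m + 1) \<le> \<epsilon> / 16"
    and few: "\<not> many_closing {1..n} (\<epsilon> / 32) \<alpha> E" and \<alpha>: "\<alpha> * n \<ge> 1"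
  shows "measure (age_measure {1..n}) {X \<in> space (age_measure {1..n}). large_component n \<alpha> \<lparr>pverts = {1..n}, parcs = E\<rparr> X}
      \<ge> 1 - K * exp (- (\<epsilon>\<^sup>2 / (8 * real K)) * n)"
proof -
  let ?V = "{1..n}"
  have EV: "E \<subseteq> ?V \<times> ?V" "sym E" "irrefl E" using E by (auto simp: deg_graphs_def)
  interpret aged_graph ?V E d
    using n deg E by unfold_locales (auto simp: deg_graphs_def)
  let ?P = "gain E (Suc m) (1 / (2 * surv_const d))"
  let ?L = "large_component n \<alpha> \<lparr>pverts = ?V, parcs = E\<rparr>"
  have meas: "{X \<in> space M. ?L X} \<in> events" by (rule large_component_measurable[OF n E])
  have large: "?L X" if many: "\<not> real (card {v \<in> ?V. ?P v X}) < \<epsilon> / 8 * n" for X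
  proof -
    let ?T = "low_rank ?V E X"
    have "{v \<in> ?V. ?P v X} \<subseteq> {v \<in> ?V \<inter> ?T. card (branches E ?T (2 * m + 1) v) \<ge> 3}"
      using gain_branches[OF EV(1)] degree by force
    then have "card {v \<in> ?V. ?P v X} \<le> card {v \<in> ?V \<inter> ?T. card (branches E ?T (2 * m + 1) v) \<ge> 3}"
      by (intro card_mono) auto
    then have "\<epsilon> / 8 * card ?V \<le> card {v \<in> ?V \<inter> ?T. card (branches E ?T (2 * m + 1) v) \<ge> 3}"
      using many by simp
    then have "\<exists>x\<in>?T. \<alpha> * card ?V \<le> card ((E \<inter> ?T \<times> ?T)\<^sup>* `` {x})"
      using few \<alpha> m EV by (intro ex_large_class[where g = "\<epsilon> / 8" and M = "2 * m + 1"]) auto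
    then obtain x where x: "x \<in> ?T" "\<alpha> * n \<le> card ((E \<inter> ?T \<times> ?T)\<^sup>* `` {x})" by auto
    have "sym (E \<inter> ?T \<times> ?T)" using EV(2) by (auto simp: sym_def)
    then obtain C where "is_component (layer_graph 3 \<lparr>pverts = ?V, parcs = E\<rparr> X) C"
      "verts C = (E \<inter> ?T \<times> ?T)\<^sup>* `` {x}"
      unfolding layer_graph_low_rank[OF E] using ex_component[of "E \<inter> ?T \<times> ?T" ?T x] x by auto
    then show ?thesis using x(2) unfolding large_component_def by (intro exI[of _ C]) auto
  qed
  have "1 - prob {X \<in> space M. ?L X} = prob {X \<in> space M. \<not> ?L X}"
    using prob_neg[of ?L] meas by simp
  also have "\<dots> \<le> prob {X \<in> space M. real (card {v \<in> ?V. ?P v X}) < \<epsilon> / 8 * card ?V}"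
  proof (rule finite_measure_mono)
    have "(\<lambda>X. \<Sum>s\<in>?V. of_bool (?P s X) :: real) \<in> borel_measurable M"
      by (intro borel_measurable_sum measurable_compose[OF pred_gain]) auto
    moreover have "(\<Sum>s\<in>?V. of_bool (?P s X)) = real (card {s \<in> ?V. ?P s X})" for X
      by (simp add: of_bool_def sum.If_cases Int_def)
    ultimately have "(\<lambda>X. real (card {s \<in> ?V. ?P s X})) \<in> borel_measurable M" by simp
    then show "{X \<in> space M. real (card {v \<in> ?V. ?P v X}) < \<epsilon> / 8 * card ?V} \<in> events" by measurable
    show "{X \<in> space M. \<not> ?L X} \<subseteq> {X \<in> space M. real (card {v \<in> ?V. ?P v X}) < \<epsilon> / 8 * card ?V}"
      using large by auto
  qed
  also have "\<dots> \<le> K * exp (- (\<epsilon>\<^sup>2 / (8 * real K)) * card ?V)"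
    unfolding \<epsilon>_def K_def using half by (intro prob_few_gains) simp
  finally show ?thesis by simp
qed

theorem theorem4:
  fixes d :: nat
  assumes "3 \<le> d"
  shows "\<exists>\<alpha>::real. \<alpha> > 0 \<and>
    (\<exists>c::real. c > 0 \<and>
      (\<exists>N::nat. \<forall>n\<ge>N. \<forall>deg :: nat \<Rightarrow> nat.
        even (\<Sum>i=1..n. deg i) \<and> (\<forall>i\<in>{1..n}. 3 \<le> deg i \<and> deg i \<le> d) \<longrightarrow>
        \<P>((G, X) in graph_age_measure n deg.
            \<exists>C. is_component (layer_graph 3 G X) C \<and> real (card (verts C)) \<ge> \<alpha> * real n)
          \<ge> 1 - exp (- c * real n)))"
proof -
  define \<epsilon> where "\<epsilon> = (1 / (2 * surv_const d)) ^ Suc d"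
  have \<epsilon>: "\<epsilon> > 0" unfolding \<epsilon>_def using surv_const_ge_1[OF assms] by (intro zero_less_power) simp
  \<comment> \<open>The bound \<epsilon> for a gain does not depend on the walk length, so the
    length can be chosen afterwards, long enough for the loss n / (2 m + 1) to be harmless.\<close>
  define m where "m = nat \<lceil>16 / \<epsilon>\<rceil>"
  have m: "1 / real (2 * m + 1) \<le> \<epsilon> / 16"
  proof -
    have "16 / \<epsilon> \<le> real (2 * m + 1)" unfolding m_def by linarith
    then show ?thesis using \<epsilon> by (simp add: field_simps)
  qed
  \<comment> \<open>The radius within which a gain with \<open>Suc m\<close> blocks of two vertices
    reads ages.\<close>
  define R where "R = Suc (2 * Suc m)"
  define K where "K = (d + 1) ^ (2 * R) + 1"
  have K: "K > 0" by (simp add: K_def)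
  have d: "d > 0" using assms by simp
  have "\<epsilon> / 32 > 0" using \<epsilon> by simp
  from few_closing_edges[OF this d, where 'a = nat] obtain \<alpha> N2 where \<alpha>: "\<alpha> > 0"
    and N2: "\<forall>V :: nat set. \<forall>deg. finite V \<longrightarrow> card V \<ge> N2 \<longrightarrow> (\<forall>i\<in>V. 3 \<le> deg i \<and> deg i \<le> d) \<longrightarrow>
      real (card {E \<in> deg_graphs V deg. many_closing V (\<epsilon> / 32) \<alpha> E})
        \<le> exp (- real (card V)) * real (card (deg_graphs V deg))"
    by (elim exE conjE)
  \<comment> \<open>\<open>K\<close> colour classes with at most n / (2 K) bad vertices each leave
    half of the vertices tree-like.\<close>
  have "1 / (2 * real K) > 0" using K by simp
  from few_closing_edges[OF this d, where 'a = nat] obtain \<beta> N1 where \<beta>: "\<beta> > 0"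
    and N1: "\<forall>V :: nat set. \<forall>deg. finite V \<longrightarrow> card V \<ge> N1 \<longrightarrow> (\<forall>i\<in>V. 3 \<le> deg i \<and> deg i \<le> d) \<longrightarrow>
      real (card {E \<in> deg_graphs V deg. many_closing V (1 / (2 * real K)) \<beta> E})
        \<le> exp (- real (card V)) * real (card (deg_graphs V deg))"
    by (elim exE conjE)
  define c1 where "c1 = \<epsilon>\<^sup>2 / (8 * real K)"
  \<comment> \<open>Halving leaves a factor exp (c n) to absorb 2 + K: two terms exp (- n) for
    exceptional graphs and \<open>K\<close> from the colour classes.\<close>
  define c where "c = min 1 c1 / 2"
  have c1: "c1 > 0" using \<epsilon> K by (simp add: c1_def)
  have c: "c > 0" "2 * c \<le> 1" "2 * c \<le> c1" using c1 by (auto simp: c_def)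
  \<comment> \<open>In this order: both switching estimates apply, a ball has at most \<beta> n
    vertices, \<alpha> n \<ge> 1, graphs with the given degrees exist, and exp (c n) \<ge> 2 +
    K.\<close>
  define N where "N = Max {N1, N2, nat \<lceil>real ((d + 1) ^ R) / \<beta>\<rceil>, nat \<lceil>1 / \<alpha>\<rceil>, (d + 1) * (d + 1) + 1, nat \<lceil>(2 + real K) / c\<rceil>}"
  have main: "1 - exp (- c * real n) \<le>
      measure (graph_age_measure n deg) {z \<in> space (graph_age_measure n deg). large_component n \<alpha> (fst z) (snd z)}"
    if n: "n \<ge> N" and even: "even (\<Sum>i=1..n. deg i)" and deg: "\<forall>i\<in>{1..n}. 3 \<le> deg i \<and> deg i \<le> d" for n deg
  proof -
    have n_ge: "n \<ge> N1" "n \<ge> N2" "n \<ge> nat \<lceil>real ((d + 1) ^ R) / \<beta>\<rceil>" "n \<ge> nat \<lceil>1 / \<alpha>\<rceil>"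
      "n \<ge> (d + 1) * (d + 1) + 1" "n \<ge> nat \<lceil>(2 + real K) / c\<rceil>"
      using n unfolding N_def by simp_all
    have n\<beta>: "real ((d + 1) ^ R) \<le> \<beta> * n"
    proof -
      have "real ((d + 1) ^ R) / \<beta> \<le> n" using n_ge(3) by linarith
      then show ?thesis using \<beta> by (simp add: field_simps)
    qed
    have n\<alpha>: "\<alpha> * n \<ge> 1"
    proof -
      have "1 / \<alpha> \<le> n" using n_ge(4) by linarith
      then show ?thesis using \<alpha> by (simp add: field_simps)
    qed
    have nc: "2 + real K \<le> exp (c * n)"
    proof -
      have "(2 + real K) / c \<le> n" using n_ge(6) by linarith
      then have "2 + real K \<le> c * n" using c by (simp add: field_simps)
      then show ?thesis using exp_ge_add_one_self[of "c * n"] by linarith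
    qed
    have npos: "n > 0" using n_ge(5) by linarith
    let ?G = "deg_graphs {1..n} deg" and ?M = "age_measure {1..n}"
    let ?g = "\<lambda>E. \<lparr>pverts = {1..n}, parcs = E\<rparr>"
    have G: "finite ?G" "?G \<noteq> {}"
      using finite_deg_graphs[of "{1..n}" deg] deg_graphs_nonempty[of "{1..n}" deg d] deg even n_ge(5) by auto
    then have Gpos: "card ?G > 0" by (simp add: card_gt_0_iff)
    interpret ages "{1..n}" using npos by unfold_locales auto
    define p where "p E = prob {X \<in> space M. large_component n \<alpha> (?g E) X}" for E
    define B1 where "B1 = {E \<in> ?G. many_closing {1..n} (1 / (2 * real K)) \<beta> E}"
    define B2 where "B2 = {E \<in> ?G. many_closing {1..n} (\<epsilon> / 32) \<alpha> E}"
    have B1: "real (card B1) \<le> exp (- real n) * card ?G"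
      using N1[rule_format, of "{1..n}" deg] n_ge(1) deg by (simp add: B1_def)
    have B2: "real (card B2) \<le> exp (- real n) * card ?G"
      using N2[rule_format, of "{1..n}" deg] n_ge(2) deg by (simp add: B2_def)
    have ev: "{X \<in> space M. large_component n \<alpha> (?g E) X} \<in> events" if "E \<in> ?G" for E
      by (rule large_component_measurable[OF npos that])
    \<comment> \<open>For exceptional graphs the left side is at most 0, so a single inequality can
      be averaged over all graphs.\<close>
    have p_ge: "1 - K * exp (- c1 * n) - of_bool (E \<in> B1) - of_bool (E \<in> B2) \<le> p E" if E: "E \<in> ?G" for E
    proof (cases "E \<in> B1 \<or> E \<in> B2")
      case True
      have "0 \<le> p E" "0 \<le> K * exp (- c1 * n)" by (simp_all add: p_def)
      moreover have "of_bool (E \<in> B1) + of_bool (E \<in> B2) \<ge> (1 :: real)" using True by auto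
      ultimately show ?thesis by linarith
    next
      case False
      then have few: "\<not> many_closing {1..n} (1 / (2 * real K)) \<beta> E" "\<not> many_closing {1..n} (\<epsilon> / 32) \<alpha> E"
        using E by (auto simp: B1_def B2_def)
      have EV: "E \<subseteq> {1..n} \<times> {1..n}" "sym E" "irrefl E" "\<And>i. i \<in> {1..n} \<Longrightarrow> card (E `` {i}) \<le> d"
        using E deg by (auto simp: deg_graphs_def)
      have "real (card {s \<in> {1..n}. \<not> treelike E R s s})
          \<le> real ((d + 1) ^ (2 * R) + 1) * (1 / (2 * real K) * card {1..n})"
        using few(1) n\<beta> by (intro card_not_treelike_le[OF _ EV]) auto
      then have "real (card {s \<in> {1..n}. \<not> treelike E R s s}) \<le> n / 2" using K unfolding K_def[symmetric] by simp
      moreover have "real n = real (card {s \<in> {1..n}. treelike E R s s}) + real (card {s \<in> {1..n}. \<not> treelike E R s s})"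
      proof -
        have "{1..n} = {s \<in> {1..n}. treelike E R s s} \<union> {s \<in> {1..n}. \<not> treelike E R s s}" by auto
        then have "card {1..n} = card ({s \<in> {1..n}. treelike E R s s} \<union> {s \<in> {1..n}. \<not> treelike E R s s})"
          by (rule arg_cong)
        also have "\<dots> = card {s \<in> {1..n}. treelike E R s s} + card {s \<in> {1..n}. \<not> treelike E R s s}"
          by (intro card_Un_disjoint) auto
        finally have "card {1..n} = \<dots>" .
        then show ?thesis by simp
      qed
      ultimately have half: "real (card {s \<in> {1..n}. treelike E R s s}) \<ge> n / 2" by linarith
      have "1 - K * exp (- c1 * n) \<le> p E"
        unfolding p_def c1_def K_def R_def \<epsilon>_def
        by (rule prob_large_component[OF npos _ E]) (use deg half m few(2) n\<alpha> in \<open>auto simp: R_def \<epsilon>_def\<close>)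
      then show ?thesis using False by simp
    qed
    have cnt: "(\<Sum>E\<in>?G. of_bool (E \<in> B)) = real (card B)" if "B \<subseteq> ?G" for B
      using that G(1) by (simp add: of_bool_def sum.If_cases Int_absorb1)
    have "(1 - K * exp (- c1 * n)) * card ?G - card B1 - card B2
        = (\<Sum>E\<in>?G. 1 - K * exp (- c1 * n) - of_bool (E \<in> B1) - of_bool (E \<in> B2))"
      using cnt[of B1] cnt[of B2] by (simp add: sum_subtractf B1_def B2_def)
    also have "\<dots> \<le> (\<Sum>E\<in>?G. p E)" by (intro sum_mono p_ge)
    finally have "(1 - K * exp (- c1 * n) - 2 * exp (- real n)) * card ?G \<le> (\<Sum>E\<in>?G. p E)"
      using B1 B2 by (simp add: algebra_simps)
    then have "1 - K * exp (- c1 * n) - 2 * exp (- real n) \<le> (\<Sum>E\<in>?G. p E) / card ?G"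
      using Gpos by (simp add: field_simps)
    moreover have "1 - exp (- c * n) \<le> 1 - K * exp (- c1 * n) - 2 * exp (- real n)"
    proof -
      have "exp (- c1 * n) \<le> exp (- (2 * c) * n)" "exp (- real n) \<le> exp (- (2 * c) * n)"
        using c mult_right_mono[of "2 * c" c1 n] mult_right_mono[of "2 * c" 1 n] by auto
      then have "K * exp (- c1 * n) + 2 * exp (- real n) \<le> K * exp (- (2 * c) * n) + 2 * exp (- (2 * c) * n)"
        by (intro add_mono mult_left_mono) auto
      also have "\<dots> = (2 + real K) * exp (- (2 * c) * n)" by (simp add: algebra_simps)
      also have "\<dots> \<le> exp (c * n) * exp (- (2 * c) * n)" using nc by (intro mult_right_mono) auto
      also have "\<dots> = exp (- c * n)" by (simp add: exp_add[symmetric])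
      finally show ?thesis by simp
    qed
    moreover have "measure (graph_age_measure n deg) {z \<in> space (graph_age_measure n deg). large_component n \<alpha> (fst z) (snd z)}
       = (\<Sum>E\<in>?G. p E) / card ?G"
    proof -
      have inj: "inj_on ?g ?G" by (auto simp: inj_on_def)
      have "measure (graph_age_measure n deg) {z \<in> space (graph_age_measure n deg). large_component n \<alpha> (fst z) (snd z)}
        = (\<Sum>G\<in>?g ` ?G. prob {X \<in> space M. large_component n \<alpha> G X}) / card (?g ` ?G)"
        unfolding graph_age_measure_def graphs_with_degrees_eq
        using G ev prob_space_axioms by (intro measure_slices) auto
      then show ?thesis using inj by (simp add: sum.reindex card_image p_def)
    qed
    ultimately show ?thesis by linarith
  qed
  show ?thesis
  proof (rule exI[of _ \<alpha>], rule conjI[OF \<alpha>], rule exI[of _ c], rule conjI[OF c(1)],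
      rule exI[of _ N], intro allI impI)
    fix n deg assume "n \<ge> N" and "even (\<Sum>i=1..n. deg i) \<and> (\<forall>i\<in>{1..n}. 3 \<le> deg i \<and> deg i \<le> d)"
    then show "1 - exp (- c * real n) \<le> \<P>((G, X) in graph_age_measure n deg.
            \<exists>C. is_component (layer_graph 3 G X) C \<and> real (card (verts C)) \<ge> \<alpha> * real n)"
      using main[of n deg] by (simp add: large_component_def case_prod_unfold)
  qed
qed

end
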